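(* Let $G$ be a minimally 2-rigid graph with $n\ge 3$ vertices and graphic matroid $M_G$. Then the following three values are equal, and $2c_2(G)$ is bounded above by their common value: (1) the Tutte polynomial evaluation $T(M_G;1,0)$; (2) the absolute value of the constant term of the characteristic polynomial $\chi_{M_G}(\lambda)$; (3) the absolute value of the coefficient of the linear term of the chromatic polynomial $P(G;\lambda)$ of $G$.
   Context: **Rigidity.** Graphs are finite, simple, undirected, with vertex set $[n]$ and edge set $E$. A framework $(G,p)$ with $p:[n]\to\mathbb{R}^d$ is rigid if every edge-length preserving continuous deformation of the vertices comes from isometries of $\mathbb{R}^d$. $G$ is $d$-rigid if $(G,p)$ is rigid for almost all $p$ (all $p$ in some non-empty Zariski open set), and minimally $d$-rigid if moreover $G-e$ is not $d$-rigid for every edge $e$. **Realisation number.** Let $f_{G,d}:\mathbb{C}^{n\cdot d}\to\mathbb{C}^{E}$, $p\mapsto \frac12\big(\sum_{k=1}^d (p_{i,k}-p_{j,k})^2\big)_{ij\in E}$. Write $p\sim q$ if there are $A\in O(d,\mathbb{C})$ (complex matrices with $A^TA=AA^T=I$) and $x\in\mathbb{C}^d$ with $p_i=Aq_i+x$ for all $i$. For a $d$-rigid graph with $n\ge d+1$, $f_{G,d}^{-1}(f_{G,d}(p))/\!\sim$ has the same finite cardinality for all generic $p\in\mathbb{C}^{n\cdot d}$; this is the $d$-realisation number $c_d(G)$. **Polynomials.** The graphic matroid $M_G$ is the matroid on $E$ whose circuits are the cycles of $G$. For a matroid $M$ on $E$ with rank function $r$: $T(M;x,y)=\sum_{A\subseteq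 E}(x-1)^{r(E)-r(A)}(y-1)^{|A|-r(A)}$ and $\chi_M(\lambda)=\sum_{A\subseteq E}(-1)^{|A|}\lambda^{r(E)-r(A)}$. The chromatic polynomial $P(G;\lambda)$ is the unique polynomial whose value at each integer $k\ge0$ is the number of proper $k$-colourings of $G$. *)

theory Defs
  imports "HOL-Analysis.Analysis" "HOL-Computational_Algebra.Polynomial"
begin

definition simple_graph :: "nat \<Rightarrow> nat set set \<Rightarrow> bool" where
  "simple_graph n E \<longleftrightarrow> E \<subseteq> {e. e \<subseteq> {1..n} \<and> card e = 2}"

text \<open>Edge sets of cycles: the list \<open>vs\<close> enumerates the vertices of the cycle in cyclic order.\<close>

definition cycles :: "nat set set \<Rightarrow> nat set set set" where
  "cycles E = {C. C \<subseteq> E \<and> (\<exists>vs. distinct vs \<and> length vs \<ge> 3 \<and>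
     C = {{vs ! i, vs ! (Suc i mod length vs)} |i. i < length vs})}"

text \<open>The space of configurations of n points in d-dimensional space over \<open>'a\<close>; the dimension
  d is \<open>CARD('d)\<close>. Configurations are \<open>undefined\<close> outside the vertex set \<open>{1..n}\<close>, so that they correspond
  exactly to points of \<open>'a\<^bsup>n\<cdot>d\<^esup>\<close>.\<close>

definition configs :: "nat \<Rightarrow> (nat \<Rightarrow> 'a ^ 'd) set" where
  "configs n = {1..n} \<rightarrow>\<^sub>E UNIV"

inductive_set poly_funs :: "nat \<Rightarrow> ((nat \<Rightarrow> 'a::comm_ring_1 ^ 'd) \<Rightarrow> 'a) set" for n :: nat where
  const: "(\<lambda>p. c) \<in> poly_funs n"
| coord: "i \<in> {1..n} \<Longrightarrow> (\<lambda>p. p i $ k) \<in> poly_funs n"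
| add: "f \<in> poly_funs n \<Longrightarrow> g \<in> poly_funs n \<Longrightarrow> (\<lambda>p. f p + g p) \<in> poly_funs n"
| mult: "f \<in> poly_funs n \<Longrightarrow> g \<in> poly_funs n \<Longrightarrow> (\<lambda>p. f p * g p) \<in> poly_funs n"

definition zariski_open :: "nat \<Rightarrow> (nat \<Rightarrow> 'a::field ^ 'd) set \<Rightarrow> bool" where
  "zariski_open n U \<longleftrightarrow>
     (\<exists>F \<subseteq> poly_funs n. U = configs n - {p. \<forall>f\<in>F. f p = 0})"

definition for_generic :: "nat \<Rightarrow> ((nat \<Rightarrow> 'a::field ^ 'd) \<Rightarrow> bool) \<Rightarrow> bool" where
  "for_generic n Q \<longleftrightarrow> (\<exists>U. zariski_open n U \<and> U \<noteq> {} \<and> (\<forall>p\<in>U. Q p))"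

definition rigid_framework :: "nat \<Rightarrow> nat set set \<Rightarrow> (nat \<Rightarrow> real ^ 'd) \<Rightarrow> bool" where
  "rigid_framework n E p \<longleftrightarrow>
     (\<forall>P :: real \<Rightarrow> nat \<Rightarrow> real ^ 'd.
        (\<forall>i\<in>{1..n}. continuous_on {0..1} (\<lambda>t. P t i)) \<and>
        (\<forall>i\<in>{1..n}. P 0 i = p i) \<and>
        (\<forall>t\<in>{0..1}. \<forall>i j. {i, j} \<in> E \<longrightarrow> dist (P t i) (P t j) = dist (p i) (p j))
        \<longrightarrow> (\<forall>t\<in>{0..1}. \<exists>g :: real ^ 'd \<Rightarrow> real ^ 'd.
              (\<forall>x y. dist (g x) (g y) = dist x y) \<and> (\<forall>i\<in>{1..n}. P t i = g (p i))))"

definition rigid_graph :: "'d::finite itself \<Rightarrow> nat \<Rightarrow> nat set set \<Rightarrow> bool" where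
  "rigid_graph _ n E \<longleftrightarrow> for_generic n (\<lambda>p :: nat \<Rightarrow> real ^ 'd. rigid_framework n E p)"

definition minimally_rigid_graph :: "'d::finite itself \<Rightarrow> nat \<Rightarrow> nat set set \<Rightarrow> bool" where
  "minimally_rigid_graph d n E \<longleftrightarrow>
     rigid_graph d n E \<and> (\<forall>e\<in>E. \<not> rigid_graph d n (E - {e}))"

text \<open>An edge \<open>e\<close> has end points \<open>Min e\<close> and \<open>Max e\<close>; their order is irrelevant below.\<close>

definition measurement :: "nat set set \<Rightarrow> (nat \<Rightarrow> complex ^ 'd) \<Rightarrow> nat set \<Rightarrow> complex" where
  "measurement E p = (\<lambda>e\<in>E. 1 / 2 * (\<Sum>k\<in>UNIV. (p (Min e) $ k - p (Max e) $ k)\<^sup>2))"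

definition congruence :: "nat \<Rightarrow> ((nat \<Rightarrow> complex ^ 'd) \<times> (nat \<Rightarrow> complex ^ 'd)) set" where
  "congruence n = {(p, q). p \<in> configs n \<and> q \<in> configs n \<and>
     (\<exists>(A :: complex ^ 'd ^ 'd) x. orthogonal_matrix A \<and> (\<forall>i\<in>{1..n}. p i = A *v q i + x))}"

definition realisations :: "nat \<Rightarrow> nat set set \<Rightarrow> (nat \<Rightarrow> complex ^ 'd) \<Rightarrow> (nat \<Rightarrow> complex ^ 'd) set set" where
  "realisations n E p = {q \<in> configs n. measurement E q = measurement E p} // congruence n"

text \<open>Well defined for d-rigid graphs with at least d + 1 vertices.\<close>

definition realisation_number :: "'d::finite itself \<Rightarrow> nat \<Rightarrow> nat set set \<Rightarrow> nat" where
  "realisation_number _ n E = (THE N. for_generic n (\<lambda>p :: nat \<Rightarrow> complex ^ 'd.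
     finite (realisations n E p) \<and> card (realisations n E p) = N))"

text \<open>A matroid is represented by its ground set and its circuits. A set is independent iff it
  contains no circuit, and the rank of a set is the largest size of an independent subset.\<close>

record 'a matroid =
  ground :: "'a set"
  circuits :: "'a set set"

definition matroid_indep :: "'a matroid \<Rightarrow> 'a set \<Rightarrow> bool" where
  "matroid_indep M X \<longleftrightarrow> X \<subseteq> ground M \<and> \<not> (\<exists>C\<in>circuits M. C \<subseteq> X)"

definition matroid_rank :: "'a matroid \<Rightarrow> 'a set \<Rightarrow> nat" where
  "matroid_rank M A = Max (card ` {X. X \<subseteq> A \<and> matroid_indep M X})"

definition tutte :: "'a matroid \<Rightarrow> 'b::comm_ring_1 \<Rightarrow> 'b \<Rightarrow> 'b" where
  "tutte M x y = (\<Sum>A\<in>Pow (ground M).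
     (x - 1) ^ (matroid_rank M (ground M) - matroid_rank M A) * (y - 1) ^ (card A - matroid_rank M A))"

definition characteristic_poly :: "'a matroid \<Rightarrow> int poly" where
  "characteristic_poly M = (\<Sum>A\<in>Pow (ground M).
     monom ((-1) ^ card A) (matroid_rank M (ground M) - matroid_rank M A))"

definition graphic_matroid :: "nat set set \<Rightarrow> nat set matroid" where
  "graphic_matroid E = \<lparr>ground = E, circuits = cycles E\<rparr>"

definition proper_colourings :: "nat \<Rightarrow> nat set set \<Rightarrow> nat \<Rightarrow> (nat \<Rightarrow> nat) set" where
  "proper_colourings n E k =
     {c \<in> {1..n} \<rightarrow>\<^sub>E {..<k}. \<forall>i j. {i, j} \<in> E \<longrightarrow> c i \<noteq> c j}"

definition chromatic_poly :: "nat \<Rightarrow> nat set set \<Rightarrow> int poly" where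
  "chromatic_poly n E =
     (THE P. \<forall>k. poly P (int k) = int (card (proper_colourings n E k)))"

end

theory Submission
  imports Defs "HOL-Computational_Algebra.Fundamental_Theorem_Algebra"
begin

text \<open>
  In the coordinates \<open>u = x + \<i> y\<close>, \<open>v = x - \<i> y\<close> the squared length of an edge is the product of the
  \<open>u\<close>- and the \<open>v\<close>-difference along it. So a realisation of the edge measurements \<open>\<lambda>\<close> is a point of the
  graphic arrangement (the \<open>u\<close>-differences) whose reciprocal, scaled by \<open>\<lambda>\<close>, again consists of
  differences, and every congruence class yields two such points up to scaling, because reflections
  swap \<open>u\<close> and \<open>v\<close>. Monomials in the reciprocals of differences are spanned by those whose support
  contains no broken circuit. Counting them against the monomials in \<open>n - 1\<close> linear forms that cut
  out the fibre, times powers of a further linear form, produces an equation for that form of degree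
  at most the number of nbc bases; since the fibre is a limit of nearby ones along which \<open>\<lambda>\<close> moves
  linearly, the equation survives on the fibre. By Whitney's toggling involution, the number of nbc bases is
  the common value of the three graph invariants.

  Minimal rigidity enters twice: a dimension count with an explicit flex (a contraction argument)
  gives at least \<open>2n - 3\<close> edges, and minimality makes the edge measurements algebraically independent,
  since a measurement that is algebraic over the others is constant along a flex. That the generic
  fibre has a constant cardinality follows from Chevalley's theorem on constructible sets.
\<close>

section \<open>Polynomial functions and generic points\<close>

text \<open>Why the count succeeds: in degree \<open>k\<close> the nbc monomials number about
  \<open>T * k ^ (n - 2) / (n - 2)!\<close>, where \<open>T\<close> is the number of nbc bases,
  while monomials of degree \<open>k - T\<close> in \<open>n - 1\<close> forms, each combined with
  \<open>T + 1\<close> powers of one more form, number about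
  \<open>(T + 1) * k ^ (n - 2) / (n - 2)!\<close>. A comparison of growth rates thus takes the place
  of degrees and intersection numbers. The obstacle is that \<open>n - 2\<close> of the forms vanish
  identically on the fibre, where the relation found might read \<open>0 = 0\<close>. Therefore the
  measurements are variables while the relation is produced, and only its lowest-order part in these
  forms is specialised. Two things can still go wrong at the end: the coefficients of the equation
  may vanish at the given measurements, which algebraic independence excludes, and two points may
  have the same value under the extra form, which is why the coefficients of that form are
  parameters as well. Finally the two points of one class must differ; if they did not, every
  measurement would be the square of a difference along a line, and this would make at least
  \<open>n\<close> independent quantities depend on \<open>n - 1\<close> parameters.\<close>

definition mon :: "'i set \<Rightarrow> ('i \<Rightarrow> nat) \<Rightarrow> ('i \<Rightarrow> 'a::comm_ring_1) \<Rightarrow> 'a" where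
  "mon I \<eta> v = (\<Prod>i\<in>I. v i ^ \<eta> i)"

lemma poly_sum_monom_zero:
  fixes c :: "nat \<Rightarrow> 'a::{idom,ring_char_0}"
  assumes "finite M" "\<And>x. (\<Sum>m\<in>M. c m * x ^ m) = 0" "m \<in> M"
  shows "c m = 0"
proof -
  have "poly (\<Sum>m\<in>M. monom (c m) m) = (\<lambda>x. 0)"
    using assms(2) by (auto simp: poly_sum poly_monom)
  then have "(\<Sum>m\<in>M. monom (c m) m) = 0"
    using poly_all_0_iff_0 by (metis)
  then have "coeff (\<Sum>m\<in>M. monom (c m) m) m = 0" by simp
  then show ?thesis using assms(1,3)
    by (simp add: coeff_sum if_distrib cong: if_cong)
qed

text \<open>With all other variables frozen, a vanishing sum is a vanishing univariate polynomial in
  the variable \<open>i\<close>, so each coefficient vanishes and the induction applies to it.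
  Exponent functions are extensional so that distinct members of \<open>\<Lambda>\<close> are
  distinct monomials.\<close>

lemma mon_indep:
  fixes \<kappa> :: "('i \<Rightarrow> nat) \<Rightarrow> 'a::{idom,ring_char_0}"
  assumes "finite I" "finite \<Lambda>" "\<Lambda> \<subseteq> (I \<rightarrow>\<^sub>E UNIV)"
    and "\<And>v. (\<Sum>\<eta>\<in>\<Lambda>. \<kappa> \<eta> * mon I \<eta> v) = 0" "\<eta> \<in> \<Lambda>"
  shows "\<kappa> \<eta> = 0"
  using assms
proof (induction I arbitrary: \<Lambda> \<kappa> \<eta> rule: finite_induct)
  case empty
  then have "\<Lambda> = {\<eta>}" by auto
  then show ?case using empty(3) by (simp add: mon_def)
next
  case (insert i I)
  let ?m = "\<eta> i"
  let ?L = "\<lambda>m. {\<zeta>\<in>\<Lambda>. \<zeta> i = m}"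
  let ?r = "\<lambda>\<zeta>. \<zeta>(i := undefined)"
  have split: "mon (insert i I) \<zeta> (v(i:=x)) = x ^ \<zeta> i * mon I (?r \<zeta>) v" for \<zeta> and v :: "'i \<Rightarrow> 'a" and x
  proof -
    have "(\<Prod>j\<in>I. (v(i:=x)) j ^ \<zeta> j) = (\<Prod>j\<in>I. v j ^ (?r \<zeta>) j)"
      by (rule prod.cong) (use insert(2) in auto)
    then show ?thesis unfolding mon_def using insert(1,2) by simp
  qed
  have zero: "(\<Sum>\<zeta>\<in>?L ?m. \<kappa> \<zeta> * mon I (?r \<zeta>) v) = 0" for v :: "'i \<Rightarrow> 'a"
  proof (rule poly_sum_monom_zero[where M = "(\<lambda>\<zeta>. \<zeta> i) ` \<Lambda>"
          and c = "\<lambda>m. \<Sum>\<zeta>\<in>?L m. \<kappa> \<zeta> * mon I (?r \<zeta>) v"])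
    show "finite ((\<lambda>\<zeta>. \<zeta> i) ` \<Lambda>)" using insert by simp
    show "?m \<in> (\<lambda>\<zeta>. \<zeta> i) ` \<Lambda>" using insert by simp
    fix x :: 'a
    have "(\<Sum>m\<in>(\<lambda>\<zeta>. \<zeta> i) ` \<Lambda>. (\<Sum>\<zeta>\<in>?L m. \<kappa> \<zeta> * mon I (?r \<zeta>) v) * x ^ m)
      = (\<Sum>m\<in>(\<lambda>\<zeta>. \<zeta> i) ` \<Lambda>. (\<Sum>\<zeta>\<in>?L m. \<kappa> \<zeta> * mon (insert i I) \<zeta> (v(i:=x))))"
      by (intro sum.cong refl) (auto simp: split sum_distrib_right intro!: sum.cong)
    also have "\<dots> = (\<Sum>\<zeta>\<in>\<Lambda>. \<kappa> \<zeta> * mon (insert i I) \<zeta> (v(i:=x)))"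
      using insert(4) sum.image_gen[of \<Lambda> "\<lambda>\<zeta>. \<kappa> \<zeta> * mon (insert i I) \<zeta> (v(i:=x))" "\<lambda>\<zeta>. \<zeta> i"] by simp
    also have "\<dots> = 0" by (rule insert(6))
    finally show "(\<Sum>m\<in>(\<lambda>\<zeta>. \<zeta> i) ` \<Lambda>. (\<Sum>\<zeta>\<in>?L m. \<kappa> \<zeta> * mon I (?r \<zeta>) v) * x ^ m) = 0" .
  qed
  have upd: "(?r \<zeta>)(i := ?m) = \<zeta>" if "\<zeta> \<in> ?L ?m" for \<zeta> using that by auto
  then have inj: "inj_on ?r (?L ?m)" by (metis (no_types, lifting) inj_onI)
  have "\<kappa> ((?r \<eta>)(i := ?m)) = 0"
  proof (rule insert(3)[of "?r ` ?L ?m" "\<lambda>\<zeta>. \<kappa> (\<zeta>(i := ?m))" "?r \<eta>"])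
    show "finite (?r ` ?L ?m)" using insert(4) by simp
    show "?r ` ?L ?m \<subseteq> I \<rightarrow>\<^sub>E UNIV" using insert(2,5) by (fastforce simp: PiE_iff extensional_def)
    show "?r \<eta> \<in> ?r ` ?L ?m" using insert(7) by auto
    fix v :: "'i \<Rightarrow> 'a"
    show "(\<Sum>\<zeta>\<in>?r ` ?L ?m. \<kappa> (\<zeta>(i := ?m)) * mon I \<zeta> v) = 0"
      unfolding sum.reindex[OF inj] comp_def using zero[of v] upd
      by (metis (mono_tags, lifting) sum.cong)
  qed
  then show ?case by simp
qed

text \<open>Unlike in \<open>poly_funs\<close>, the variables form an arbitrary index type and are
  not grouped into vectors; this is the form used for substitution, for restriction to lines and for
  quantifier elimination.\<close>

inductive_set polyfn :: "(('i \<Rightarrow> 'a::comm_ring_1) \<Rightarrow> 'a) set" where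
  polyfn_const: "(\<lambda>v. c) \<in> polyfn"
| polyfn_var: "(\<lambda>v. v i) \<in> polyfn"
| polyfn_add: "f \<in> polyfn \<Longrightarrow> g \<in> polyfn \<Longrightarrow> (\<lambda>v. f v + g v) \<in> polyfn"
| polyfn_mult: "f \<in> polyfn \<Longrightarrow> g \<in> polyfn \<Longrightarrow> (\<lambda>v. f v * g v) \<in> polyfn"

lemma polyfn_minus: "f \<in> polyfn \<Longrightarrow> g \<in> polyfn \<Longrightarrow> (\<lambda>v. f v - g v) \<in> polyfn"
  using polyfn_add[OF _ polyfn_mult[OF polyfn_const[of "-1"]], of f g] by simp

lemma polyfn_power: "f \<in> polyfn \<Longrightarrow> (\<lambda>v. f v ^ k) \<in> polyfn"
  by (induction k) (auto intro: polyfn_const polyfn_mult)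

lemma polyfn_sum: "(\<And>a. a \<in> A \<Longrightarrow> f a \<in> polyfn) \<Longrightarrow> (\<lambda>v. \<Sum>a\<in>A. f a v) \<in> polyfn"
  by (induction A rule: infinite_finite_induct) (auto intro: polyfn_const polyfn_add)

lemma polyfn_prod: "(\<And>a. a \<in> A \<Longrightarrow> f a \<in> polyfn) \<Longrightarrow> (\<lambda>v. \<Prod>a\<in>A. f a v) \<in> polyfn"
  by (induction A rule: infinite_finite_induct) (auto intro: polyfn_const polyfn_mult)

lemma polyfn_mon: "(\<lambda>v. mon I \<eta> v) \<in> polyfn"
  unfolding mon_def by (intro polyfn_prod polyfn_power polyfn_var)

lemma polyfn_subst: "f \<in> polyfn \<Longrightarrow> (\<And>i. \<phi> i \<in> polyfn) \<Longrightarrow> (\<lambda>v. f (\<lambda>i. \<phi> i v)) \<in> polyfn"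
  by (induction rule: polyfn.induct) (auto intro: polyfn_const polyfn_mult polyfn_add)

lemma polyfn_line:
  assumes "f \<in> polyfn"
  shows "\<exists>P. \<forall>t. f (\<lambda>i. a i + t * b i) = poly P t"
  using assms
proof (induction rule: polyfn.induct)
  case (polyfn_const c)
  have "\<forall>t. c = poly [:c:] t" by simp then show ?case by blast
next
  case (polyfn_var i)
  have "\<forall>t. a i + t * b i = poly [:a i, b i:] t" by simp then show ?case by blast
next
  case (polyfn_add f g) then show ?case by (metis poly_add)
next
  case (polyfn_mult f g) then show ?case by (metis poly_mult)
qed

text \<open>On the line from \<open>a\<close> to \<open>b\<close> both functions become nonzero
  univariate polynomials, and the product of these is nonzero somewhere.\<close>

lemma polyfn_nonzero_both:
  fixes f g :: "('i \<Rightarrow> 'a::{idom,ring_char_0}) \<Rightarrow> 'a"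
  assumes "f \<in> polyfn" "g \<in> polyfn" "f a \<noteq> 0" "g b \<noteq> 0"
  obtains c where "f c \<noteq> 0" "g c \<noteq> 0"
proof -
  obtain P where P: "\<And>t. f (\<lambda>i. a i + t * (b i - a i)) = poly P t" using polyfn_line[OF assms(1)] by metis
  obtain Q where Q: "\<And>t. g (\<lambda>i. a i + t * (b i - a i)) = poly Q t" using polyfn_line[OF assms(2)] by metis
  have "P \<noteq> 0" using P[of 0] assms(3) by auto
  moreover have "Q \<noteq> 0" using Q[of 1] assms(4) by auto
  ultimately have "P * Q \<noteq> 0" by simp
  then obtain t where "poly (P * Q) t \<noteq> 0" using poly_all_0_iff_0 by blast
  then have "poly P t \<noteq> 0" "poly Q t \<noteq> 0" by auto
  then show thesis using P[of t] Q[of t] that by metis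
qed

lemma polyfn_nonzero_all:
  fixes f :: "'b \<Rightarrow> ('i \<Rightarrow> 'a::{idom,ring_char_0}) \<Rightarrow> 'a"
  assumes "finite B" "\<And>b. b \<in> B \<Longrightarrow> f b \<in> polyfn" "\<And>b. b \<in> B \<Longrightarrow> \<exists>v. f b v \<noteq> 0"
  obtains v where "\<And>b. b \<in> B \<Longrightarrow> f b v \<noteq> 0"
proof -
  have "\<exists>v. (\<Prod>b\<in>B. f b v) \<noteq> 0" using assms
  proof (induction B rule: finite_induct)
    case empty then show ?case by simp
  next
    case (insert b B)
    obtain v where v: "(\<Prod>b\<in>B. f b v) \<noteq> 0" using insert by auto
    obtain w where w: "f b w \<noteq> 0" using insert(5) by blast
    obtain c where "f b c \<noteq> 0" "(\<Prod>b\<in>B. f b c) \<noteq> 0"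
      using polyfn_nonzero_both[of "f b" "\<lambda>v. \<Prod>b\<in>B. f b v", OF _ _ w v] insert(4) polyfn_prod[of B f]
      by blast
    then show ?case using insert(1,2) by auto
  qed
  then show thesis using that assms(1) by (metis prod_zero)
qed

lemma poly_funs_subst:
  assumes "g \<in> polyfn" "\<And>j. \<phi> j \<in> poly_funs n"
  shows "(\<lambda>p. g (\<lambda>j. \<phi> j p)) \<in> poly_funs n"
  using assms(1) by (induction rule: polyfn.induct) (auto intro: poly_funs.intros assms(2))

lemma poly_funs_flat:
  assumes "f \<in> poly_funs n"
  shows "\<exists>g\<in>polyfn. \<forall>p. f p = g (\<lambda>(i,k). p i $ k)"
  using assms
proof (induction rule: poly_funs.induct)
  case (const c) show ?case by (intro bexI[of _ "\<lambda>v. c"]) (auto intro: polyfn.intros)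
next
  case (coord i k) show ?case by (intro bexI[of _ "\<lambda>v. v (i,k)"]) (auto intro: polyfn.intros)
next
  case (add f g)
  then obtain f' g' where "f' \<in> polyfn" "g' \<in> polyfn" "\<And>p. f p = f' (\<lambda>(i,k). p i $ k)"
    "\<And>p. g p = g' (\<lambda>(i,k). p i $ k)" by auto
  then show ?case by (intro bexI[of _ "\<lambda>v. f' v + g' v"]) (auto intro: polyfn.intros)
next
  case (mult f g)
  then obtain f' g' where "f' \<in> polyfn" "g' \<in> polyfn" "\<And>p. f p = f' (\<lambda>(i,k). p i $ k)"
    "\<And>p. g p = g' (\<lambda>(i,k). p i $ k)" by auto
  then show ?case by (intro bexI[of _ "\<lambda>v. f' v * g' v"]) (auto intro: polyfn.intros)
qed

lemma poly_funs_minus: "f \<in> poly_funs n \<Longrightarrow> g \<in> poly_funs n \<Longrightarrow> (\<lambda>p. f p - g p) \<in> poly_funs n"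
  using poly_funs.add[OF _ poly_funs.mult[OF poly_funs.const[of "-1"]], of f n g] by simp

lemma poly_funs_sum: "(\<And>a. a \<in> A \<Longrightarrow> f a \<in> poly_funs n) \<Longrightarrow> (\<lambda>v. \<Sum>a\<in>A. f a v) \<in> poly_funs n"
  by (induction A rule: infinite_finite_induct) (auto intro: poly_funs.intros)

lemma poly_funs_cong:
  "f \<in> poly_funs n \<Longrightarrow> (\<And>i. i \<in> {1..n} \<Longrightarrow> p i = q i) \<Longrightarrow> f p = f q"
  by (induction rule: poly_funs.induct) auto

lemma restrict_configs: "restrict p {1..n} \<in> configs n"
  unfolding configs_def by auto

text \<open>A nonempty Zariski open set contains the nonvanishing set of a single polynomial. The
  witness \<open>p\<close> need not be a configuration, because members of
  \<open>poly_funs n\<close> see only the vertices in \<open>{1..n}\<close>.\<close>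

lemma for_generic_iff:
  "for_generic n Q \<longleftrightarrow> (\<exists>f\<in>poly_funs n. (\<exists>p. f p \<noteq> 0) \<and> (\<forall>p\<in>configs n. f p \<noteq> 0 \<longrightarrow> Q p))"
proof
  assume "for_generic n Q"
  then obtain F where F: "F \<subseteq> poly_funs n" "configs n - {p. \<forall>f\<in>F. f p = 0} \<noteq> {}"
    "\<forall>p\<in>configs n - {p. \<forall>f\<in>F. f p = 0}. Q p"
    unfolding for_generic_def zariski_open_def by auto
  then obtain p f where "p \<in> configs n" "f \<in> F" "f p \<noteq> 0" by auto
  then show "\<exists>f\<in>poly_funs n. (\<exists>p. f p \<noteq> 0) \<and> (\<forall>p\<in>configs n. f p \<noteq> 0 \<longrightarrow> Q p)"
    using F by (intro bexI[of _ f]) auto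
next
  assume "\<exists>f\<in>poly_funs n. (\<exists>p. f p \<noteq> 0) \<and> (\<forall>p\<in>configs n. f p \<noteq> 0 \<longrightarrow> Q p)"
  then obtain f p where f: "f \<in> poly_funs n" "f p \<noteq> 0" "\<forall>p\<in>configs n. f p \<noteq> 0 \<longrightarrow> Q p" by auto
  have "f (restrict p {1..n}) \<noteq> 0" using poly_funs_cong[OF f(1), of p "restrict p {1..n}"] f(2) by simp
  then have "restrict p {1..n} \<in> configs n - {p. \<forall>f\<in>{f}. f p = 0}" using restrict_configs by simp
  then show "for_generic n Q"
    unfolding for_generic_def zariski_open_def using f
    by (intro exI[of _ "configs n - {p. \<forall>f\<in>{f}. f p = 0}"]) blast
qed

lemma for_generic_mono: "for_generic n P \<Longrightarrow> (\<And>p. p \<in> configs n \<Longrightarrow> P p \<Longrightarrow> Q p) \<Longrightarrow> for_generic n Q"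
  unfolding for_generic_iff by blast

text \<open>This is the irreducibility of affine space. It also makes the generic number of
  realisations unique at the end.\<close>

lemma for_generic_conj:
  fixes P Q :: "(nat \<Rightarrow> 'a::{field,ring_char_0} ^ 'd::finite) \<Rightarrow> bool"
  assumes "for_generic n P" "for_generic n Q"
  shows "for_generic n (\<lambda>p. P p \<and> Q p)"
proof -
  obtain f p where f: "f \<in> poly_funs n" "f p \<noteq> 0" "\<forall>p\<in>configs n. f p \<noteq> 0 \<longrightarrow> P p"
    using assms(1) unfolding for_generic_iff by auto
  obtain g q where g: "g \<in> poly_funs n" "g q \<noteq> 0" "\<forall>p\<in>configs n. g p \<noteq> 0 \<longrightarrow> Q p"
    using assms(2) unfolding for_generic_iff by auto
  obtain f' where f': "f' \<in> polyfn" "\<And>p. f p = f' (\<lambda>(i,k). p i $ k)" using poly_funs_flat[OF f(1)] by auto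
  obtain g' where g': "g' \<in> polyfn" "\<And>p. g p = g' (\<lambda>(i,k). p i $ k)" using poly_funs_flat[OF g(1)] by auto
  obtain c where c: "f' c \<noteq> 0" "g' c \<noteq> 0"
    using polyfn_nonzero_both[OF f'(1) g'(1)] f(2) g(2) f'(2) g'(2) by metis
  define r where "r = (\<lambda>i. \<chi> k. c (i,k))"
  have "(\<lambda>(i,k). r i $ k) = c" by (auto simp: r_def)
  then have "f r * g r \<noteq> 0" using c f'(2) g'(2) by simp
  then show ?thesis unfolding for_generic_iff
    using f g by (intro bexI[of _ "\<lambda>p. f p * g p"]) (auto intro: poly_funs.mult)
qed

lemma for_generic_True: "for_generic n (\<lambda>p :: nat \<Rightarrow> 'a::field ^ 'd::finite. True)"
  unfolding for_generic_iff by (intro bexI[of _ "\<lambda>p. 1"]) (auto intro: poly_funs.const)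

lemma for_generic_ball:
  fixes P :: "'b \<Rightarrow> (nat \<Rightarrow> 'a::{field,ring_char_0} ^ 'd::finite) \<Rightarrow> bool"
  assumes "finite B" "\<And>b. b \<in> B \<Longrightarrow> for_generic n (P b)"
  shows "for_generic n (\<lambda>p. \<forall>b\<in>B. P b p)"
  using assms
proof (induction B rule: finite_induct)
  case empty then show ?case by (simp add: for_generic_True)
next
  case (insert b B)
  then have "for_generic n (\<lambda>p. P b p \<and> (\<forall>b\<in>B. P b p))" by (intro for_generic_conj) auto
  then show ?case by simp
qed

lemma for_generic_nonzero:
  "f \<in> poly_funs n \<Longrightarrow> f p \<noteq> 0 \<Longrightarrow> for_generic n (\<lambda>p. f p \<noteq> 0)"
  unfolding for_generic_iff by auto

lemma for_generic_ex: "for_generic n P \<Longrightarrow> \<exists>p\<in>configs n. P p"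
  unfolding for_generic_def zariski_open_def by blast

section \<open>Linear algebra by elimination\<close>

lemma kernel_vector:
  fixes a :: "'e \<Rightarrow> 'i \<Rightarrow> 'a::field"
  assumes "finite F" "finite I" "card F < card I"
  shows "\<exists>h. (\<forall>i. i \<notin> I \<longrightarrow> h i = 0) \<and> (\<exists>i\<in>I. h i \<noteq> 0) \<and> (\<forall>e\<in>F. (\<Sum>i\<in>I. a e i * h i) = 0)"
  using assms
proof (induction F arbitrary: I a rule: finite_induct)
  case empty
  then obtain j where "j \<in> I" by fastforce
  then show ?case by (intro exI[of _ "\<lambda>i. if i = j then 1 else 0"]) auto
next
  case (insert e F)
  show ?case
  proof (cases "\<forall>i\<in>I. a e i = 0")
    case True
    have "card F < card I" using insert by simp
    then show ?thesis using insert.IH[of I a] insert(4) True by simp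
  next
    case False
    then obtain j where j: "j \<in> I" "a e j \<noteq> 0" by auto
    let ?I = "I - {j}"
    have "card F < card ?I" using insert j by simp
    then obtain h where h: "\<forall>i. i \<notin> ?I \<longrightarrow> h i = 0" "\<exists>i\<in>?I. h i \<noteq> 0"
      "\<forall>f\<in>F. (\<Sum>i\<in>?I. (a f i - a f j * a e i / a e j) * h i) = 0"
      using insert.IH[of ?I "\<lambda>f i. a f i - a f j * a e i / a e j"] insert(4) by auto
    define s where "s = (\<Sum>i\<in>?I. a e i * h i)"
    \<comment> \<open>The equation of \<open>e\<close> is solved for the unknown \<open>j\<close>,
      whose coefficient is the pivot.\<close>
    define h' where "h' = h(j := - s / a e j)"
    have sum: "(\<Sum>i\<in>I. a f i * h' i) = a f j * (- s / a e j) + (\<Sum>i\<in>?I. a f i * h i)" for f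
    proof -
      have "(\<Sum>i\<in>I. a f i * h' i) = a f j * h' j + (\<Sum>i\<in>?I. a f i * h' i)"
        using insert(4) j(1) by (simp add: sum.remove)
      also have "(\<Sum>i\<in>?I. a f i * h' i) = (\<Sum>i\<in>?I. a f i * h i)" by (auto simp: h'_def intro: sum.cong)
      finally show ?thesis by (simp add: h'_def)
    qed
    have "(\<Sum>i\<in>I. a f i * h' i) = 0" if "f \<in> F" for f
    proof -
      have "0 = (\<Sum>i\<in>?I. (a f i - a f j * a e i / a e j) * h i)" using h(3) that by simp
      also have "\<dots> = (\<Sum>i\<in>?I. a f i * h i - (a f j / a e j) * (a e i * h i))"
        by (rule sum.cong) (simp_all add: left_diff_distrib)
      also have "\<dots> = (\<Sum>i\<in>?I. a f i * h i) - (a f j / a e j) * s"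
        by (simp add: sum_subtractf s_def sum_distrib_left)
      finally show ?thesis unfolding sum by simp
    qed
    moreover have "(\<Sum>i\<in>I. a e i * h' i) = 0" unfolding sum using j by (simp add: s_def)
    ultimately show ?thesis using h j by (intro exI[of _ h']) (auto simp: h'_def)
  qed
qed

text \<open>Independent rows have a right inverse. For a new row \<open>f\<close>, a unit vector is
  corrected by the old dual vectors until every old row kills it; independence provides a unit
  vector for which \<open>f\<close> does not kill the result.\<close>

lemma dual_vectors:
  fixes a :: "'e \<Rightarrow> 'i \<Rightarrow> 'a::field"
  assumes "finite F" "\<And>\<kappa>. (\<forall>i\<in>I. (\<Sum>e\<in>F. \<kappa> e * a e i) = 0) \<Longrightarrow> \<forall>e\<in>F. \<kappa> e = 0" "finite I"
  shows "\<exists>S. \<forall>e\<in>F. \<forall>f\<in>F. (\<Sum>i\<in>I. a e i * S f i) = (if e = f then 1 else 0)"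
  using assms
proof (induction F rule: finite_induct)
  case empty then show ?case by simp
next
  case (insert f F)
  have indep: "\<forall>e\<in>F. \<kappa> e = 0" if "\<forall>i\<in>I. (\<Sum>e\<in>F. \<kappa> e * a e i) = 0" for \<kappa>
  proof -
    have "(\<Sum>e\<in>insert f F. (\<kappa>(f:=0)) e * a e i) = (\<Sum>e\<in>F. \<kappa> e * a e i)" for i
      using insert(1,2) by (auto intro!: sum.cong)
    then have "\<forall>e\<in>insert f F. (\<kappa>(f:=0)) e = 0" using insert(4)[of "\<kappa>(f:=0)"] that by simp
    then show ?thesis using insert(2) by (auto split: if_splits)
  qed
  obtain S where S: "\<forall>e\<in>F. \<forall>g\<in>F. (\<Sum>i\<in>I. a e i * S g i) = (if e = g then 1 else 0)"
    using insert.IH[OF indep insert(5)] by auto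
  define B where "B = (\<lambda>e h. \<Sum>i\<in>I. a e i * h i)"
  have S': "B e (S g) = (if e = g then 1 else 0)" if "e \<in> F" "g \<in> F" for e g using S that by (auto simp: B_def)
  have Blin: "B e (\<lambda>i. x i - y i) = B e x - B e y" for e x y
    by (simp add: B_def algebra_simps sum_subtractf)
  have Bsc: "B e (\<lambda>i. x i * c) = B e x * c" for e x c
    by (simp add: B_def sum_distrib_right mult.assoc)
  have Bsum: "B e (\<lambda>i. \<Sum>g\<in>F. x g i) = (\<Sum>g\<in>F. B e (x g))" for e x
    unfolding B_def by (subst sum.swap) (simp add: sum_distrib_left)
  obtain j where j: "j \<in> I" "a f j - (\<Sum>e\<in>F. B f (S e) * a e j) \<noteq> 0"
  proof -
    define \<kappa> where "\<kappa> = (\<lambda>e. if e = f then 1 else - B f (S e))"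
    have "\<not> (\<forall>i\<in>I. (\<Sum>e\<in>insert f F. \<kappa> e * a e i) = 0)"
      using insert(4)[of \<kappa>] by (auto simp: \<kappa>_def)
    moreover have "(\<Sum>e\<in>insert f F. \<kappa> e * a e i) = a f i - (\<Sum>e\<in>F. B f (S e) * a e i)" for i
    proof -
      have "(\<Sum>e\<in>F. \<kappa> e * a e i) = (\<Sum>e\<in>F. - (B f (S e) * a e i))"
        using insert(2) by (auto simp: \<kappa>_def intro!: sum.cong)
      then show ?thesis using insert(1,2) by (simp add: \<kappa>_def sum_negf)
    qed
    ultimately show ?thesis using that by auto
  qed
  define h where "h = (\<lambda>i. (if i = j then 1 else 0) - (\<Sum>e\<in>F. S e i * a e j))"
  have Bu: "B e (\<lambda>i. if i = j then 1 else 0) = a e j" for e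
    using j(1) insert(5) by (simp add: B_def if_distrib cong: if_cong)
  have Bh: "B e h = a e j - (\<Sum>g\<in>F. B e (S g) * a g j)" for e
    by (simp add: h_def Blin Bsum Bsc Bu)
  have Bh0: "B e h = 0" if "e \<in> F" for e
  proof -
    have "(\<Sum>g\<in>F. B e (S g) * a g j) = (\<Sum>g\<in>F. if g = e then a g j else 0)"
      using that S' by (intro sum.cong) auto
    then show ?thesis unfolding Bh using insert(1) that by simp
  qed
  have Bf: "B f h \<noteq> 0" unfolding Bh using j(2) by (simp)
  then obtain c where c: "B f h * c = 1" by (metis right_inverse)
  \<comment> \<open>Scaling gives \<open>h\<close> the value one under \<open>f\<close>; the old
    dual vectors are then cleared of their own value under \<open>f\<close>.\<close>
  define S2 where "S2 = (\<lambda>g. if g = f then (\<lambda>i. h i * c) else (\<lambda>i. S g i - h i * (c * B f (S g))))"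
  have "B e (S2 g) = (if e = g then 1 else 0)" if "e \<in> insert f F" "g \<in> insert f F" for e g
    using that Bh0 c S' insert(2) unfolding S2_def by (auto simp: Blin Bsc mult.assoc[symmetric])
  then show ?case unfolding B_def by blast
qed

section \<open>Consequences of generic rigidity\<close>

lemma poly_funs_power: "f \<in> poly_funs n \<Longrightarrow> (\<lambda>p. f p ^ k) \<in> poly_funs n"
  by (induction k) (auto intro: poly_funs.intros)

lemma poly_funs_prod: "(\<And>a. a \<in> A \<Longrightarrow> f a \<in> poly_funs n) \<Longrightarrow> (\<lambda>v. \<Prod>a\<in>A. f a v) \<in> poly_funs n"
  by (induction A rule: infinite_finite_induct) (auto intro: poly_funs.intros)

lemma simple_graphD:
  assumes "simple_graph n E" "e \<in> E"
  obtains a b where "e = {a, b}" "a < b" "a \<in> {1..n}" "b \<in> {1..n}" "Min e = a" "Max e = b"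
proof -
  have "card e = 2" "e \<subseteq> {1..n}" using assms unfolding simple_graph_def by auto
  then obtain a b where ab: "e = {a, b}" "a \<noteq> b" by (meson card_2_iff)
  then have r: "a \<in> {1..n}" "b \<in> {1..n}" using \<open>e \<subseteq> {1..n}\<close> by auto
  show thesis
  proof (cases "a < b")
    case True then show thesis using that[of a b] ab r by (simp add: min_def max_def)
  next
    case False then show thesis using that[of b a] ab r by (simp add: min_def max_def insert_commute)
  qed
qed

lemma simple_graph_finite: "simple_graph n E \<Longrightarrow> finite E"
  unfolding simple_graph_def by (rule finite_subset[of _ "Pow {1..n}"]) auto

text \<open>Defined over any ring and without the factor one half of \<open>measurement\<close>, so
  that the same polynomials serve the real frameworks and the complex realisations.\<close>

definition sqd :: "(nat \<Rightarrow> 'a::comm_ring_1 ^ 'd::finite) \<Rightarrow> nat set \<Rightarrow> 'a" where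
  "sqd p e = (\<Sum>k\<in>UNIV. (p (Min e) $ k - p (Max e) $ k)\<^sup>2)"

lemma Min_Max_pair: "(Min {i, j} = i \<and> Max {i, j} = j) \<or> (Min {i, j} = j \<and> Max {i, j} = (i::nat))"
  by (auto simp: min_def max_def)

lemma sqd_pair: "sqd p {i, j} = (\<Sum>k\<in>UNIV. (p i $ k - p j $ k)\<^sup>2)"
  unfolding sqd_def using Min_Max_pair[of i j] by (auto intro!: sum.cong power2_commute)

lemma dist_sqd:
  fixes p :: "nat \<Rightarrow> real ^ 'd::finite"
  shows "dist (p i) (p j) = sqrt (sqd p {i, j})"
  unfolding sqd_pair dist_vec_def L2_set_def dist_real_def by simp

lemma dist_eq_iff_sqd:
  fixes p q :: "nat \<Rightarrow> real ^ 'd::finite"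
  shows "dist (p i) (p j) = dist (q i) (q j) \<longleftrightarrow> sqd p {i, j} = sqd q {i, j}"
  by (simp add: dist_sqd)

lemma sqd_poly_fun:
  assumes "simple_graph n E" "e \<in> E"
  shows "(\<lambda>p. sqd p e) \<in> poly_funs n"
proof -
  obtain a b where "a \<in> {1..n}" "b \<in> {1..n}" "Min e = a" "Max e = b"
    using simple_graphD[OF assms] by metis
  then show ?thesis unfolding sqd_def
    by (auto intro!: poly_funs_sum poly_funs_power poly_funs_minus poly_funs.coord)
qed

lemma mon_sqd_poly_fun:
  assumes "simple_graph n E" "F \<subseteq> E"
  shows "(\<lambda>p. \<Sum>\<zeta>\<in>\<Lambda>. \<kappa> \<zeta> * mon F (h \<zeta>) (sqd p)) \<in> poly_funs n"
  unfolding mon_def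
  by (intro poly_funs_sum poly_funs.mult poly_funs.const poly_funs_prod poly_funs_power sqd_poly_fun[OF assms(1)])
     (use assms(2) in auto)

text \<open>A vertex set without edges to its complement can be translated alone, which is a motion
  that no isometry of the whole framework explains.\<close>

lemma rigid_connected:
  assumes rig: "rigid_graph TYPE('d::finite) n E"
    and S: "S \<subseteq> {1..n}" "S \<noteq> {}" "S \<noteq> {1..n}"
    and closed: "\<And>i j. {i, j} \<in> E \<Longrightarrow> i \<in> S \<longleftrightarrow> j \<in> S"
  shows False
proof -
  obtain p :: "nat \<Rightarrow> real ^ 'd" where p: "rigid_framework n E p"
    using for_generic_ex rig unfolding rigid_graph_def by blast
  obtain i j where ij: "i \<in> S" "j \<in> {1..n}" "j \<notin> S" using S by blast
  \<comment> \<open>The translation doubles the distance of \<open>i\<close> and \<open>j\<close>,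
    or makes it positive when the two points coincide; either way the distance changes.\<close>
  define a where "a = (if p i = p j then axis (SOME k. True) 1 else p i - p j)"
  define P where "P = (\<lambda>t k. if k \<in> S then p k + t *\<^sub>R a else p k)"
  have "continuous_on {0..1} (\<lambda>t. P t k)" for k
    unfolding P_def by (cases "k \<in> S") (auto intro!: continuous_intros)
  then have "\<forall>k\<in>{1..n}. continuous_on {0..1} (\<lambda>t. P t k)" by blast
  moreover have "\<forall>t\<in>{0..1}. \<forall>k l. {k, l} \<in> E \<longrightarrow> dist (P t k) (P t l) = dist (p k) (p l)"
    unfolding P_def using closed by (auto simp: dist_norm)
  moreover have "\<forall>k\<in>{1..n}. P 0 k = p k" by (simp add: P_def)
  ultimately have "\<forall>t\<in>{0..1}. \<exists>g :: real ^ 'd \<Rightarrow> real ^ 'd.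
      (\<forall>x y. dist (g x) (g y) = dist x y) \<and> (\<forall>k\<in>{1..n}. P t k = g (p k))"
    using p unfolding rigid_framework_def by blast
  moreover have "(1::real) \<in> {0..1}" by simp
  ultimately obtain g :: "real ^ 'd \<Rightarrow> real ^ 'd" where g: "\<forall>x y. dist (g x) (g y) = dist x y" "\<forall>k\<in>{1..n}. P 1 k = g (p k)"
    by blast
  have "dist (P 1 i) (P 1 j) = dist (p i) (p j)" using g ij S(1) by auto
  then have nrm: "norm (p i + a - p j) = norm (p i - p j)" using ij by (simp add: P_def dist_norm)
  then show False
  proof (cases "p i = p j")
    case True then show ?thesis using nrm by (simp add: a_def)
  next
    case False
    then have "p i + a - p j = 2 *\<^sub>R (p i - p j)" by (simp add: a_def scaleR_2)
    then have "norm (p i + a - p j) = 2 * norm (p i - p j)" by simp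
    then show ?thesis using nrm False by simp
  qed
qed

section \<open>Algebraic independence of the edge lengths\<close>

definition alg_indep :: "nat set set \<Rightarrow> bool" where
  "alg_indep E \<longleftrightarrow> (\<forall>\<Lambda> (\<kappa> :: (nat set \<Rightarrow> nat) \<Rightarrow> real). finite \<Lambda> \<longrightarrow> \<Lambda> \<subseteq> (E \<rightarrow>\<^sub>E UNIV) \<longrightarrow>
     (\<forall>p :: nat \<Rightarrow> real ^ 2. (\<Sum>\<eta>\<in>\<Lambda>. \<kappa> \<eta> * mon E \<eta> (sqd p)) = 0) \<longrightarrow> (\<forall>\<eta>\<in>\<Lambda>. \<kappa> \<eta> = 0))"

lemma alg_indepD:
  fixes \<kappa> :: "(nat set \<Rightarrow> nat) \<Rightarrow> real"
  assumes "alg_indep E" "finite \<Lambda>" "\<Lambda> \<subseteq> (E \<rightarrow>\<^sub>E UNIV)"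
    "\<And>p :: nat \<Rightarrow> real ^ 2. (\<Sum>\<eta>\<in>\<Lambda>. \<kappa> \<eta> * mon E \<eta> (sqd p)) = 0" "\<eta> \<in> \<Lambda>"
  shows "\<kappa> \<eta> = 0"
  using assms unfolding alg_indep_def by simp

lemma PiE_upd_undefined: "\<zeta> \<in> F \<rightarrow>\<^sub>E UNIV \<Longrightarrow> \<zeta>(e := undefined) \<in> (F - {e}) \<rightarrow>\<^sub>E UNIV"
  by (auto simp: PiE_iff extensional_def)

lemma mon_split:
  assumes "finite F" "e \<in> F"
  shows "mon F \<zeta> v = v e ^ \<zeta> e * mon (F - {e}) (\<zeta>(e := undefined)) v"
proof -
  have "(\<Prod>j\<in>F - {e}. v j ^ \<zeta> j) = (\<Prod>j\<in>F - {e}. v j ^ (\<zeta>(e := undefined)) j)"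
    by (rule prod.cong) auto
  then show ?thesis unfolding mon_def using prod.remove[OF assms, of "\<lambda>j. v j ^ \<zeta> j"] by simp
qed

lemma mon_cong: "(\<And>i. i \<in> I \<Longrightarrow> v i = w i) \<Longrightarrow> mon I \<eta> v = mon I \<eta> w"
  unfolding mon_def by (auto intro: prod.cong)

text \<open>A path that keeps the lengths of \<open>E - {e}\<close> also keeps the coefficients
  \<open>A m\<close>, so the length of \<open>e\<close> stays among the finitely many roots of one
  polynomial and by continuity does not move. Induction on subsets guarantees that this polynomial
  is nonzero at generic points: its coefficient \<open>A ?m\<close> is a nontrivial combination of
  monomials in fewer lengths.\<close>

lemma minimally_rigid_alg_indep:
  assumes sg: "simple_graph n E" and mr: "minimally_rigid_graph TYPE(2) n E"
  shows "alg_indep E"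
proof -
  have finE: "finite E" using sg by (rule simple_graph_finite)
  have "F \<subseteq> E \<Longrightarrow> alg_indep F" if "finite F" for F
    using that
  proof (induction F rule: finite_psubset_induct)
    case (psubset F)
    show ?case unfolding alg_indep_def
    proof (intro allI impI)
      fix \<Lambda> and \<kappa> :: "(nat set \<Rightarrow> nat) \<Rightarrow> real"
      assume \<Lambda>: "finite \<Lambda>" "\<Lambda> \<subseteq> (F \<rightarrow>\<^sub>E UNIV)"
        and rel: "\<forall>p :: nat \<Rightarrow> real ^ 2. (\<Sum>\<eta>\<in>\<Lambda>. \<kappa> \<eta> * mon F \<eta> (sqd p)) = 0"
      show "\<forall>\<eta>\<in>\<Lambda>. \<kappa> \<eta> = 0"
      proof (rule ballI, rule ccontr)
        fix \<eta> assume \<eta>: "\<eta> \<in> \<Lambda>" "\<kappa> \<eta> \<noteq> 0"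
        have "F \<noteq> {}"
        proof
          assume "F = {}"
          then have "\<Lambda> = {\<eta>}" using \<Lambda> \<eta> by auto
          then show False using rel \<eta> \<open>F = {}\<close> by (simp add: mon_def)
        qed
        then obtain e where e: "e \<in> F" by auto
        let ?m = "\<eta> e"
        let ?L = "\<lambda>m. {\<zeta>\<in>\<Lambda>. \<zeta> e = m}"
        let ?r = "\<lambda>\<zeta>. \<zeta>(e := undefined)"
        \<comment> \<open>The relation is read as a polynomial in the length of \<open>e\<close>,
          with \<open>A m\<close> as coefficient of degree \<open>m\<close>.\<close>
        define A where "A = (\<lambda>m (p :: nat \<Rightarrow> real ^ 2). \<Sum>\<zeta>\<in>?L m. \<kappa> \<zeta> * mon (F - {e}) (?r \<zeta>) (sqd p))"
        have rel': "(\<Sum>m\<in>(\<lambda>\<zeta>. \<zeta> e) ` \<Lambda>. A m p * sqd p e ^ m) = 0" for p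
        proof -
          have "(\<Sum>m\<in>(\<lambda>\<zeta>. \<zeta> e) ` \<Lambda>. A m p * sqd p e ^ m)
            = (\<Sum>m\<in>(\<lambda>\<zeta>. \<zeta> e) ` \<Lambda>. \<Sum>\<zeta>\<in>?L m. \<kappa> \<zeta> * mon F \<zeta> (sqd p))"
            unfolding A_def
            by (intro sum.cong refl) (auto simp: mon_split[OF psubset(1) e] sum_distrib_right intro!: sum.cong)
          also have "\<dots> = (\<Sum>\<zeta>\<in>\<Lambda>. \<kappa> \<zeta> * mon F \<zeta> (sqd p))"
            using sum.image_gen[OF \<Lambda>(1), of "\<lambda>\<zeta>. \<kappa> \<zeta> * mon F \<zeta> (sqd p)" "\<lambda>\<zeta>. \<zeta> e"] by simp
          finally show ?thesis using rel by simp
        qed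
        have "\<exists>p. A ?m p \<noteq> 0"
        proof (rule ccontr)
          assume "\<not> ?thesis"
          then have zero: "A ?m p = 0" for p by simp
          have upd: "(?r \<zeta>)(e := ?m) = \<zeta>" if "\<zeta> \<in> ?L ?m" for \<zeta> using that by auto
          then have inj: "inj_on ?r (?L ?m)" by (metis (no_types, lifting) inj_onI)
          have c1: "alg_indep (F - {e})" using psubset(2)[of "F - {e}"] psubset(3) e by blast
          have c2: "finite (?r ` ?L ?m)" using \<Lambda>(1) by simp
          have c3: "?r ` ?L ?m \<subseteq> (F - {e}) \<rightarrow>\<^sub>E UNIV" 
            by (rule image_subsetI, rule PiE_upd_undefined) (use \<Lambda>(2) in blast)
          have c4: "(\<Sum>\<zeta>\<in>?r ` ?L ?m. \<kappa> (\<zeta>(e := ?m)) * mon (F - {e}) \<zeta> (sqd p)) = 0" for p :: "nat \<Rightarrow> real ^ 2"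
          proof -
            have "(\<Sum>\<zeta>\<in>?r ` ?L ?m. \<kappa> (\<zeta>(e := ?m)) * mon (F - {e}) \<zeta> (sqd p)) = A ?m p"
              unfolding sum.reindex[OF inj] comp_def A_def
              by (rule sum.cong) (use upd in auto)
            then show ?thesis using zero by simp
          qed
          have c5: "?r \<eta> \<in> ?r ` ?L ?m" using \<eta>(1) by blast
          have "\<kappa> ((?r \<eta>)(e := ?m)) = 0"
            by (rule alg_indepD[where \<kappa> = "\<lambda>\<zeta>. \<kappa> (\<zeta>(e := ?m))", OF c1 c2 c3 c4 c5])
          then show False using \<eta>(2) by simp
        qed
        then obtain p0 where p0: "A ?m p0 \<noteq> 0" by auto
        have "A ?m \<in> poly_funs n" unfolding A_def
          by (rule mon_sqd_poly_fun[OF sg]) (use psubset(3) in auto)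
        then have g1: "for_generic n (\<lambda>p. A ?m p \<noteq> 0)" using p0 by (rule for_generic_nonzero)
        have g2: "for_generic n (\<lambda>p :: nat \<Rightarrow> real ^ 2. rigid_framework n E p)"
          using mr unfolding minimally_rigid_graph_def rigid_graph_def by simp
        have "rigid_framework n (E - {e}) p" if nz: "A ?m p \<noteq> 0" and rf: "rigid_framework n E p" for p
          unfolding rigid_framework_def
        proof (intro allI impI, elim conjE)
          fix P :: "real \<Rightarrow> nat \<Rightarrow> real ^ 2"
          assume P: "\<forall>i\<in>{1..n}. continuous_on {0..1} (\<lambda>t. P t i)" "\<forall>i\<in>{1..n}. P 0 i = p i"
            "\<forall>t\<in>{0..1}. \<forall>i j. {i, j} \<in> E - {e} \<longrightarrow> dist (P t i) (P t j) = dist (p i) (p j)"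
          have sq: "sqd (P t) f = sqd p f" if "t \<in> {0..1}" "f \<in> E - {e}" for t f
          proof -
            obtain a b where "f = {a, b}" using simple_graphD[OF sg, of f] \<open>f \<in> E - {e}\<close> by (metis DiffD1)
            then show ?thesis using P(3) that dist_eq_iff_sqd[of "P t" a b p] by auto
          qed
          define Q where "Q = (\<Sum>m\<in>(\<lambda>\<zeta>. \<zeta> e) ` \<Lambda>. monom (A m p) m)"
          have "coeff Q ?m = A ?m p"
            unfolding Q_def coeff_sum using \<Lambda>(1) \<eta>(1) by (simp add: if_distrib cong: if_cong)
          then have "Q \<noteq> 0" using nz by auto
          then have fin: "finite {x. poly Q x = 0}" by (rule poly_roots_finite)
          have root: "poly Q (sqd (P t) e) = 0" if "t \<in> {0..1}" for t
          proof -
            have "A m (P t) = A m p" for m unfolding A_def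
              by (intro sum.cong refl arg_cong2[of _ _ _ _ "(*)"] mon_cong) (use sq[OF that] psubset(3) in auto)
            then show ?thesis using rel'[of "P t"] unfolding Q_def by (simp add: poly_sum poly_monom)
          qed
          have "e \<in> E" using e psubset(3) by auto
          then obtain a b where ab: "e = {a, b}" "a \<in> {1..n}" "b \<in> {1..n}" using simple_graphD[OF sg] by metis
          have "continuous_on {0..1} (\<lambda>t. sqd (P t) e)"
            unfolding ab(1) sqd_pair using P(1) ab by (intro continuous_intros) auto
          moreover have "finite ((\<lambda>t. sqd (P t) e) ` {0..1})"
            by (rule finite_subset[OF _ fin]) (use root in auto)
          ultimately have "(\<lambda>t. sqd (P t) e) constant_on {0..1::real}"
            by (intro continuous_finite_range_constant) auto
          then have const: "sqd (P t) e = sqd (P 0) e" if "t \<in> {0..1}" for t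
            using that unfolding constant_on_def by (metis atLeastAtMost_iff order_refl zero_le_one)
          have "sqd (P 0) e = sqd p e" unfolding ab(1) sqd_pair using P(2) ab by simp
          then have "\<forall>t\<in>{0..1}. \<forall>i j. {i, j} \<in> E \<longrightarrow> dist (P t i) (P t j) = dist (p i) (p j)"
            using const P(3) by (metis DiffI dist_eq_iff_sqd singletonD)
          then show "\<forall>t\<in>{0..1}. \<exists>g. (\<forall>x y. dist (g x) (g y) = dist x y) \<and> (\<forall>i\<in>{1..n}. P t i = g (p i))"
            using rf P(1,2) unfolding rigid_framework_def by blast
        qed
        then have "rigid_graph TYPE(2) n (E - {e})"
          unfolding rigid_graph_def using for_generic_mono[OF for_generic_conj[OF g1 g2]] by blast
        then show False using mr e psubset(3) unfolding minimally_rigid_graph_def by auto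
      qed
    qed
  qed
  then show ?thesis using finE by auto
qed

section \<open>Flexes constructed by contraction\<close>

lemma contraction_path:
  fixes \<Phi> :: "real \<Rightarrow> ('f \<Rightarrow> real) \<Rightarrow> 'f \<Rightarrow> real"
  assumes fin: "finite F" and \<rho>: "\<rho> \<ge> 0" and L: "L \<ge> 0"
    and self: "\<And>t w f. t \<in> {0..1} \<Longrightarrow> (\<And>g. g \<in> F \<Longrightarrow> \<bar>w g\<bar> \<le> \<rho>) \<Longrightarrow> f \<in> F \<Longrightarrow> \<bar>\<Phi> t w f\<bar> \<le> \<rho>"
    and contr: "\<And>t w w' \<delta> f. t \<in> {0..1} \<Longrightarrow> (\<And>g. g \<in> F \<Longrightarrow> \<bar>w g\<bar> \<le> \<rho>) \<Longrightarrow> (\<And>g. g \<in> F \<Longrightarrow> \<bar>w' g\<bar> \<le> \<rho>) \<Longrightarrow>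
       (\<And>g. g \<in> F \<Longrightarrow> \<bar>w g - w' g\<bar> \<le> \<delta>) \<Longrightarrow> f \<in> F \<Longrightarrow> \<bar>\<Phi> t w f - \<Phi> t w' f\<bar> \<le> \<delta> / 2"
    and lip: "\<And>t t' w f. t \<in> {0..1} \<Longrightarrow> t' \<in> {0..1} \<Longrightarrow> (\<And>g. g \<in> F \<Longrightarrow> \<bar>w g\<bar> \<le> \<rho>) \<Longrightarrow> f \<in> F \<Longrightarrow>
       \<bar>\<Phi> t w f - \<Phi> t' w f\<bar> \<le> L * \<bar>t - t'\<bar>"
    and zero: "\<And>f. f \<in> F \<Longrightarrow> \<Phi> 0 (\<lambda>_. 0) f = 0"
  shows "\<exists>\<omega>. (\<forall>t\<in>{0..1}. \<forall>f\<in>F. \<omega> t f = \<Phi> t (\<omega> t) f) \<and>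
     (\<forall>f\<in>F. continuous_on {0..1} (\<lambda>t. \<omega> t f)) \<and> (\<forall>f\<in>F. \<omega> 0 f = 0)"
proof -
  \<comment> \<open>Picard iteration from zero, separately for each parameter. The geometric bound
    on the increments gives pointwise convergence; continuity in \<open>t\<close> is obtained
    afterwards from the fixed point equation alone.\<close>
  define W where "W = (\<lambda>t k. (\<Phi> t ^^ k) (\<lambda>_. 0))"
  have WS: "W t (Suc k) = \<Phi> t (W t k)" for t k by (simp add: W_def)
  have W0: "W t 0 f = 0" for t f by (simp add: W_def)
  have Wb: "f \<in> F \<Longrightarrow> \<bar>W t k f\<bar> \<le> \<rho>" if "t \<in> {0..1}" for t k f
    by (induction k arbitrary: f) (auto simp: W_def \<rho> intro: self that)
  have step: "f \<in> F \<Longrightarrow> \<bar>W t (Suc k) f - W t k f\<bar> \<le> (2 * \<rho>) * (1/2) ^ k" if t: "t \<in> {0..1}" for t k f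
  proof (induction k arbitrary: f)
    case 0
    then show ?case using Wb[OF t, of f 1] Wb[OF t, of f 0] by simp
  next
    case (Suc k)
    have "\<bar>\<Phi> t (W t (Suc k)) f - \<Phi> t (W t k) f\<bar> \<le> ((2 * \<rho>) * (1/2) ^ k) / 2"
      by (rule contr[OF t]) (use Wb[OF t] Suc in auto)
    then show ?case by (simp add: WS)
  qed
  have conv: "convergent (\<lambda>k. W t k f)" if t: "t \<in> {0..1}" and f: "f \<in> F" for t f
  proof -
    have "summable (\<lambda>k. W t (Suc k) f - W t k f)"
      by (rule summable_comparison_test'[where g = "\<lambda>k. (2 * \<rho>) * (1/2) ^ k" and N = 0])
         (use step[OF t f] in \<open>auto intro!: summable_mult summable_geometric\<close>)
    then have "convergent (\<lambda>k. \<Sum>j<k. W t (Suc j) f - W t j f)" by (simp add: summable_iff_convergent)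
    moreover have "(\<Sum>j<k. W t (Suc j) f - W t j f) = W t k f" for k
      using sum_lessThan_telescope[of "\<lambda>j. W t j f" k] W0 by simp
    ultimately show ?thesis by simp
  qed
  define \<omega> where "\<omega> = (\<lambda>t f. lim (\<lambda>k. W t k f))"
  have lim: "(\<lambda>k. W t k f) \<longlonglongrightarrow> \<omega> t f" if "t \<in> {0..1}" "f \<in> F" for t f
    using conv[OF that] unfolding \<omega>_def by (simp add: convergent_LIMSEQ_iff)
  have wb: "\<bar>\<omega> t f\<bar> \<le> \<rho>" if "t \<in> {0..1}" "f \<in> F" for t f
    by (rule LIMSEQ_le_const2[OF tendsto_rabs[OF lim[OF that]]]) (use Wb that in auto)
  have fix_eq: "\<omega> t f = \<Phi> t (\<omega> t) f" if t: "t \<in> {0..1}" and f: "f \<in> F" for t f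
  proof -
    have "(\<lambda>k. W t (Suc k) f) \<longlonglongrightarrow> \<Phi> t (\<omega> t) f"
    proof (rule tendstoI)
      fix \<epsilon> :: real assume "\<epsilon> > 0"
      have "\<forall>\<^sub>F k in sequentially. \<forall>g\<in>F. \<bar>W t k g - \<omega> t g\<bar> < \<epsilon>"
        unfolding eventually_ball_finite_distrib[OF fin]
        using lim[OF t] \<open>\<epsilon> > 0\<close> by (auto simp: tendsto_iff dist_real_def)
      then show "\<forall>\<^sub>F k in sequentially. dist (W t (Suc k) f) (\<Phi> t (\<omega> t) f) < \<epsilon>"
      proof (rule eventually_mono)
        fix k assume k: "\<forall>g\<in>F. \<bar>W t k g - \<omega> t g\<bar> < \<epsilon>"
        have "\<bar>\<Phi> t (W t k) f - \<Phi> t (\<omega> t) f\<bar> \<le> \<epsilon> / 2"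
          by (rule contr[OF t]) (use Wb[OF t] wb[OF t] k f in \<open>auto intro: less_imp_le\<close>)
        then show "dist (W t (Suc k) f) (\<Phi> t (\<omega> t) f) < \<epsilon>" using \<open>\<epsilon> > 0\<close> by (simp add: WS dist_real_def)
      qed
    qed
    moreover have "(\<lambda>k. W t (Suc k) f) \<longlonglongrightarrow> \<omega> t f" using lim[OF t f] by (rule LIMSEQ_Suc)
    ultimately show ?thesis by (metis LIMSEQ_unique)
  qed
  \<comment> \<open>At the coordinate where the two fixed points differ most, contraction absorbs
    half of the difference and the Lipschitz condition bounds the rest; hence the factor
    two.\<close>
  have Lip: "\<bar>\<omega> t f - \<omega> t' f\<bar> \<le> 2 * L * \<bar>t - t'\<bar>" if t: "t \<in> {0..1}" "t' \<in> {0..1}" and f: "f \<in> F" for t t' f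
  proof -
    define \<delta> where "\<delta> = Max ((\<lambda>g. \<bar>\<omega> t g - \<omega> t' g\<bar>) ` F)"
    have le: "\<bar>\<omega> t g - \<omega> t' g\<bar> \<le> \<delta>" if "g \<in> F" for g unfolding \<delta>_def using fin that by simp
    have "\<delta> \<in> (\<lambda>g. \<bar>\<omega> t g - \<omega> t' g\<bar>) ` F" unfolding \<delta>_def using fin f by (intro Max_in) auto
    then obtain g where g: "g \<in> F" "\<delta> = \<bar>\<omega> t g - \<omega> t' g\<bar>" by auto
    have "\<bar>\<Phi> t (\<omega> t) g - \<Phi> t (\<omega> t') g\<bar> \<le> \<delta> / 2"
      by (rule contr[OF t(1)]) (use wb t le g in auto)
    moreover have "\<bar>\<Phi> t (\<omega> t') g - \<Phi> t' (\<omega> t') g\<bar> \<le> L * \<bar>t - t'\<bar>"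
      by (rule lip[OF t]) (use wb t g in auto)
    ultimately have "\<delta> \<le> \<delta> / 2 + L * \<bar>t - t'\<bar>"
      using g fix_eq[OF t(1) g(1)] fix_eq[OF t(2) g(1)] by linarith
    then show ?thesis using le[OF f] by linarith
  qed
  have "continuous_on {0..1} (\<lambda>t. \<omega> t f)" if f: "f \<in> F" for f
    by (rule lipschitz_on_continuous_on[of "2 * L"], rule lipschitz_onI)
       (use Lip f L in \<open>auto simp: dist_real_def\<close>)
  moreover have "\<omega> 0 f = 0" if f: "f \<in> F" for f
  proof -
    define \<delta> where "\<delta> = Max ((\<lambda>g. \<bar>\<omega> 0 g\<bar>) ` F)"
    have le: "\<bar>\<omega> 0 g\<bar> \<le> \<delta>" if "g \<in> F" for g unfolding \<delta>_def using fin that by simp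
    have "\<delta> \<in> (\<lambda>g. \<bar>\<omega> 0 g\<bar>) ` F" unfolding \<delta>_def using fin f by (intro Max_in) auto
    then obtain g where g: "g \<in> F" "\<delta> = \<bar>\<omega> 0 g\<bar>" by auto
    have "\<bar>\<Phi> 0 (\<omega> 0) g - \<Phi> 0 (\<lambda>_. 0) g\<bar> \<le> \<delta> / 2"
      by (rule contr) (use wb le g \<rho> in auto)
    then have "\<delta> \<le> \<delta> / 2" using g fix_eq[of 0 g] zero[of g] by simp
    then show ?thesis using le[OF f] by linarith
  qed
  ultimately show ?thesis using fix_eq by blast
qed

text \<open>The polar form of the squared length: \<open>edge_form e x x\<close> is the squared
  length itself, and the values \<open>edge_form e x (unit_vec i)\<close> form the row of
  \<open>e\<close> in the rigidity matrix at \<open>x\<close>.\<close>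

definition edge_form :: "nat set \<Rightarrow> (nat \<times> 2 \<Rightarrow> real) \<Rightarrow> (nat \<times> 2 \<Rightarrow> real) \<Rightarrow> real" where
  "edge_form e x y = (\<Sum>k\<in>UNIV. (x (Min e, k) - x (Max e, k)) * (y (Min e, k) - y (Max e, k)))"

lemma edge_form_commute: "edge_form e x y = edge_form e y x"
  unfolding edge_form_def by (simp add: mult.commute)

lemma edge_form_add: "edge_form e x (\<lambda>i. y i + z i) = edge_form e x y + edge_form e x z"
  "edge_form e (\<lambda>i. y i + z i) x = edge_form e y x + edge_form e z x"
  unfolding edge_form_def by (simp_all add: algebra_simps sum.distrib[symmetric])

lemma edge_form_scale: "edge_form e x (\<lambda>i. c * y i) = c * edge_form e x y"
  "edge_form e (\<lambda>i. c * y i) x = c * edge_form e y x"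
  unfolding edge_form_def by (simp_all add: algebra_simps sum_distrib_left)

lemma edge_form_sum: "edge_form e x (\<lambda>i. \<Sum>g\<in>F. w g * S g i) = (\<Sum>g\<in>F. w g * edge_form e x (S g))"
proof (induction F rule: infinite_finite_induct)
  case (insert g F) then show ?case by (simp add: edge_form_add edge_form_scale)
qed (simp_all add: edge_form_def)

text \<open>An edge has equal length in \<open>x\<close> and \<open>y\<close> exactly if
  \<open>x - y\<close> is an infinitesimal motion of it at the midpoint. This turns finite motions
  into infinitesimal ones without differentiation.\<close>

lemma edge_form_squares: "edge_form e x x - edge_form e y y = edge_form e (\<lambda>i. x i + y i) (\<lambda>i. x i - y i)"
  unfolding edge_form_def by (simp add: sum_subtractf[symmetric] algebra_simps)

lemma edge_form_bound:
  assumes "\<And>i. \<bar>x i\<bar> \<le> a" "\<And>i. \<bar>y i\<bar> \<le> b"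
  shows "\<bar>edge_form e x y\<bar> \<le> 8 * a * b"
proof -
  have "\<bar>(x (Min e, k) - x (Max e, k)) * (y (Min e, k) - y (Max e, k))\<bar> \<le> (2 * a) * (2 * b)" for k
    unfolding abs_mult
    by (rule mult_mono) (use assms[of "(Min e, k)"] assms[of "(Max e, k)"] in linarith)+
  then have "(\<Sum>k\<in>(UNIV::2 set). \<bar>(x (Min e, k) - x (Max e, k)) * (y (Min e, k) - y (Max e, k))\<bar>)
    \<le> of_nat (card (UNIV::2 set)) * ((2 * a) * (2 * b))" by (intro sum_bounded_above) simp
  then show ?thesis unfolding edge_form_def by (intro order_trans[OF sum_abs]) (simp add: mult.assoc)
qed

definition unit_vec :: "nat \<times> 2 \<Rightarrow> nat \<times> 2 \<Rightarrow> real" where "unit_vec i j = (if j = i then 1 else 0)"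

lemma edge_form_unit:
  assumes "finite I" "\<And>i. i \<notin> I \<Longrightarrow> h i = 0"
  shows "edge_form e x h = (\<Sum>i\<in>I. edge_form e x (unit_vec i) * h i)"
proof -
  have "h = (\<lambda>j. \<Sum>i\<in>I. h i * unit_vec i j)"
    by (rule ext) (use assms in \<open>auto simp: unit_vec_def if_distrib cong: if_cong\<close>)
  then show ?thesis using edge_form_sum[of e x h unit_vec I] by (simp add: mult.commute)
qed

lemma edge_form_cong:
  assumes "\<And>k. x (Min e, k) = x' (Min e, k)" "\<And>k. x (Max e, k) = x' (Max e, k)"
  shows "edge_form e x y = edge_form e x' y"
  unfolding edge_form_def using assms by simp

text \<open>For \<open>q = x + Y\<close> a squared length changes by
  \<open>2 * edge_form f x Y + edge_form f Y Y\<close>. If \<open>Y\<close> is a multiple of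
  \<open>h\<close> plus the combination of the \<open>S g\<close> with coefficients
  \<open>w g\<close>, the first form equals \<open>w f\<close>. So the lengths are kept exactly if
  \<open>w\<close> is a fixed point of minus one half of the second form, which is a contraction for
  small \<open>Y\<close>.\<close>

lemma flex_path:
  assumes fin: "finite F" and finI: "finite I" and h0: "\<And>i. i \<notin> I \<Longrightarrow> h i = 0" "h \<noteq> (\<lambda>_. 0)"
    and S0: "\<And>g i. g \<in> F \<Longrightarrow> i \<notin> I \<Longrightarrow> S g i = 0"
    and dual: "\<And>f g. f \<in> F \<Longrightarrow> g \<in> F \<Longrightarrow> edge_form f x (S g) = (if f = g then 1 else 0)"
    and ker: "\<And>f. f \<in> F \<Longrightarrow> edge_form f x h = 0"
  shows "\<exists>q :: real \<Rightarrow> nat \<times> 2 \<Rightarrow> real. q 0 = x \<and> (\<forall>t\<in>{0<..1}. q t \<noteq> x) \<and> (\<forall>t. \<forall>i. i \<notin> I \<longrightarrow> q t i = x i) \<and>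
    (\<forall>i. continuous_on {0..1} (\<lambda>t. q t i)) \<and> (\<forall>t\<in>{0..1}. \<forall>f\<in>F. edge_form f (q t) (q t) = edge_form f x x)"
proof -
  obtain H where H: "H \<ge> 0" "\<And>i. \<bar>h i\<bar> \<le> H"
  proof -
    have "\<bar>h i\<bar> \<le> (\<Sum>j\<in>I. \<bar>h j\<bar>)" for i
      by (cases "i \<in> I") (use h0 finI in \<open>auto intro: member_le_sum sum_nonneg\<close>)
    then show thesis using that[of "\<Sum>j\<in>I. \<bar>h j\<bar>"] by (simp add: sum_nonneg)
  qed
  obtain \<sigma> where \<sigma>: "\<sigma> \<ge> 0" "\<And>g i. g \<in> F \<Longrightarrow> \<bar>S g i\<bar> \<le> \<sigma>"
  proof -
    have "\<bar>S g i\<bar> \<le> (\<Sum>g\<in>F. \<Sum>j\<in>I. \<bar>S g j\<bar>)" if g: "g \<in> F" for g i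
    proof -
      have "\<bar>S g i\<bar> \<le> (\<Sum>j\<in>I. \<bar>S g j\<bar>)"
        by (cases "i \<in> I") (use S0[OF g] finI in \<open>auto intro: member_le_sum sum_nonneg\<close>)
      also have "\<dots> \<le> (\<Sum>g\<in>F. \<Sum>j\<in>I. \<bar>S g j\<bar>)"
        by (rule member_le_sum) (use fin g in \<open>auto intro: sum_nonneg\<close>)
      finally show ?thesis .
    qed
    then show thesis using that[of "\<Sum>g\<in>F. \<Sum>j\<in>I. \<bar>S g j\<bar>"] by (simp add: sum_nonneg)
  qed
  define c where "c = card F * \<sigma> + 1"
  have c: "c \<ge> 1" using \<sigma> by (simp add: c_def)
  \<comment> \<open>The constant \<open>c\<close> bounds how much the vectors \<open>S g\<close>
    enlarge coefficients. The value 32 makes the bound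
    \<open>8 * (4 * c * \<rho>) * (c * \<delta>)\<close> for the difference of two quadratic terms
    equal to \<open>\<delta>\<close>, and one half of this is the contraction required. Below,
    \<open>\<tau>\<close> keeps the part along \<open>h\<close> within the same bound
    \<open>c * \<rho>\<close> as the correction.\<close>
  define \<rho> where "\<rho> = 1 / (32 * c\<^sup>2)"
  have \<rho>: "\<rho> > 0" "32 * c\<^sup>2 * \<rho> = 1" using c by (simp_all add: \<rho>_def)
  define \<tau> where "\<tau> = c * \<rho> / (H + 1)"
  have \<tau>: "\<tau> > 0" using c \<rho> H(1) by (simp add: \<tau>_def)
  have \<tau>H: "\<tau> * H \<le> c * \<rho>"
  proof -
    have "c * \<rho> * H \<le> c * \<rho> * (H + 1)" using c \<rho> by (intro mult_left_mono) auto
    then show ?thesis using H(1) by (simp add: \<tau>_def field_simps)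
  qed
  define Y where "Y = (\<lambda>t w i. (t * \<tau>) * h i + (\<Sum>g\<in>F. w g * S g i))"
  define \<Phi> where "\<Phi> = (\<lambda>t w f. - (1/2) * edge_form f (Y t w) (Y t w))"
  have sumb: "\<bar>\<Sum>g\<in>F. w g * S g i\<bar> \<le> c * \<delta>" if "\<And>g. g \<in> F \<Longrightarrow> \<bar>w g\<bar> \<le> \<delta>" "\<delta> \<ge> 0" for w i \<delta>
  proof -
    have "\<bar>\<Sum>g\<in>F. w g * S g i\<bar> \<le> (\<Sum>g\<in>F. \<bar>w g * S g i\<bar>)" by (rule sum_abs)
    also have "\<dots> \<le> of_nat (card F) * (\<delta> * \<sigma>)"
    proof (rule sum_bounded_above)
      fix g assume g: "g \<in> F"
      show "\<bar>w g * S g i\<bar> \<le> \<delta> * \<sigma>" unfolding abs_mult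
        by (rule mult_mono) (use that g \<sigma>(2)[OF g, of i] in auto)
    qed
    also have "\<dots> \<le> c * \<delta>" using that(2) by (simp add: c_def algebra_simps)
    finally show ?thesis .
  qed
  have hb: "\<bar>(t * \<tau>) * h i\<bar> \<le> \<bar>t\<bar> * (c * \<rho>)" for t i
  proof -
    have "\<tau> * \<bar>h i\<bar> \<le> c * \<rho>" using mult_left_mono[OF H(2)[of i], of \<tau>] \<tau> \<tau>H by linarith
    then have "\<bar>t\<bar> * (\<tau> * \<bar>h i\<bar>) \<le> \<bar>t\<bar> * (c * \<rho>)" by (intro mult_left_mono) auto
    then show ?thesis using \<tau> by (simp add: abs_mult mult.assoc)
  qed
  have Yb: "\<bar>Y t w i\<bar> \<le> 2 * c * \<rho>" if "t \<in> {0..1}" "\<And>g. g \<in> F \<Longrightarrow> \<bar>w g\<bar> \<le> \<rho>" for t w i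
  proof -
    have "\<bar>t\<bar> * (c * \<rho>) \<le> 1 * (c * \<rho>)" using that(1) c \<rho> by (intro mult_right_mono) auto
    moreover have "\<bar>\<Sum>g\<in>F. w g * S g i\<bar> \<le> c * \<rho>" by (rule sumb) (use that(2) \<rho> in auto)
    ultimately show ?thesis using hb[of t i] unfolding Y_def by linarith
  qed
  have diffb: "\<bar>edge_form f (Y t w) (Y t w) - edge_form f (Y t' w') (Y t' w')\<bar> \<le> 8 * (4 * c * \<rho>) * b"
    if "t \<in> {0..1}" "\<And>g. g \<in> F \<Longrightarrow> \<bar>w g\<bar> \<le> \<rho>" "t' \<in> {0..1}" "\<And>g. g \<in> F \<Longrightarrow> \<bar>w' g\<bar> \<le> \<rho>"
      "\<And>i. \<bar>Y t w i - Y t' w' i\<bar> \<le> b" for f t w t' w' b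
    unfolding edge_form_squares
  proof (rule edge_form_bound)
    fix i show "\<bar>Y t w i + Y t' w' i\<bar> \<le> 4 * c * \<rho>"
      using Yb[of t w i] Yb[of t' w' i] that(1-4) by fastforce
  qed (rule that(5))
  have crho: "c * \<rho> * c = 1/32" using \<rho>(2) by (simp add: power2_eq_square mult_ac)
  have "\<exists>\<omega>. (\<forall>t\<in>{0..1}. \<forall>f\<in>F. \<omega> t f = \<Phi> t (\<omega> t) f) \<and>
     (\<forall>f\<in>F. continuous_on {0..1} (\<lambda>t. \<omega> t f)) \<and> (\<forall>f\<in>F. \<omega> 0 f = 0)"
  proof (rule contraction_path[OF fin, where \<rho> = \<rho> and L = "16 * c * \<rho> * (c * \<rho>)"])
    show "\<rho> \<ge> 0" "16 * c * \<rho> * (c * \<rho>) \<ge> 0" using \<rho> c by auto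
  next
    fix t w f assume t: "t \<in> {0..1::real}" and w: "\<And>g. g \<in> F \<Longrightarrow> \<bar>w g\<bar> \<le> \<rho>"
    have "\<bar>edge_form f (Y t w) (Y t w)\<bar> \<le> 8 * (2 * c * \<rho>) * (2 * c * \<rho>)"
      by (rule edge_form_bound) (use Yb[OF t w] in auto)
    also have "\<dots> = 32 * (c * \<rho> * c) * \<rho>" by simp
    also have "\<dots> = \<rho>" unfolding crho by simp
    finally show "\<bar>\<Phi> t w f\<bar> \<le> \<rho>" using \<rho> by (simp add: \<Phi>_def)
  next
    fix t w w' \<delta> f assume t: "t \<in> {0..1::real}" and w: "\<And>g. g \<in> F \<Longrightarrow> \<bar>w g\<bar> \<le> \<rho>" and w': "\<And>g. g \<in> F \<Longrightarrow> \<bar>w' g\<bar> \<le> \<rho>"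
      and d: "\<And>g. g \<in> F \<Longrightarrow> \<bar>w g - w' g\<bar> \<le> \<delta>" and f: "f \<in> F"
    have "\<delta> \<ge> 0" using d[OF f] by linarith
    have "\<bar>edge_form f (Y t w) (Y t w) - edge_form f (Y t w') (Y t w')\<bar> \<le> 8 * (4 * c * \<rho>) * (c * \<delta>)"
    proof (rule diffb[OF t w t w'])
      fix i
      have "Y t w i - Y t w' i = (\<Sum>g\<in>F. (w g - w' g) * S g i)"
        by (simp add: Y_def sum_subtractf left_diff_distrib)
      then show "\<bar>Y t w i - Y t w' i\<bar> \<le> c * \<delta>" using sumb[of "\<lambda>g. w g - w' g" \<delta> i] d \<open>\<delta> \<ge> 0\<close> by simp
    qed
    also have "\<dots> = 32 * (c * \<rho> * c) * \<delta>" by simp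
    also have "\<dots> = \<delta>" unfolding crho by simp
    finally show "\<bar>\<Phi> t w f - \<Phi> t w' f\<bar> \<le> \<delta> / 2" unfolding \<Phi>_def by linarith
  next
    fix t t' w f assume t: "t \<in> {0..1::real}" "t' \<in> {0..1::real}" and w: "\<And>g. g \<in> F \<Longrightarrow> \<bar>w g\<bar> \<le> \<rho>"
    have "\<bar>edge_form f (Y t w) (Y t w) - edge_form f (Y t' w) (Y t' w)\<bar> \<le> 8 * (4 * c * \<rho>) * (\<bar>t - t'\<bar> * (c * \<rho>))"
    proof (rule diffb[OF t(1) w t(2) w])
      fix i
      have "Y t w i - Y t' w i = ((t - t') * \<tau>) * h i" by (simp add: Y_def algebra_simps)
      then show "\<bar>Y t w i - Y t' w i\<bar> \<le> \<bar>t - t'\<bar> * (c * \<rho>)" using hb[of "t - t'" i] by simp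
    qed
    then show "\<bar>\<Phi> t w f - \<Phi> t' w f\<bar> \<le> 16 * c * \<rho> * (c * \<rho>) * \<bar>t - t'\<bar>" by (simp add: \<Phi>_def mult_ac)
  next
    fix f show "\<Phi> 0 (\<lambda>_. 0) f = 0" by (simp add: \<Phi>_def Y_def edge_form_def)
  qed
  then obtain \<omega> where \<omega>: "\<And>t f. t \<in> {0..1} \<Longrightarrow> f \<in> F \<Longrightarrow> \<omega> t f = \<Phi> t (\<omega> t) f"
    "\<And>f. f \<in> F \<Longrightarrow> continuous_on {0..1} (\<lambda>t. \<omega> t f)" "\<And>f. f \<in> F \<Longrightarrow> \<omega> 0 f = 0" by blast
  define q where "q = (\<lambda>t i. x i + Y t (\<omega> t) i)"
  have BY: "edge_form f x (Y t (\<omega> t)) = \<omega> t f" if "f \<in> F" for f t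
  proof -
    have "edge_form f x (Y t (\<omega> t)) = (\<Sum>g\<in>F. \<omega> t g * edge_form f x (S g))"
      unfolding Y_def edge_form_add edge_form_scale edge_form_sum by (simp add: ker[OF that])
    also have "\<dots> = (\<Sum>g\<in>F. if g = f then \<omega> t g else 0)" by (rule sum.cong) (use dual that in auto)
    finally show ?thesis using fin that by simp
  qed
  have "q 0 = x" unfolding q_def Y_def using \<omega>(3) by (auto intro!: sum.neutral)
  \<comment> \<open>If the displacement vanished, duality would give \<open>\<omega> t = 0\<close>,
    and a nonzero multiple of \<open>h\<close> would remain.\<close>
  moreover have "q t \<noteq> x" if t: "t \<in> {0<..1}" for t
  proof
    assume "q t = x"
    then have Y0: "Y t (\<omega> t) i = 0" for i unfolding q_def by (metis add_cancel_left_right)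
    then have "\<omega> t f = 0" if "f \<in> F" for f using BY[OF that, of t] by (simp add: edge_form_def)
    then have "(t * \<tau>) * h i = 0" for i using Y0[of i] unfolding Y_def by (simp)
    then show False using h0(2) t \<tau> by auto
  qed
  moreover have "q t i = x i" if "i \<notin> I" for t i unfolding q_def Y_def using h0(1) S0 that by simp
  moreover have "continuous_on {0..1} (\<lambda>t. q t i)" for i
    unfolding q_def Y_def by (intro continuous_intros \<omega>(2))
  moreover have "edge_form f (q t) (q t) = edge_form f x x" if "t \<in> {0..1}" "f \<in> F" for t f
  proof -
    have "edge_form f (q t) (q t) = edge_form f x x + 2 * edge_form f x (Y t (\<omega> t)) + edge_form f (Y t (\<omega> t)) (Y t (\<omega> t))"
      unfolding q_def edge_form_add using edge_form_commute[of f "Y t (\<omega> t)" x] by simp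
    then show ?thesis using \<omega>(1)[OF that] BY[OF that(2), of t] by (simp add: \<Phi>_def)
  qed
  ultimately show ?thesis by blast
qed


section \<open>The number of edges of a rigid graph\<close>

definition flat :: "(nat \<Rightarrow> real ^ 2) \<Rightarrow> nat \<times> 2 \<Rightarrow> real" where "flat p = (\<lambda>(i, k). p i $ k)"

definition unflat :: "nat \<Rightarrow> (nat \<times> 2 \<Rightarrow> real) \<Rightarrow> nat \<Rightarrow> real ^ 2" where
  "unflat n x = (\<lambda>i\<in>{1..n}. \<chi> k. x (i, k))"

lemma unflat_configs: "unflat n x \<in> configs n" unfolding unflat_def configs_def by auto

lemma unflat_flat: "p \<in> configs n \<Longrightarrow> unflat n (flat p) = p"
  unfolding unflat_def flat_def configs_def by (auto simp: fun_eq_iff PiE_iff extensional_def restrict_def)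

lemma poly_fun_along_path:
  assumes "f \<in> poly_funs n" "\<And>i. continuous_on T (\<lambda>t. z t i)"
  shows "continuous_on T (\<lambda>t. f (unflat n (z t)))"
  using assms(1)
proof (induction rule: poly_funs.induct)
  case (coord i k)
  then show ?case unfolding unflat_def using assms(2)[of "(i, k)"] by simp
qed (auto intro: continuous_intros)

text \<open>These are the coordinates that stay free: the three excluded ones are held fixed in
  order to rule out the isometries of the plane, whose group has dimension three.\<close>

definition pinned :: "nat \<Rightarrow> (nat \<times> 2) set" where
  "pinned n = {1..n} \<times> UNIV - {(1,1), (1,2), (2,1)}"

lemma card_pinned: "n \<ge> 3 \<Longrightarrow> card (pinned n) = 2 * n - 3"
proof -
  assume "n \<ge> 3"
  then have "{(1,1), (1,2), (2,1)} \<subseteq> {1..n} \<times> (UNIV :: 2 set)" by auto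
  moreover have "card {(1,1), (1,2), (2,1) :: nat \<times> 2} = 3" by simp
  ultimately show ?thesis unfolding pinned_def by (subst card_Diff_subset) (auto simp: card_cartesian_product)
qed

text \<open>The matrix concerned is the rigidity matrix at \<open>x\<close> without the columns of
  the three fixed coordinates.\<close>

definition rows_indep :: "nat \<Rightarrow> (nat \<times> 2 \<Rightarrow> real) \<Rightarrow> nat set set \<Rightarrow> bool" where
  "rows_indep n x F \<longleftrightarrow> (\<forall>\<kappa>. (\<forall>i\<in>pinned n. (\<Sum>e\<in>F. \<kappa> e * edge_form e x (unit_vec i)) = 0) \<longrightarrow> (\<forall>e\<in>F. \<kappa> e = 0))"

text \<open>The determinants say that no later point is collinear with the first two. The first
  condition makes the pair \<open>{1, 2}\<close> control the only free coordinate of vertex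
  2.\<close>

definition spread :: "nat \<Rightarrow> (nat \<Rightarrow> real ^ 2) \<Rightarrow> bool" where
  "spread n p \<longleftrightarrow> p 1 $ 2 - p 2 $ 2 \<noteq> 0 \<and>
     (\<forall>j\<in>{3..n}. (p 1 $ 1 - p j $ 1) * (p 2 $ 2 - p j $ 2) - (p 1 $ 2 - p j $ 2) * (p 2 $ 1 - p j $ 1) \<noteq> 0)"

lemma for_generic_spread:
  assumes "n \<ge> 3" shows "for_generic n (spread n)"
proof -
  have "for_generic n (\<lambda>p :: nat \<Rightarrow> real ^ 2. p 1 $ 2 - p 2 $ 2 \<noteq> 0)"
    by (rule for_generic_nonzero[where p = "\<lambda>i. \<chi> k. if i = 1 then 1 else 0"])
       (use assms in \<open>auto intro!: poly_funs_minus poly_funs.coord\<close>)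
  moreover have "for_generic n (\<lambda>p :: nat \<Rightarrow> real ^ 2. \<forall>j\<in>{3..n}.
     (p 1 $ 1 - p j $ 1) * (p 2 $ 2 - p j $ 2) - (p 1 $ 2 - p j $ 2) * (p 2 $ 1 - p j $ 1) \<noteq> 0)"
  proof (rule for_generic_ball)
    fix j assume j: "j \<in> {3..n}"
    show "for_generic n (\<lambda>p :: nat \<Rightarrow> real ^ 2.
     (p 1 $ 1 - p j $ 1) * (p 2 $ 2 - p j $ 2) - (p 1 $ 2 - p j $ 2) * (p 2 $ 1 - p j $ 1) \<noteq> 0)"
      by (rule for_generic_nonzero[where p = "\<lambda>i. \<chi> k. if (i = 1 \<and> k = 1) \<or> (i = 2 \<and> k = 2) then 1 else 0"])
         (use assms j in \<open>auto intro!: poly_funs_minus poly_funs.mult poly_funs.coord\<close>)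
  qed simp
  ultimately show ?thesis unfolding spread_def by (rule for_generic_conj)
qed

text \<open>Vertex 2 can move only in its second coordinate, which the pair with vertex 1 forbids.
  Every other velocity is then orthogonal to two independent directions.\<close>

lemma spread_no_motion:
  assumes n: "n \<ge> 3" and sp: "spread n (unflat n x)" and h: "\<And>i. i \<notin> pinned n \<Longrightarrow> h i = 0"
    and mot: "\<And>i j. i \<in> {1..n} \<Longrightarrow> j \<in> {1..n} \<Longrightarrow> edge_form {i, j} x h = 0"
  shows "h = (\<lambda>_. 0)"
proof -
  have pair: "(x (i, 1) - x (j, 1)) * (h (i, 1) - h (j, 1)) + (x (i, 2) - x (j, 2)) * (h (i, 2) - h (j, 2)) = 0"
    if "i \<in> {1..n}" "j \<in> {1..n}" for i j
  proof -
    have "edge_form {i, j} x h = (x (i, 1) - x (j, 1)) * (h (i, 1) - h (j, 1)) + (x (i, 2) - x (j, 2)) * (h (i, 2) - h (j, 2))"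
      unfolding edge_form_def sum_2 using Min_Max_pair[of i j] by (auto simp: algebra_simps)
    then show ?thesis using mot[OF that] by simp
  qed
  have p: "h (1, 1) = 0" "h (1, 2) = 0" "h (2, 1) = 0" by (auto intro: h simp: pinned_def)
  have "x (1, 2) - x (2, 2) \<noteq> 0" using sp n unfolding spread_def unflat_def by simp
  then have h22: "h (2, 2) = 0" using pair[of 1 2] n p by auto
  have z: "h (j, k) = 0" if j: "j \<in> {3..n}" for j k
  proof -
    let ?a = "x (1, 1) - x (j, 1)" and ?b = "x (1, 2) - x (j, 2)" and ?c = "x (2, 1) - x (j, 1)" and ?d = "x (2, 2) - x (j, 2)"
    have "?a * h (j, 1) + ?b * h (j, 2) = 0" using pair[of 1 j] p j by simp
    moreover have "?c * h (j, 1) + ?d * h (j, 2) = 0" using pair[of 2 j] p h22 j by simp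
    moreover have det: "?a * ?d - ?b * ?c \<noteq> 0" using sp j n unfolding spread_def unflat_def by auto
    moreover have "(?a * ?d - ?b * ?c) * h (j, 1) = ?d * (?a * h (j, 1) + ?b * h (j, 2)) - ?b * (?c * h (j, 1) + ?d * h (j, 2))"
      "(?a * ?d - ?b * ?c) * h (j, 2) = ?a * (?c * h (j, 1) + ?d * h (j, 2)) - ?c * (?a * h (j, 1) + ?b * h (j, 2))"
      by (simp_all add: algebra_simps)
    ultimately have "h (j, 1) = 0" "h (j, 2) = 0" by auto
    then show ?thesis using exhaust_2[of k] by auto
  qed
  show ?thesis
  proof
    fix i :: "nat \<times> 2"
    obtain j k where i: "i = (j, k)" by (cases i)
    show "h i = 0"
    proof (cases "j \<in> {1..n}")
      case False then show ?thesis using h[of i] i by (auto simp: pinned_def)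
    next
      case True
      then consider "j = 1" | "j = 2" | "j \<in> {3..n}" by (cases "j = 1"; cases "j = 2"; simp)
      then show ?thesis using p h22 z i exhaust_2[of k] by cases auto
    qed
  qed
qed

text \<open>Diagonal dominance: the matrix of values on the vectors \<open>S g\<close> is so close
  to the identity that a relation contradicts itself at its coefficient of largest absolute
  value.\<close>

lemma rows_indep_perturb:
  assumes fin: "finite F" and S0: "\<And>g i. g \<in> F \<Longrightarrow> i \<notin> pinned n \<Longrightarrow> S g i = 0"
    and near: "\<And>f g. f \<in> F \<Longrightarrow> g \<in> F \<Longrightarrow> \<bar>edge_form f m (S g) - (if f = g then 1 else 0)\<bar> < 1 / (card F + 1)"
  shows "rows_indep n m F"
  unfolding rows_indep_def
proof (intro allI impI)
  fix \<kappa> assume \<kappa>: "\<forall>i\<in>pinned n. (\<Sum>e\<in>F. \<kappa> e * edge_form e m (unit_vec i)) = 0"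
  have finp: "finite (pinned n)" unfolding pinned_def by simp
  have zero: "(\<Sum>e\<in>F. \<kappa> e * edge_form e m (S g)) = 0" if "g \<in> F" for g
  proof -
    have "(\<Sum>e\<in>F. \<kappa> e * edge_form e m (S g)) = (\<Sum>e\<in>F. \<Sum>i\<in>pinned n. (\<kappa> e * edge_form e m (unit_vec i)) * S g i)"
      by (intro sum.cong refl) (simp add: edge_form_unit[OF finp S0[OF that]] sum_distrib_left mult.assoc)
    also have "\<dots> = (\<Sum>i\<in>pinned n. (\<Sum>e\<in>F. \<kappa> e * edge_form e m (unit_vec i)) * S g i)"
      by (subst sum.swap) (simp add: sum_distrib_right)
    finally show ?thesis using \<kappa> by simp
  qed
  show "\<forall>e\<in>F. \<kappa> e = 0"
  proof (rule ccontr)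
    assume ne: "\<not> (\<forall>e\<in>F. \<kappa> e = 0)"
    then have "F \<noteq> {}" by auto
    have "Max ((\<lambda>e. \<bar>\<kappa> e\<bar>) ` F) \<in> (\<lambda>e. \<bar>\<kappa> e\<bar>) ` F" using fin \<open>F \<noteq> {}\<close> by (intro Max_in) auto
    then obtain g where g: "g \<in> F" "Max ((\<lambda>e. \<bar>\<kappa> e\<bar>) ` F) = \<bar>\<kappa> g\<bar>" by auto
    have le: "\<bar>\<kappa> e\<bar> \<le> \<bar>\<kappa> g\<bar>" if "e \<in> F" for e using Max_ge[of "(\<lambda>e. \<bar>\<kappa> e\<bar>) ` F" "\<bar>\<kappa> e\<bar>"] fin that g(2) by simp
    have pos: "\<bar>\<kappa> g\<bar> > 0" using ne le by fastforce
    have "(\<Sum>e\<in>F. \<kappa> e * (if e = g then 1 else 0)) = \<kappa> g" using fin g(1) by (simp add: if_distrib cong: if_cong)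
    then have "\<kappa> g = (\<Sum>e\<in>F. \<kappa> e * ((if e = g then 1 else 0) - edge_form e m (S g)))"
      using zero[OF g(1)] by (simp add: right_diff_distrib sum_subtractf)
    then have "\<bar>\<kappa> g\<bar> \<le> (\<Sum>e\<in>F. \<bar>\<kappa> e * ((if e = g then 1 else 0) - edge_form e m (S g))\<bar>)" using sum_abs by metis
    also have "\<dots> \<le> of_nat (card F) * (\<bar>\<kappa> g\<bar> * (1 / (card F + 1)))"
    proof (rule sum_bounded_above)
      fix e assume e: "e \<in> F"
      show "\<bar>\<kappa> e * ((if e = g then 1 else 0) - edge_form e m (S g))\<bar> \<le> \<bar>\<kappa> g\<bar> * (1 / (card F + 1))"
        unfolding abs_mult by (rule mult_mono) (use near[OF e g(1)] le[OF e] in \<open>auto simp: abs_minus_commute\<close>)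
    qed
    also have "\<dots> = \<bar>\<kappa> g\<bar> * (card F / (card F + 1))" by simp
    also have "\<dots> < \<bar>\<kappa> g\<bar> * 1" using pos by (intro mult_strict_left_mono) auto
    finally show False by simp
  qed
qed

lemma edge_form_flat_unflat:
  assumes "simple_graph n E" "e \<in> E"
  shows "edge_form e (flat (unflat n x)) y = edge_form e x y"
proof -
  obtain a b where "a \<in> {1..n}" "b \<in> {1..n}" "Min e = a" "Max e = b"
    using simple_graphD[OF assms] by metis
  then show ?thesis by (intro edge_form_cong) (auto simp: flat_def unflat_def)
qed

lemma sqd_edge_form: "sqd p e = edge_form e (flat p) (flat p)"
  unfolding sqd_def edge_form_def flat_def by (simp add: power2_eq_square)

lemma rows_span:
  assumes fin: "finite F" and e: "e \<notin> F" and ind: "rows_indep n m F" and dep: "\<not> rows_indep n m (insert e F)"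
    and h: "\<And>i. i \<notin> pinned n \<Longrightarrow> h i = 0" and z: "\<And>f. f \<in> F \<Longrightarrow> edge_form f m h = 0"
  shows "edge_form e m h = 0"
proof -
  obtain \<kappa> where \<kappa>: "\<forall>i\<in>pinned n. (\<Sum>f\<in>insert e F. \<kappa> f * edge_form f m (unit_vec i)) = 0"
      "\<not> (\<forall>f\<in>insert e F. \<kappa> f = 0)"
    using dep unfolding rows_indep_def by auto
  have "\<kappa> e \<noteq> 0"
  proof
    assume "\<kappa> e = 0"
    then have "\<forall>i\<in>pinned n. (\<Sum>f\<in>F. \<kappa> f * edge_form f m (unit_vec i)) = 0" using \<kappa>(1) fin e by simp
    then show False using ind \<kappa>(2) \<open>\<kappa> e = 0\<close> unfolding rows_indep_def by auto
  qed
  have finp: "finite (pinned n)" unfolding pinned_def by simp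
  have "(\<Sum>f\<in>insert e F. \<kappa> f * edge_form f m h) = (\<Sum>f\<in>insert e F. \<Sum>i\<in>pinned n. (\<kappa> f * edge_form f m (unit_vec i)) * h i)"
    by (intro sum.cong refl) (simp add: edge_form_unit[OF finp h] sum_distrib_left mult.assoc)
  also have "\<dots> = (\<Sum>i\<in>pinned n. (\<Sum>f\<in>insert e F. \<kappa> f * edge_form f m (unit_vec i)) * h i)"
    by (subst sum.swap) (simp add: sum_distrib_right)
  also have "\<dots> = 0" using \<kappa>(1) by simp
  finally have "\<kappa> e * edge_form e m h + (\<Sum>f\<in>F. \<kappa> f * edge_form f m h) = 0" using fin e by simp
  then show ?thesis using z \<open>\<kappa> e \<noteq> 0\<close> by simp
qed

text \<open>With too few edges, a largest independent edge set \<open>F\<close> has a flex within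
  the free coordinates. Since \<open>F\<close> stays independent nearby and cannot be enlarged
  there, the rows of all other edges depend on it along the flex, so the flex keeps their lengths as
  well. This argument stands in for the constant rank theorem.\<close>

lemma rigid_edge_count:
  assumes sg: "simple_graph n E" and n: "n \<ge> 3" and rig: "rigid_graph TYPE(2) n E"
  shows "2 * n - 3 \<le> card E"
proof (rule ccontr)
  assume few: "\<not> ?thesis"
  have finE: "finite E" using sg by (rule simple_graph_finite)
  have finp: "finite (pinned n)" unfolding pinned_def by simp
  have "for_generic n (\<lambda>p :: nat \<Rightarrow> real ^ 2. rigid_framework n E p \<and> spread n p)"
    by (rule for_generic_conj[OF _ for_generic_spread[OF n]]) (use rig in \<open>simp add: rigid_graph_def\<close>)
  then obtain \<phi> p0 where \<phi>: "\<phi> \<in> poly_funs n" "\<phi> p0 \<noteq> 0"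
    and gen: "\<And>p :: nat \<Rightarrow> real ^ 2. p \<in> configs n \<Longrightarrow> \<phi> p \<noteq> 0 \<Longrightarrow> rigid_framework n E p \<and> spread n p"
    unfolding for_generic_iff by auto
  define V where "V = {p \<in> configs n. \<phi> p \<noteq> 0}"
  have p0: "restrict p0 {1..n} \<in> V" unfolding V_def
    using poly_funs_cong[OF \<phi>(1), of p0 "restrict p0 {1..n}"] \<phi>(2) restrict_configs by auto
  \<comment> \<open>The configuration varies together with the edge set, so that maximality can
    later be applied at configurations near \<open>p\<close>.\<close>
  define OK where "OK = (\<lambda>pF. fst pF \<in> V \<and> snd pF \<subseteq> E \<and> rows_indep n (flat (fst pF)) (snd pF))"
  have "OK (restrict p0 {1..n}, {})" unfolding OK_def rows_indep_def using p0 by simp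
  moreover have "\<forall>y. OK y \<longrightarrow> card (snd y) < Suc (card E)"
    unfolding OK_def less_Suc_eq_le using finE card_mono by blast
  ultimately obtain pF where pF: "OK pF" "\<And>y. OK y \<Longrightarrow> card (snd y) \<le> card (snd pF)"
    using ex_has_greatest_nat[of OK _ "\<lambda>y. card (snd y)"] by metis
  define p where "p = fst pF"
  define F where "F = snd pF"
  have pV: "p \<in> V" and FE: "F \<subseteq> E" and ind: "rows_indep n (flat p) F"
    using pF(1) unfolding OK_def p_def F_def by auto
  have max: "card F' \<le> card F" if "p' \<in> V" "F' \<subseteq> E" "rows_indep n (flat p') F'" for p' F'
    using pF(2)[of "(p', F')"] that unfolding OK_def F_def by simp
  have finF: "finite F" using FE finE finite_subset by blast
  let ?x = "flat p"
  obtain S0 where S0: "\<forall>e\<in>F. \<forall>f\<in>F. (\<Sum>i\<in>pinned n. edge_form e ?x (unit_vec i) * S0 f i) = (if e = f then 1 else 0)"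
    using dual_vectors[of F "pinned n" "\<lambda>e i. edge_form e ?x (unit_vec i)"] finF finp ind unfolding rows_indep_def by blast
  define S where "S = (\<lambda>f i. if i \<in> pinned n then S0 f i else 0)"
  have Ssupp: "i \<notin> pinned n \<Longrightarrow> S g i = 0" for g i by (simp add: S_def)
  have dual: "edge_form f ?x (S g) = (if f = g then 1 else 0)" if "f \<in> F" "g \<in> F" for f g
    using S0 that edge_form_unit[where x = ?x and e = f and h = "S g", OF finp Ssupp] by (simp add: S_def)
  have "card F \<le> card E" using FE finE by (rule card_mono[rotated])
  then have "card F < card (pinned n)" using few card_pinned[OF n] by simp
  then obtain h where h: "\<forall>i. i \<notin> pinned n \<longrightarrow> h i = 0" "\<exists>i\<in>pinned n. h i \<noteq> 0"
      "\<forall>e\<in>F. (\<Sum>i\<in>pinned n. edge_form e ?x (unit_vec i) * h i) = 0"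
    using kernel_vector[OF finF finp, of "\<lambda>e i. edge_form e ?x (unit_vec i)"] by auto
  have hker: "edge_form f ?x h = 0" if "f \<in> F" for f
  proof -
    have "edge_form f ?x h = (\<Sum>i\<in>pinned n. edge_form f ?x (unit_vec i) * h i)"
      by (rule edge_form_unit[OF finp]) (use h(1) in blast)
    then show ?thesis using h(3) that by simp
  qed
  have hne: "h \<noteq> (\<lambda>_. 0)" using h(2) by auto
  have hsupp: "\<And>i. i \<notin> pinned n \<Longrightarrow> h i = 0" using h(1) by blast
  have Ssupp': "\<And>g i. g \<in> F \<Longrightarrow> i \<notin> pinned n \<Longrightarrow> S g i = 0" using Ssupp by blast
  obtain q :: "real \<Rightarrow> nat \<times> 2 \<Rightarrow> real" where q: "q 0 = ?x" "\<And>t. t \<in> {0<..1} \<Longrightarrow> q t \<noteq> ?x"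
    "\<And>t i. i \<notin> pinned n \<Longrightarrow> q t i = ?x i" "\<And>i. continuous_on {0..1} (\<lambda>t. q t i)"
    "\<And>t f. t \<in> {0..1} \<Longrightarrow> f \<in> F \<Longrightarrow> edge_form f (q t) (q t) = edge_form f ?x ?x"
    using flex_path[OF finF finp hsupp hne Ssupp' dual hker] by metis
  \<comment> \<open>The displacement \<open>q t - ?x\<close> is an infinitesimal motion of
    \<open>F\<close> at this midpoint. For small \<open>t\<close> the midpoint lies in
    \<open>V\<close>, so maximality applies to it and the displacement is an infinitesimal motion of
    every edge.\<close>
  define m where "m = (\<lambda>t i. (1/2) * (q t i + ?x i))"
  have mcont: "continuous_on {0..1} (\<lambda>t. m t i)" for i unfolding m_def by (intro continuous_intros q)
  have m0: "m 0 = ?x" unfolding m_def q(1) by simp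
  have pc: "p \<in> configs n" "\<phi> p \<noteq> 0" using pV unfolding V_def by auto
  have ev: "\<forall>\<^sub>F t in at 0 within {0..1}. \<phi> (unflat n (m t)) \<noteq> 0 \<and>
      (\<forall>f\<in>F. \<forall>g\<in>F. \<bar>edge_form f (m t) (S g) - (if f = g then 1 else 0)\<bar> < 1 / (card F + 1))"
  proof (intro eventually_conj)
    have "continuous_on {0..1} (\<lambda>t. \<phi> (unflat n (m t)))" by (rule poly_fun_along_path[OF \<phi>(1) mcont])
    then have "((\<lambda>t. \<phi> (unflat n (m t))) \<longlongrightarrow> \<phi> (unflat n (m 0))) (at 0 within {0..1})"
      unfolding continuous_on_def by auto
    then show "\<forall>\<^sub>F t in at 0 within {0..1}. \<phi> (unflat n (m t)) \<noteq> 0"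
      by (rule tendsto_imp_eventually_ne) (use pc m0 unflat_flat in simp)
    show "\<forall>\<^sub>F t in at 0 within {0..1}. \<forall>f\<in>F. \<forall>g\<in>F. \<bar>edge_form f (m t) (S g) - (if f = g then 1 else 0)\<bar> < 1 / (card F + 1)"
      unfolding eventually_ball_finite_distrib[OF finF]
    proof (intro ballI)
      fix f g assume fg: "f \<in> F" "g \<in> F"
      have "continuous_on {0..1} (\<lambda>t. edge_form f (m t) (S g))"
        unfolding edge_form_def by (intro continuous_intros mcont)
      then have "((\<lambda>t. edge_form f (m t) (S g)) \<longlongrightarrow> edge_form f (m 0) (S g)) (at 0 within {0..1})"
        unfolding continuous_on_def by auto
      then have "\<forall>\<^sub>F t in at 0 within {0..1}. dist (edge_form f (m t) (S g)) (edge_form f (m 0) (S g)) < 1 / (card F + 1)"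
        by (rule tendstoD) simp
      then show "\<forall>\<^sub>F t in at 0 within {0..1}. \<bar>edge_form f (m t) (S g) - (if f = g then 1 else 0)\<bar> < 1 / (card F + 1)"
        unfolding m0 dual[OF fg] dist_real_def .
    qed
  qed
  then obtain d where d: "d > 0" and near: "\<And>t. t \<in> {0..1} \<Longrightarrow> t \<noteq> 0 \<Longrightarrow> \<bar>t\<bar> < d \<Longrightarrow> \<phi> (unflat n (m t)) \<noteq> 0 \<and>
      (\<forall>f\<in>F. \<forall>g\<in>F. \<bar>edge_form f (m t) (S g) - (if f = g then 1 else 0)\<bar> < 1 / (card F + 1))"
    unfolding eventually_at by (auto simp: dist_real_def)
  define t1 where "t1 = min 1 (d / 2)"
  have t1: "0 < t1" "t1 \<le> 1" "t1 < d" using d by (auto simp: t1_def min_def)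
  have motion: "edge_form e (q t) (q t) - edge_form e ?x ?x = 2 * edge_form e (m t) (\<lambda>i. q t i - ?x i)" for e t
    unfolding edge_form_squares m_def edge_form_scale by simp
  have supp: "q t i - ?x i = 0" if "i \<notin> pinned n" for t i using q(3)[OF that] by simp
  have pres: "edge_form e (q t) (q t) = edge_form e ?x ?x" if t: "t \<in> {0..t1}" and e: "e \<in> E" for t e
  proof (cases "t = 0 \<or> e \<in> F")
    case True then show ?thesis using q(1) q(5)[of t e] t t1 by auto
  next
    case False
    have t': "t \<in> {0..1}" "t \<noteq> 0" "\<bar>t\<bar> < d" using t t1 False by auto
    have V: "unflat n (m t) \<in> V" using near[OF t'] unflat_configs unfolding V_def by blast
    have indm: "rows_indep n (m t) F" by (rule rows_indep_perturb[OF finF, of _ S]) (use near[OF t'] Ssupp in auto)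
    have "\<not> rows_indep n (flat (unflat n (m t))) (insert e F)"
      using max[OF V, of "insert e F"] e FE False finF by auto
    moreover have "rows_indep n (flat (unflat n (m t))) (insert e F) = rows_indep n (m t) (insert e F)"
      unfolding rows_indep_def using edge_form_flat_unflat[OF sg] e FE
      by (intro all_cong1 imp_cong ball_cong refl arg_cong2[of _ _ _ _ "(=)"] sum.cong) auto
    ultimately have dep: "\<not> rows_indep n (m t) (insert e F)" by simp
    have "edge_form f (m t) (\<lambda>i. q t i - ?x i) = 0" if "f \<in> F" for f
      using motion[of f t] q(5)[OF t'(1) that] by simp
    then have "edge_form e (m t) (\<lambda>i. q t i - ?x i) = 0"
      by (intro rows_span[OF finF _ indm dep]) (use False supp in auto)
    then show ?thesis using motion[of e t] by simp
  qed
  \<comment> \<open>The flex is controlled only up to time \<open>t1\<close>; this initial piece is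
    stretched to the unit interval.\<close>
  define P where "P = (\<lambda>s i. \<chi> k. q (s * t1) (i, k))"
  have Pflat: "flat (P s) = q (s * t1)" for s unfolding P_def flat_def by auto
  have range: "s * t1 \<in> {0..t1}" "s * t1 \<in> {0..1}" if "s \<in> {0..1}" for s
    using that t1 by (auto simp: mult_left_le_one_le mult_le_one)
  have "rigid_framework n E p" using gen pc by blast
  moreover have "\<forall>i\<in>{1..n}. continuous_on {0..1} (\<lambda>s. P s i)"
  proof
    fix i
    have "continuous_on {0..1} (\<lambda>s. q (s * t1) (i, k))" for k
      by (rule continuous_on_compose2[OF q(4), of "{0..1}" "\<lambda>s. s * t1"]) (use range in \<open>auto intro!: continuous_intros\<close>)
    then show "continuous_on {0..1} (\<lambda>s. P s i)" unfolding P_def by (intro continuous_on_vec_lambda)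
  qed
  moreover have "\<forall>i\<in>{1..n}. P 0 i = p i" unfolding P_def using q(1) by (simp add: flat_def vec_eq_iff)
  moreover have "\<forall>s\<in>{0..1}. \<forall>i j. {i, j} \<in> E \<longrightarrow> dist (P s i) (P s j) = dist (p i) (p j)"
    using pres range(1) unfolding dist_eq_iff_sqd sqd_edge_form Pflat by blast
  ultimately have "\<forall>s\<in>{0..1}. \<exists>g :: real ^ 2 \<Rightarrow> real ^ 2.
      (\<forall>x y. dist (g x) (g y) = dist x y) \<and> (\<forall>i\<in>{1..n}. P s i = g (p i))"
    unfolding rigid_framework_def by blast
  moreover have "(1::real) \<in> {0..1}" by simp
  ultimately obtain g :: "real ^ 2 \<Rightarrow> real ^ 2" where
    g: "\<And>x y. dist (g x) (g y) = dist x y" "\<And>i. i \<in> {1..n} \<Longrightarrow> P 1 i = g (p i)" by blast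
  \<comment> \<open>All pairs of vertices keep their distance, so the displacement is an
    infinitesimal motion of the complete graph at a spread midpoint.\<close>
  have "(\<lambda>i. q t1 i - ?x i) = (\<lambda>_. 0)"
  proof (rule spread_no_motion[OF n _ supp])
    have "t1 \<in> {0..1}" "t1 \<noteq> 0" "\<bar>t1\<bar> < d" using t1 by auto
    then show "spread n (unflat n (m t1))" using near gen unflat_configs by blast
    fix i j assume ij: "i \<in> {1..n}" "j \<in> {1..n}"
    then have "dist (P 1 i) (P 1 j) = dist (p i) (p j)" using g by simp
    then have "edge_form {i, j} (q t1) (q t1) = edge_form {i, j} ?x ?x"
      unfolding dist_eq_iff_sqd sqd_edge_form Pflat by simp
    then show "edge_form {i, j} (m t1) (\<lambda>i. q t1 i - ?x i) = 0" using motion[of "{i, j}" t1] by simp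
  qed
  then have "q t1 = ?x" by (simp add: fun_eq_iff)
  then show False using q(2)[of t1] t1 by simp
qed

section \<open>Cycles, forests and colourings\<close>

definition edge_diff :: "nat set \<Rightarrow> (nat \<Rightarrow> 'a::comm_ring_1) \<Rightarrow> 'a" where
  "edge_diff e u = u (Min e) - u (Max e)"

lemma edge_diff_pair: "edge_diff {i, j} u = (if i < j then 1 else -1) * (u i - u j)"
  unfolding edge_diff_def by (auto simp: min_def max_def)

lemma cycles_mono: "C \<in> cycles A \<Longrightarrow> A \<subseteq> B \<Longrightarrow> C \<in> cycles B"
  unfolding cycles_def by auto

lemma cycles_sub: "C \<in> cycles B \<Longrightarrow> C \<subseteq> A \<Longrightarrow> C \<in> cycles A"
  unfolding cycles_def by auto

lemma cycle_nonempty: "C \<in> cycles E \<Longrightarrow> C \<noteq> {} \<and> finite C \<and> C \<subseteq> E"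
proof -
  assume "C \<in> cycles E"
  then obtain vs where vs: "length vs \<ge> 3" "C = {{vs ! i, vs ! (Suc i mod length vs)} |i. i < length vs}" "C \<subseteq> E"
    unfolding cycles_def by auto
  have "C = (\<lambda>i. {vs ! i, vs ! (Suc i mod length vs)}) ` {..<length vs}" using vs(2) by auto
  then show ?thesis using vs(1,3) by (auto simp: lessThan_empty_iff)
qed

text \<open>Around the cycle the differences telescope; the signs undo the orientation from
  \<open>Min\<close> to \<open>Max\<close> that \<open>edge_diff\<close> imposes.\<close>

lemma cycle_relation:
  assumes "C \<in> cycles E"
  obtains \<epsilon> :: "nat set \<Rightarrow> int" where "\<And>e. e \<in> C \<Longrightarrow> \<epsilon> e = 1 \<or> \<epsilon> e = -1"
    "\<And>u :: nat \<Rightarrow> complex. (\<Sum>e\<in>C. of_int (\<epsilon> e) * edge_diff e u) = 0"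
proof -
  obtain vs where vs: "distinct vs" "length vs \<ge> 3" "C = {{vs ! i, vs ! (Suc i mod length vs)} |i. i < length vs}"
    using assms unfolding cycles_def by auto
  define l where "l = length vs"
  have l3: "l \<ge> 3" using vs(2) by (simp add: l_def)
  define D where "D = (\<lambda>i. {vs ! i, vs ! (Suc i mod l)})"
  have C: "C = D ` {..<l}" using vs(3) by (auto simp: D_def l_def)
  have md: "Suc i mod l = (if Suc i = l then 0 else Suc i)" if "i < l" for i using that by auto
  have eq: "vs ! i = vs ! j \<longleftrightarrow> i = j" if "i < l" "j < l" for i j
    using vs(1) that by (simp add: nth_eq_iff_index_eq l_def)
  \<comment> \<open>Here the length of at least three matters: a closed walk of length two would use
    its edge twice.\<close>
  have inj: "inj_on D {..<l}"
  proof (rule inj_onI)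
    fix i j assume ij: "i \<in> {..<l}" "j \<in> {..<l}" "D i = D j"
    have m: "Suc i mod l < l" "Suc j mod l < l" using l3 by auto
    have "i = j \<or> (i = Suc j mod l \<and> Suc i mod l = j)"
      using ij m eq unfolding D_def doubleton_eq_iff by auto
    then show "i = j" using md ij l3 by (auto split: if_splits)
  qed
  define \<sigma> :: "nat \<Rightarrow> int" where "\<sigma> = (\<lambda>i. if vs ! i < vs ! (Suc i mod l) then 1 else -1)"
  define \<epsilon> where "\<epsilon> = (\<lambda>e. \<sigma> (inv_into {..<l} D e))"
  have ed: "\<epsilon> (D i) = \<sigma> i" if "i < l" for i unfolding \<epsilon>_def using inj that by simp
  have "(\<Sum>e\<in>C. of_int (\<epsilon> e) * edge_diff e u) = 0" for u :: "nat \<Rightarrow> complex"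
  proof -
    have "(\<Sum>e\<in>C. of_int (\<epsilon> e) * edge_diff e u) = (\<Sum>i<l. of_int (\<epsilon> (D i)) * edge_diff (D i) u)"
      unfolding C sum.reindex[OF inj] by simp
    also have "\<dots> = (\<Sum>i<l. u (vs ! i) - u (vs ! (Suc i mod l)))"
    proof (rule sum.cong[OF refl])
      fix i assume "i \<in> {..<l}"
      then show "of_int (\<epsilon> (D i)) * edge_diff (D i) u = u (vs ! i) - u (vs ! (Suc i mod l))"
        by (subst ed) (simp_all add: \<sigma>_def D_def edge_diff_pair)
    qed
    also have "\<dots> = 0"
    proof -
      obtain m where m: "l = Suc m" using l3 by (cases l) auto
      have "(\<Sum>i<l. u (vs ! (Suc i mod l))) = (\<Sum>i<m. u (vs ! Suc i)) + u (vs ! 0)"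
        unfolding m by (auto intro: sum.cong)
      also have "\<dots> = (\<Sum>i<l. u (vs ! i))" unfolding m sum.lessThan_Suc_shift by simp
      finally show ?thesis by (simp add: sum_subtractf)
    qed
    finally show ?thesis .
  qed
  moreover have "\<epsilon> e = 1 \<or> \<epsilon> e = -1" for e by (simp add: \<epsilon>_def \<sigma>_def)
  ultimately show thesis using that by blast
qed

lemma cycle_edge_determined:
  assumes "C \<in> cycles E" "e \<in> C" "\<And>f. f \<in> C - {e} \<Longrightarrow> edge_diff f u = (0::complex)"
  shows "edge_diff e u = 0"
proof -
  obtain \<epsilon> where \<epsilon>: "\<And>e. e \<in> C \<Longrightarrow> \<epsilon> e = 1 \<or> \<epsilon> e = (-1::int)"
    "\<And>u :: nat \<Rightarrow> complex. (\<Sum>e\<in>C. of_int (\<epsilon> e) * edge_diff e u) = 0"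
    using cycle_relation[OF assms(1)] by metis
  have "finite C" using cycle_nonempty[OF assms(1)] by simp
  then have "(\<Sum>e\<in>C. of_int (\<epsilon> e) * edge_diff e u) = of_int (\<epsilon> e) * edge_diff e u"
    using assms by (simp add: sum.remove)
  then show ?thesis using \<epsilon>(1)[OF assms(2)] \<epsilon>(2)[of u] by auto
qed

section \<open>Paths and monochromatic colourings\<close>

definition linked :: "nat set set \<Rightarrow> nat \<Rightarrow> nat \<Rightarrow> bool" where
  "linked A = (\<lambda>x y. {x, y} \<in> A)\<^sup>*\<^sup>*"

lemma linked_simple_path:
  assumes "linked A a b"
  shows "\<exists>xs. xs \<noteq> [] \<and> hd xs = a \<and> last xs = b \<and> distinct xs \<and> successively (\<lambda>x y. {x, y} \<in> A) xs"
  using assms unfolding linked_def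
proof (induction rule: rtranclp_induct)
  case base
  then show ?case by (intro exI[of _ "[a]"]) auto
next
  case (step y z)
  then obtain xs where xs: "xs \<noteq> []" "hd xs = a" "last xs = y" "distinct xs" "successively (\<lambda>x y. {x, y} \<in> A) xs"
    by auto
  show ?case
  proof (cases "z \<in> set xs")
    case True
    then obtain ys zs where "xs = ys @ z # zs" by (meson split_list)
    then have "xs = (ys @ [z]) @ zs" by simp
    then show ?thesis using xs
      by (intro exI[of _ "ys @ [z]"]) (auto simp: successively_append_iff hd_append split: if_splits)
  next
    case False
    then show ?thesis using xs step(2)
      by (intro exI[of _ "xs @ [z]"]) (auto simp: successively_append_iff)
  qed
qed

text \<open>A simple path is closed up by the new edge. As that edge is not in \<open>A\<close>, the
  path has at least three vertices.\<close>

lemma linked_cycle: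
  assumes "linked A a b" "a \<noteq> b" "{a, b} \<notin> A"
  shows "\<exists>C\<in>cycles (insert {a, b} A). {a, b} \<in> C"
proof -
  obtain xs where xs: "xs \<noteq> []" "hd xs = a" "last xs = b" "distinct xs" "successively (\<lambda>x y. {x, y} \<in> A) xs"
    using linked_simple_path[OF assms(1)] by auto
  define l where "l = length xs"
  have nthA: "{xs ! i, xs ! Suc i} \<in> A" if "Suc i < l" for i
    using xs(5) that unfolding successively_conv_nth l_def by auto
  have a: "xs ! 0 = a" using xs(1,2) by (simp add: hd_conv_nth)
  have b: "xs ! (l - 1) = b" using xs(1,3) by (simp add: last_conv_nth l_def)
  have "l \<noteq> 0" using xs(1) by (simp add: l_def)
  moreover have "l \<noteq> 1" using a b assms(2) by auto
  moreover have "l \<noteq> 2" using a b nthA[of 0] assms(3) by auto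
  ultimately have l3: "l \<ge> 3" by linarith
  let ?C = "{{xs ! i, xs ! (Suc i mod length xs)} |i. i < length xs}"
  have wrap: "{xs ! (l - 1), xs ! (Suc (l - 1) mod l)} = {a, b}" using a b l3 by auto
  have "?C \<subseteq> insert {a, b} A"
  proof
    fix f assume "f \<in> ?C"
    then obtain i where i: "i < l" "f = {xs ! i, xs ! (Suc i mod l)}" by (auto simp: l_def)
    show "f \<in> insert {a, b} A"
    proof (cases "Suc i = l")
      case True then have "i = l - 1" by simp
      then show ?thesis using wrap i(2) by simp
    next
      case False then show ?thesis using nthA[of i] i by simp
    qed
  qed
  then have "?C \<in> cycles (insert {a, b} A)" unfolding cycles_def using xs(4) l3 l_def by blast
  moreover have "{a, b} \<in> ?C" using wrap l3 unfolding l_def by (intro CollectI exI[of _ "length xs - 1"]) auto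
  ultimately show ?thesis by (rule bexI[rotated])
qed

text \<open>Their number is \<open>k\<close> to the number of components of \<open>A\<close>.
  Counting them gives access to ranks without a notion of component.\<close>

definition mono_cols :: "nat \<Rightarrow> nat \<Rightarrow> nat set set \<Rightarrow> (nat \<Rightarrow> nat) set" where
  "mono_cols n k A = {c \<in> {1..n} \<rightarrow>\<^sub>E {..<k}. \<forall>i j. {i, j} \<in> A \<longrightarrow> c i = c j}"

lemma finite_mono_cols: "finite (mono_cols n k A)"
  unfolding mono_cols_def by (rule finite_subset[of _ "{1..n} \<rightarrow>\<^sub>E {..<k}"]) (auto intro: finite_PiE)

lemma mono_cols_antimono: "A \<subseteq> B \<Longrightarrow> mono_cols n k B \<subseteq> mono_cols n k A"
  unfolding mono_cols_def by auto

lemma linked_step: "{i, j} \<in> A \<Longrightarrow> linked A b i \<longleftrightarrow> linked A b j"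
proof -
  assume ij: "{i, j} \<in> A"
  then have ji: "{j, i} \<in> A" by (simp add: insert_commute)
  show ?thesis unfolding linked_def
    using rtranclp.rtrancl_into_rtrancl[of "\<lambda>x y. {x, y} \<in> A" b i j] ij
      rtranclp.rtrancl_into_rtrancl[of "\<lambda>x y. {x, y} \<in> A" b j i] ji by blast
qed

lemma linked_sym: "linked A a b \<Longrightarrow> linked A b a"
  unfolding linked_def
proof (induction rule: rtranclp_induct)
  case (step y z)
  then have "{z, y} \<in> A" by (simp add: insert_commute)
  then show ?case using step(3) by (rule converse_rtranclp_into_rtranclp)
qed simp

text \<open>A colouring for \<open>A\<close> amounts to one that agrees at \<open>a\<close> and
  \<open>b\<close>, together with a cyclic shift of the colours on the component of
  \<open>b\<close>.\<close>

lemma card_mono_cols_insert: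
  assumes nl: "\<not> linked A a b" and ab: "a \<in> {1..n}" "b \<in> {1..n}"
    and A: "\<And>i j. {i, j} \<in> A \<Longrightarrow> i \<in> {1..n} \<and> j \<in> {1..n}"
  shows "card (mono_cols n k A) = card (mono_cols n k (insert {a, b} A)) * k"
proof (cases "k = 0")
  case True
  then show ?thesis using ab by (auto simp: mono_cols_def PiE_eq_empty_iff)
next
  case False
  then have k: "k > 0" by simp
  define R where "R = linked A b"
  have Rb: "R b" unfolding R_def linked_def by simp
  have Ra: "\<not> R a"
  proof
    assume "R a"
    then show False using nl linked_sym unfolding R_def by blast
  qed
  have Rst: "R i \<longleftrightarrow> R j" if "{i, j} \<in> A" for i j unfolding R_def by (rule linked_step[OF that])
  define shift where "shift = (\<lambda>(c :: nat \<Rightarrow> nat) \<delta>. \<lambda>i\<in>{1..n}. if R i then (c i + \<delta>) mod k else c i)"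
  have sh: "shift c \<delta> i = (if R i then (c i + \<delta>) mod k else c i)" if "i \<in> {1..n}" for c \<delta> i
    using that by (simp add: shift_def)
  have bij: "bij_betw (\<lambda>(c, \<delta>). shift c \<delta>) (mono_cols n k (insert {a, b} A) \<times> {..<k}) (mono_cols n k A)"
  \<comment> \<open>The inverse shifts by \<open>c a - c b\<close> modulo \<open>k\<close> and
    records \<open>c b - c a\<close>; adding \<open>k\<close> before subtracting avoids
    truncation.\<close>
  proof (rule bij_betw_byWitness[where f' = "\<lambda>c. (shift c (c a + (k - c b)), (c b + (k - c a)) mod k)"])
    have lt: "c i < k" if "c \<in> mono_cols n k B" "i \<in> {1..n}" for c i B
      using that by (auto simp: mono_cols_def PiE_iff)
    have ext: "shift c \<delta> = c'" if "c' \<in> mono_cols n k B" "\<And>i. i \<in> {1..n} \<Longrightarrow> shift c \<delta> i = c' i" for c c' \<delta> B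
      using that by (auto simp: mono_cols_def PiE_iff extensional_def shift_def fun_eq_iff restrict_def)
    have mem: "shift c \<delta> \<in> mono_cols n k A" if "c \<in> mono_cols n k A" for c \<delta>
      unfolding mono_cols_def
    proof (intro CollectI conjI allI impI)
      show "shift c \<delta> \<in> {1..n} \<rightarrow>\<^sub>E {..<k}" unfolding shift_def using lt[OF that] k by (auto)
      fix i j assume ij: "{i, j} \<in> A"
      then have "c i = c j" using that by (simp add: mono_cols_def)
      then show "shift c \<delta> i = shift c \<delta> j" using A[OF ij] Rst[OF ij] by (simp add: sh)
    qed
    have anti: "mono_cols n k (insert {a, b} A) \<subseteq> mono_cols n k A" by (rule mono_cols_antimono) auto
    show "\<forall>x\<in>mono_cols n k (insert {a, b} A) \<times> {..<k}.
      (\<lambda>c. (shift c (c a + (k - c b)), (c b + (k - c a)) mod k)) (case x of (c, \<delta>) \<Rightarrow> shift c \<delta>) = x"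
    proof (rule ballI)
      fix x assume "x \<in> mono_cols n k (insert {a, b} A) \<times> {..<k}"
      then obtain c \<delta> where x: "x = (c, \<delta>)" and c: "c \<in> mono_cols n k (insert {a, b} A)" and \<delta>: "\<delta> < k"
        by auto
      have cab: "c a = c b" using c by (auto simp: mono_cols_def)
      let ?c' = "shift c \<delta>"
      have v: "?c' a = c a" "?c' b = (c a + \<delta>) mod k" using ab Ra Rb cab by (simp_all add: sh)
      have ck: "c i < k" if "i \<in> {1..n}" for i using lt[OF c that] .
      have m1: "((x + \<delta>) mod k + (c a + (k - (c a + \<delta>) mod k))) mod k = x" if "x < k" for x
      proof (cases "c a + \<delta> < k")
        case True
        then show ?thesis using that \<delta> by (cases "x + \<delta> < k") (auto simp: mod_if)
      next
        case False
        then have e: "(c a + \<delta>) mod k = c a + \<delta> - k" using ck[OF ab(1)] \<delta> by (simp add: mod_if)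
        show ?thesis unfolding e using that \<delta> False ck[OF ab(1)] by (cases "x + \<delta> < k") (auto simp: mod_if)
      qed
      have "shift ?c' (?c' a + (k - ?c' b)) = c"
      proof (rule ext[OF c])
        fix i assume i: "i \<in> {1..n}"
        show "shift ?c' (?c' a + (k - ?c' b)) i = c i"
          unfolding v using m1[OF ck[OF i]] i by (simp add: sh)
      qed
      moreover have "(?c' b + (k - ?c' a)) mod k = \<delta>"
        unfolding v using \<delta> ck[OF ab(1)] by (cases "c a + \<delta> < k") (auto simp: mod_if)
      ultimately show "(\<lambda>c. (shift c (c a + (k - c b)), (c b + (k - c a)) mod k)) (case x of (c, \<delta>) \<Rightarrow> shift c \<delta>) = x"
        unfolding x by simp
    qed
    show "\<forall>c\<in>mono_cols n k A. (case (shift c (c a + (k - c b)), (c b + (k - c a)) mod k) of (c, \<delta>) \<Rightarrow> shift c \<delta>) = c"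
    proof
      fix c assume c: "c \<in> mono_cols n k A"
      have ck: "c i < k" if "i \<in> {1..n}" for i using lt[OF c that] .
      have m2: "((x + (c a + (k - c b))) mod k + (c b + (k - c a)) mod k) mod k = x" if "x < k" for x
      proof -
        have "((x + (c a + (k - c b))) mod k + (c b + (k - c a)) mod k) mod k = (x + (c a + (k - c b)) + (c b + (k - c a))) mod k"
          by (simp add: mod_add_eq)
        also have "x + (c a + (k - c b)) + (c b + (k - c a)) = x + k * 2" using ck[OF ab(1)] ck[OF ab(2)] by simp
        finally show ?thesis using that by simp
      qed
      have "shift (shift c (c a + (k - c b))) ((c b + (k - c a)) mod k) = c"
        by (rule ext[OF c]) (use m2 ck in \<open>simp add: sh\<close>)
      then show "(case (shift c (c a + (k - c b)), (c b + (k - c a)) mod k) of (c, \<delta>) \<Rightarrow> shift c \<delta>) = c" by simp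
    qed
    show "(\<lambda>(c, \<delta>). shift c \<delta>) ` (mono_cols n k (insert {a, b} A) \<times> {..<k}) \<subseteq> mono_cols n k A"
      using mem anti by auto
    show "(\<lambda>c. (shift c (c a + (k - c b)), (c b + (k - c a)) mod k)) ` mono_cols n k A
      \<subseteq> mono_cols n k (insert {a, b} A) \<times> {..<k}"
    proof (rule image_subsetI)
      fix c assume c: "c \<in> mono_cols n k A"
      have ck: "c i < k" if "i \<in> {1..n}" for i using lt[OF c that] .
      let ?d = "shift c (c a + (k - c b))"
      have "?d b = (c b + (c a + (k - c b))) mod k" using ab Rb by (simp add: sh)
      also have "c b + (c a + (k - c b)) = c a + k" using ck[OF ab(2)] by simp
      finally have "?d a = ?d b" using ab Ra ck[OF ab(1)] by (simp add: sh)
      then have "?d \<in> mono_cols n k (insert {a, b} A)" using mem[OF c, of "c a + (k - c b)"]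
        by (auto simp: mono_cols_def doubleton_eq_iff)
      then show "(?d, (c b + (k - c a)) mod k) \<in> mono_cols n k (insert {a, b} A) \<times> {..<k}" using k by simp
    qed
  qed
  then show ?thesis using bij_betw_same_card[OF bij] by (simp add: card_cartesian_product)
qed

lemma simple_graph_mono: "simple_graph n E \<Longrightarrow> A \<subseteq> E \<Longrightarrow> simple_graph n A"
  unfolding simple_graph_def by auto

lemma simple_graph_pair: "simple_graph n E \<Longrightarrow> {i, j} \<in> E \<Longrightarrow> i \<in> {1..n} \<and> j \<in> {1..n}"
  unfolding simple_graph_def by auto

lemma forest_cols:
  assumes "finite X" "simple_graph n X" "cycles X = {}"
  shows "card (mono_cols n k X) * k ^ card X = k ^ n"
  using assms
proof (induction X rule: finite_induct)
  case empty
  have "mono_cols n k {} = {1..n} \<rightarrow>\<^sub>E {..<k}" unfolding mono_cols_def by auto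
  then show ?case by (simp add: card_PiE)
next
  case (insert e X)
  obtain a b where ab: "e = {a, b}" "a < b" "a \<in> {1..n}" "b \<in> {1..n}"
    using simple_graphD[OF insert(4), of e] by blast
  have nl: "\<not> linked X a b"
    using linked_cycle[of X a b] ab insert(2,5) by auto
  have sgX: "simple_graph n X" by (rule simple_graph_mono[OF insert(4)]) auto
  have "card (mono_cols n k X) = card (mono_cols n k (insert e X)) * k"
    unfolding ab(1) by (rule card_mono_cols_insert[OF nl ab(3,4)]) (rule simple_graph_pair[OF sgX])
  moreover have "cycles X = {}" using insert(5) cycles_mono[of _ X "insert e X"] by blast
  ultimately show ?case using insert.IH[OF sgX] insert(1,2) by (simp add: mult_ac)
qed

lemma graphic_indep: "matroid_indep (graphic_matroid E) X \<longleftrightarrow> X \<subseteq> E \<and> cycles X = {}"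
proof
  assume "matroid_indep (graphic_matroid E) X"
  then show "X \<subseteq> E \<and> cycles X = {}" unfolding matroid_indep_def graphic_matroid_def
    using cycles_mono[of _ X E] cycle_nonempty[of _ X] by auto
next
  assume "X \<subseteq> E \<and> cycles X = {}"
  then show "matroid_indep (graphic_matroid E) X" unfolding matroid_indep_def graphic_matroid_def
    using cycles_sub[of _ E X] by auto
qed

text \<open>Colours are read as complex numbers, so that the signed relation of the circuit forces
  its last edge to be monochromatic.\<close>

lemma mono_cols_cycle:
  assumes "simple_graph n E" "C \<in> cycles E" "e \<in> C" "C - {e} \<subseteq> A"
  shows "mono_cols n k (insert e A) = mono_cols n k A"
proof
  show "mono_cols n k (insert e A) \<subseteq> mono_cols n k A" by (rule mono_cols_antimono) auto
  show "mono_cols n k A \<subseteq> mono_cols n k (insert e A)"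
  proof
    fix c assume c: "c \<in> mono_cols n k A"
    have CE: "C \<subseteq> E" using cycle_nonempty[OF assms(2)] by simp
    have z: "edge_diff f (\<lambda>i. complex_of_nat (c i)) = 0" if f: "f \<in> C - {e}" for f
    proof -
      obtain a b where "f = {a, b}" "Min f = a" "Max f = b" using simple_graphD[OF assms(1), of f] f CE by blast
      then show ?thesis using c f assms(4) by (auto simp: edge_diff_def mono_cols_def)
    qed
    obtain a b where ab: "e = {a, b}" "Min e = a" "Max e = b"
      using simple_graphD[OF assms(1), of e] assms(3) CE by blast
    have "edge_diff e (\<lambda>i. complex_of_nat (c i)) = 0" by (rule cycle_edge_determined[OF assms(2,3) z])
    then have "c a = c b" using ab by (simp add: edge_diff_def)
    then show "c \<in> mono_cols n k (insert e A)" using c ab by (auto simp: mono_cols_def doubleton_eq_iff)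
  qed
qed

text \<open>A forest of largest size will do: every further edge closes a circuit with it, and
  therefore does not restrict the monochromatic colourings any more.\<close>

lemma max_forest:
  assumes sg: "simple_graph n E" and A: "A \<subseteq> E"
  obtains X where "X \<subseteq> A" "cycles X = {}" "\<And>k. mono_cols n k X = mono_cols n k A"
    "\<And>e. e \<in> A - X \<Longrightarrow> \<exists>C\<in>cycles E. e \<in> C \<and> C - {e} \<subseteq> X"
    "card X = matroid_rank (graphic_matroid E) A"
proof -
  have finA: "finite A" using simple_graph_finite[OF sg] A finite_subset by blast
  define P where "P = (\<lambda>X. X \<subseteq> A \<and> cycles X = {})"
  have "P {}" unfolding P_def using cycle_nonempty[of _ "{}"] by auto
  moreover have "\<forall>y. P y \<longrightarrow> card y < Suc (card A)" unfolding P_def less_Suc_eq_le using finA card_mono by blast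
  ultimately obtain X where X: "P X" "\<And>y. P y \<Longrightarrow> card y \<le> card X"
    using ex_has_greatest_nat[of P "{}" card] by metis
  have finX: "finite X" using X(1) finA finite_subset unfolding P_def by blast
  have cyc: "\<exists>C\<in>cycles E. e \<in> C \<and> C - {e} \<subseteq> X" if e: "e \<in> A - X" for e
  proof -
    have "\<not> P (insert e X)" using X(2)[of "insert e X"] e finX by auto
    then obtain C where C: "C \<in> cycles (insert e X)" using X(1) e unfolding P_def by auto
    have sub: "C \<subseteq> insert e X" using cycle_nonempty[OF C] by simp
    have "e \<in> C" using cycles_sub[OF C, of X] sub X(1) unfolding P_def by auto
    moreover have "C \<in> cycles E" using cycles_mono[OF C, of E] e A X(1) unfolding P_def by auto
    ultimately show ?thesis using sub by auto
  qed
  have cols: "mono_cols n k X = mono_cols n k A" for k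
  proof
    show "mono_cols n k A \<subseteq> mono_cols n k X" using X(1) unfolding P_def by (intro mono_cols_antimono) simp
    show "mono_cols n k X \<subseteq> mono_cols n k A"
    proof
      fix c assume c: "c \<in> mono_cols n k X"
      have "c i = c j" if ij: "{i, j} \<in> A" for i j
      proof (cases "{i, j} \<in> X")
        case True then show ?thesis using c by (simp add: mono_cols_def)
      next
        case False
        then obtain C where "C \<in> cycles E" "{i, j} \<in> C" "C - {{i, j}} \<subseteq> X" using cyc[of "{i,j}"] ij by auto
        then have "c \<in> mono_cols n k (insert {i, j} X)" using mono_cols_cycle[OF sg] c by blast
        then show ?thesis by (simp add: mono_cols_def)
      qed
      then show "c \<in> mono_cols n k A" using c by (simp add: mono_cols_def)
    qed
  qed
  have "matroid_rank (graphic_matroid E) A = card X"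
    unfolding matroid_rank_def
  proof (rule Max_eqI)
    show "finite (card ` {X. X \<subseteq> A \<and> matroid_indep (graphic_matroid E) X})" using finA by simp
    show "card X \<in> card ` {X. X \<subseteq> A \<and> matroid_indep (graphic_matroid E) X}"
      using X(1) A unfolding P_def graphic_indep by blast
    fix y assume "y \<in> card ` {X. X \<subseteq> A \<and> matroid_indep (graphic_matroid E) X}"
    then show "y \<le> card X" using X(2) unfolding P_def graphic_indep by blast
  qed
  then show thesis using that[of X] X(1) cols cyc unfolding P_def by auto
qed

text \<open>The multiplied form avoids a truncated exponent. With \<open>k = 2\<close> it determines
  the rank from the number of colourings.\<close>

lemma rank_cols:
  assumes sg: "simple_graph n E" and A: "A \<subseteq> E"
  shows "card (mono_cols n k A) * k ^ matroid_rank (graphic_matroid E) A = k ^ n"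
proof -
  obtain X where X: "X \<subseteq> A" "cycles X = {}" "\<And>k. mono_cols n k X = mono_cols n k A"
    "card X = matroid_rank (graphic_matroid E) A" using max_forest[OF sg A] by metis
  have "finite X" by (rule finite_subset[OF order_trans[OF X(1) A] simple_graph_finite[OF sg]])
  then have "card (mono_cols n k X) * k ^ card X = k ^ n"
    by (rule forest_cols[OF _ simple_graph_mono[OF sg] X(2)]) (use X(1) A in blast)
  then show ?thesis unfolding X(3,4) .
qed

lemma card_mono_cols_nonzero:
  assumes "simple_graph n E" "A \<subseteq> E"
  shows "card (mono_cols n 2 A) \<noteq> 0"
proof
  assume "card (mono_cols n 2 A) = 0"
  then show False using rank_cols[OF assms, of 2] by simp
qed

lemma rank_eqI:
  assumes sg: "simple_graph n E" and "A \<subseteq> E" "B \<subseteq> E" "mono_cols n 2 A = mono_cols n 2 B"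
  shows "matroid_rank (graphic_matroid E) A = matroid_rank (graphic_matroid E) B"
proof -
  have "card (mono_cols n 2 A) * 2 ^ matroid_rank (graphic_matroid E) A = (2::nat) ^ n"
    "card (mono_cols n 2 A) * 2 ^ matroid_rank (graphic_matroid E) B = (2::nat) ^ n"
    using rank_cols[OF sg assms(2), of 2] rank_cols[OF sg assms(3), of 2] assms(4) by simp_all
  then have "card (mono_cols n 2 A) * 2 ^ matroid_rank (graphic_matroid E) A = card (mono_cols n 2 A) * 2 ^ matroid_rank (graphic_matroid E) B"
    by simp
  moreover have "card (mono_cols n 2 A) \<noteq> 0" by (rule card_mono_cols_nonzero[OF sg assms(2)])
  ultimately show ?thesis by simp
qed

lemma rank_forest:
  assumes sg: "simple_graph n E" and A: "A \<subseteq> E" and "cycles A = {}"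
  shows "matroid_rank (graphic_matroid E) A = card A"
proof -
  have "finite A" by (rule finite_subset[OF A simple_graph_finite[OF sg]])
  then have "card (mono_cols n 2 A) * 2 ^ card A = (2::nat) ^ n"
    by (rule forest_cols[OF _ simple_graph_mono[OF sg A] assms(3)])
  then have "card (mono_cols n 2 A) * 2 ^ matroid_rank (graphic_matroid E) A = card (mono_cols n 2 A) * 2 ^ card A"
    using rank_cols[OF sg A, of 2] by simp
  moreover have "card (mono_cols n 2 A) \<noteq> 0" by (rule card_mono_cols_nonzero[OF sg A])
  ultimately show ?thesis by simp
qed

section \<open>Broken circuits\<close>

lemma const_mono_cols:
  assumes sg: "simple_graph n E" and A: "A \<subseteq> E" and "v < k"
  shows "(\<lambda>i\<in>{1..n}. v) \<in> mono_cols n k A"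
  unfolding mono_cols_def
proof (intro CollectI conjI allI impI)
  show "(\<lambda>i\<in>{1..n}. v) \<in> {1..n} \<rightarrow>\<^sub>E {..<k}" using assms(3) by (intro restrict_PiE_iff[THEN iffD2]) simp
  fix i j assume "{i, j} \<in> A"
  then have "i \<in> {1..n} \<and> j \<in> {1..n}" by (rule simple_graph_pair[OF simple_graph_mono[OF sg A]])
  then show "(\<lambda>i\<in>{1..n}. v) i = (\<lambda>i\<in>{1..n}. v) j" by simp
qed

text \<open>The two constant colourings leave at least one factor of two beside the power given by
  the rank.\<close>

lemma rank_less:
  assumes sg: "simple_graph n E" and A: "A \<subseteq> E" and n: "n \<ge> 1"
  shows "matroid_rank (graphic_matroid E) A < n"
proof -
  let ?c = "\<lambda>v. \<lambda>i\<in>{1..n}. (v::nat)"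
  have "?c 0 \<in> mono_cols n 2 A" "?c 1 \<in> mono_cols n 2 A" by (intro const_mono_cols[OF sg A]; simp)+
  moreover have "?c 0 \<noteq> ?c 1" using n by (auto simp: fun_eq_iff)
  ultimately have "2 \<le> card (mono_cols n 2 A)"
    using card_mono[OF finite_mono_cols, of "{?c 0, ?c 1}" n 2 A] by simp
  then have "2 * 2 ^ matroid_rank (graphic_matroid E) A \<le> (2::nat) ^ n"
    unfolding rank_cols[OF sg A, of 2, symmetric] by (rule mult_le_mono1)
  then have "(2::nat) ^ Suc (matroid_rank (graphic_matroid E) A) \<le> 2 ^ n" by simp
  then have "Suc (matroid_rank (graphic_matroid E) A) \<le> n" by (rule power_le_imp_le_exp[rotated]) simp
  then show ?thesis by simp
qed

text \<open>Phrased through vertex sets closed under edges: such a set contradicts rigidity by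
  translation, and level sets of a function constant on edges are of this kind.\<close>

definition connected_graph :: "nat \<Rightarrow> nat set set \<Rightarrow> bool" where
  "connected_graph n E \<longleftrightarrow> (\<forall>S\<subseteq>{1..n}. (\<forall>i j. {i, j} \<in> E \<longrightarrow> (i \<in> S \<longleftrightarrow> j \<in> S)) \<longrightarrow> S = {} \<or> S = {1..n})"

lemma connected_const:
  assumes sg: "simple_graph n E" and c: "connected_graph n E" and f: "\<And>i j. {i, j} \<in> E \<Longrightarrow> f i = f j"
    and i: "i \<in> {1..n}" "j \<in> {1..n}"
  shows "f i = f j"
proof -
  let ?S = "{k \<in> {1..n}. f k = f i}"
  have "\<forall>k l. {k, l} \<in> E \<longrightarrow> (k \<in> ?S \<longleftrightarrow> l \<in> ?S)" using f simple_graph_pair[OF sg] by auto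
  moreover have "?S \<subseteq> {1..n}" by blast
  ultimately have "?S = {} \<or> ?S = {1..n}" using c unfolding connected_graph_def by blast
  moreover have "i \<in> ?S" using i by simp
  ultimately have "j \<in> ?S" using i(2) by blast
  then show ?thesis by simp
qed

lemma rank_connected:
  assumes sg: "simple_graph n E" and c: "connected_graph n E" and n: "n \<ge> 1"
  shows "matroid_rank (graphic_matroid E) E = n - 1"
proof -
  let ?c = "\<lambda>v. \<lambda>i\<in>{1..n}. (v::nat)"
  have "mono_cols n 2 E \<subseteq> {?c 0, ?c 1}"
  proof
    fix d assume d: "d \<in> mono_cols n 2 E"
    have dc: "d i = d 1" if "i \<in> {1..n}" for i
    proof (rule connected_const[where f = d, OF sg c])
      fix i j assume "{i, j} \<in> E"
      then show "d i = d j" using d unfolding mono_cols_def by blast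
    qed (use that n in auto)
    have eq: "d i = ?c (d 1) i" if "i \<in> {1..n}" for i unfolding dc[OF that] using that by simp
    have dP: "d \<in> {1..n} \<rightarrow>\<^sub>E {..<2}" using d unfolding mono_cols_def by blast
    have eqd: "d = ?c (d 1)"
    proof (rule extensionalityI)
      show "d \<in> extensional {1..n}" using dP by (simp add: PiE_def)
      show "?c (d 1) \<in> extensional {1..n}" by (rule restrict_extensional)
    qed (rule eq)
    have "d 1 \<in> {..<2}" using n by (intro PiE_mem[OF dP]) simp
    then have "d 1 = 0 \<or> d 1 = 1" by auto
    then have "?c (d 1) \<in> {?c 0, ?c 1}" by auto
    then show "d \<in> {?c 0, ?c 1}" by (subst eqd)
  qed
  then have "card (mono_cols n 2 E) \<le> card {?c 0, ?c 1}" by (intro card_mono) auto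
  also have "\<dots> \<le> 2" by (simp add: card_insert_if)
  finally have "2 ^ n \<le> 2 * (2::nat) ^ matroid_rank (graphic_matroid E) E"
    unfolding rank_cols[OF sg order_refl, of 2, symmetric] by (rule mult_le_mono1)
  then have "(2::nat) ^ n \<le> 2 ^ Suc (matroid_rank (graphic_matroid E) E)" by simp
  then have "n \<le> Suc (matroid_rank (graphic_matroid E) E)" by (rule power_le_imp_le_exp[rotated]) simp
  then show ?thesis using rank_less[OF sg order_refl n] by linarith
qed


lemma rank_le_card:
  assumes sg: "simple_graph n E" and A: "A \<subseteq> E"
  shows "matroid_rank (graphic_matroid E) A \<le> card A"
proof -
  obtain X where X: "X \<subseteq> A" "card X = matroid_rank (graphic_matroid E) A" using max_forest[OF sg A] by metis
  have "card X \<le> card A" by (rule card_mono[OF finite_subset[OF A simple_graph_finite[OF sg]] X(1)])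
  then show ?thesis unfolding X(2) .
qed

section \<open>Inclusion-exclusion for proper colourings\<close>

lemma sum_Pow_alternating:
  assumes "finite B"
  shows "(\<Sum>A\<in>Pow B. (-1) ^ card A) = (if B = {} then 1 else 0 :: int)"
  using assms
proof (induction B rule: finite_induct)
  case (insert x B)
  have inj: "inj_on (insert x) (Pow B)" using insert(2) by (auto simp: inj_on_def)
  have fA: "finite A" if "A \<in> Pow B" for A using that insert(1) finite_subset by auto
  have "(\<Sum>A\<in>Pow (insert x B). (-1) ^ card A) = (\<Sum>A\<in>Pow B. (-1) ^ card A) + (\<Sum>A\<in>insert x ` Pow B. (-1::int) ^ card A)"
    unfolding Pow_insert by (rule sum.union_disjoint) (use insert(1,2) in auto)
  also have "(\<Sum>A\<in>insert x ` Pow B. (-1::int) ^ card A) = (\<Sum>A\<in>Pow B. - ((-1) ^ card A))"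
    unfolding sum.reindex[OF inj] comp_def
  proof (rule sum.cong[OF refl])
    fix A assume A: "A \<in> Pow B"
    then have "card (insert x A) = Suc (card A)" using fA insert(2) by (intro card_insert_disjoint) auto
    then show "(-1::int) ^ card (insert x A) = - ((-1) ^ card A)" by simp
  qed
  finally show ?case by (simp add: sum_negf)
qed simp

text \<open>For a colouring \<open>c\<close>, the alternating sum over the subsets of its
  monochromatic edges \<open>bad c\<close> detects whether there are any; then the two sums are
  exchanged.\<close>

lemma card_proper_colourings:
  assumes sg: "simple_graph n E"
  shows "int (card (proper_colourings n E k)) = (\<Sum>A\<in>Pow E. (-1) ^ card A * int (card (mono_cols n k A)))"
proof -
  let ?X = "{1..n} \<rightarrow>\<^sub>E {..<k}"
  have finX: "finite ?X" by (intro finite_PiE) auto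
  have finE: "finite E" by (rule simple_graph_finite[OF sg])
  define bad where "bad = (\<lambda>c :: nat \<Rightarrow> nat. {e \<in> E. c (Min e) = c (Max e)})"
  have pr: "{i, j} \<in> bad c \<longleftrightarrow> {i, j} \<in> E \<and> c i = c j" for i j c
    unfolding bad_def using Min_Max_pair[of i j] by auto
  have mem: "c \<in> mono_cols n k A \<longleftrightarrow> A \<subseteq> bad c" if hyp: "c \<in> ?X" "A \<subseteq> E" for c A
  proof
    assume c: "c \<in> mono_cols n k A"
    show "A \<subseteq> bad c"
    proof
      fix e assume e: "e \<in> A"
      then obtain i j where "e = {i, j}" using simple_graphD[OF sg, of e] hyp(2) by blast
      then show "e \<in> bad c" using c e hyp(2) pr unfolding mono_cols_def by blast
    qed
  next
    assume "A \<subseteq> bad c" then show "c \<in> mono_cols n k A" using hyp pr unfolding mono_cols_def by blast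
  qed
  have prc: "proper_colourings n E k = {c \<in> ?X. bad c = {}}"
  proof (intro set_eqI iffI)
    fix c assume c: "c \<in> proper_colourings n E k"
    have "bad c = {}"
    proof (rule ccontr)
      assume "bad c \<noteq> {}"
      then obtain e where e: "e \<in> bad c" by auto
      then have "e \<in> E" by (simp add: bad_def)
      then obtain i j where "e = {i, j}" using simple_graphD[OF sg] by metis
      then show False using e c pr unfolding proper_colourings_def by blast
    qed
    then show "c \<in> {c \<in> ?X. bad c = {}}" using c unfolding proper_colourings_def by blast
  next
    fix c assume "c \<in> {c \<in> ?X. bad c = {}}"
    then show "c \<in> proper_colourings n E k" using pr unfolding proper_colourings_def by blast
  qed
  have "(\<Sum>A\<in>Pow E. (-1) ^ card A * int (card (mono_cols n k A)))
    = (\<Sum>A\<in>Pow E. \<Sum>c\<in>?X. if A \<subseteq> bad c then (-1) ^ card A else 0)"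
  proof (rule sum.cong[OF refl])
    fix A assume A: "A \<in> Pow E"
    have "mono_cols n k A = {c \<in> ?X. A \<subseteq> bad c}" using mem A by (auto simp: mono_cols_def)
    then show "(-1) ^ card A * int (card (mono_cols n k A)) = (\<Sum>c\<in>?X. if A \<subseteq> bad c then (-1) ^ card A else 0)"
      using finX by (simp add: sum.inter_filter[symmetric] mult.commute)
  qed
  also have "\<dots> = (\<Sum>c\<in>?X. \<Sum>A\<in>Pow E. if A \<subseteq> bad c then (-1) ^ card A else 0)" by (rule sum.swap)
  also have "\<dots> = (\<Sum>c\<in>?X. if bad c = {} then 1 else 0)"
  proof (rule sum.cong[OF refl])
    fix c
    have "{A \<in> Pow E. A \<subseteq> bad c} = Pow (bad c)" unfolding bad_def by auto
    then have "(\<Sum>A\<in>Pow E. if A \<subseteq> bad c then (-1) ^ card A else 0) = (\<Sum>A\<in>Pow (bad c). (-1::int) ^ card A)"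
      using finE sum.inter_filter[of "Pow E" "\<lambda>A. (-1::int) ^ card A" "\<lambda>A. A \<subseteq> bad c"] by simp
    also have "\<dots> = (if bad c = {} then 1 else 0)" by (rule sum_Pow_alternating) (simp add: bad_def finE)
    finally show "(\<Sum>A\<in>Pow E. if A \<subseteq> bad c then (-1) ^ card A else 0) = (if bad c = {} then 1 else 0 :: int)" .
  qed
  also have "\<dots> = int (card {c \<in> ?X. bad c = {}})" using finX by (simp add: sum.inter_filter[symmetric])
  finally show ?thesis unfolding prc by simp
qed

lemma chromatic_poly_eq:
  assumes sg: "simple_graph n E" and n: "n \<ge> 1"
  shows "chromatic_poly n E = (\<Sum>A\<in>Pow E. monom ((-1) ^ card A) (n - matroid_rank (graphic_matroid E) A))"
    (is "_ = ?P")
  unfolding chromatic_poly_def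
proof (rule the_equality)
  let ?r = "matroid_rank (graphic_matroid E)"
  show val: "\<forall>k. poly ?P (int k) = int (card (proper_colourings n E k))"
  proof
    fix k
    have "int (card (mono_cols n k A)) = int k ^ (n - ?r A)" if "A \<in> Pow E" for A
    proof -
      have A: "A \<subseteq> E" using that by simp
      have lt: "?r A < n" by (rule rank_less[OF sg A n])
      have "card (mono_cols n k A) = k ^ (n - ?r A)"
      \<comment> \<open>For \<open>k = 0\<close> a power of \<open>k\<close> cannot be cancelled,
        but both sides vanish because the rank is less than \<open>n\<close>.\<close>
      proof (cases "k = 0")
        case True
        then have "mono_cols n k A = {}" using n by (auto simp: mono_cols_def PiE_eq_empty_iff)
        then show ?thesis using True lt by simp
      next
        case False
        have "card (mono_cols n k A) * k ^ ?r A = k ^ (n - ?r A) * k ^ ?r A"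
          unfolding rank_cols[OF sg A] using lt by (simp add: power_add[symmetric])
        then show ?thesis using False by simp
      qed
      then show ?thesis by simp
    qed
    then show "poly ?P (int k) = int (card (proper_colourings n E k))"
      unfolding card_proper_colourings[OF sg] poly_sum poly_monom by (intro sum.cong) auto
  qed
  fix Q :: "int poly" assume Q: "\<forall>k. poly Q (int k) = int (card (proper_colourings n E k))"
  show "Q = ?P"
  proof (rule ccontr)
    assume "Q \<noteq> ?P"
    then have "finite {x. poly (Q - ?P) x = 0}" by (intro poly_roots_finite) simp
    moreover have "range int \<subseteq> {x. poly (Q - ?P) x = 0}"
      using Q val by (auto simp del: poly_sum)
    ultimately show False by (meson finite_subset infinite_UNIV_nat finite_imageD inj_of_nat)
  qed
qed

text \<open>The edge \<open>c\<close> is the least one of a circuit whose other edges lie in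
  \<open>A\<close>. Whether \<open>c\<close> itself lies in \<open>A\<close> is left open, so that
  toggling \<open>c\<close> does not affect the property.\<close>

definition has_broken :: "(nat set \<Rightarrow> nat) \<Rightarrow> nat set set \<Rightarrow> nat set set \<Rightarrow> nat set \<Rightarrow> bool" where
  "has_broken ord E A c \<longleftrightarrow> (\<exists>C\<in>cycles E. c \<in> C \<and> (\<forall>e\<in>C. ord c \<le> ord e) \<and> C - {c} \<subseteq> A)"

definition nbc :: "(nat set \<Rightarrow> nat) \<Rightarrow> nat set set \<Rightarrow> nat set set \<Rightarrow> bool" where
  "nbc ord E A \<longleftrightarrow> A \<subseteq> E \<and> (\<forall>c. \<not> has_broken ord E A c)"

lemma nbc_forest:
  assumes "nbc ord E A" shows "cycles A = {}"
proof (rule ccontr)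
  assume "cycles A \<noteq> {}"
  then obtain C where C: "C \<in> cycles A" by auto
  have AE: "A \<subseteq> E" using assms by (simp add: nbc_def)
  have ne: "C \<noteq> {}" "finite C" "C \<subseteq> A" using cycle_nonempty[OF C] by auto
  define c where "c = arg_min_on ord C"
  have c: "c \<in> C" "\<And>e. e \<in> C \<Longrightarrow> ord c \<le> ord e" unfolding c_def
    using arg_min_if_finite[OF ne(2,1), of ord] arg_min_least[OF ne(2,1), of _ ord] by auto
  have "has_broken ord E A c" unfolding has_broken_def
    using c ne(3) cycles_mono[OF C AE] by (intro bexI[of _ C]) auto
  then show False using assms by (simp add: nbc_def)
qed

lemma sum_involution_zero:
  fixes f :: "'a \<Rightarrow> int"
  assumes "\<And>x. x \<in> S \<Longrightarrow> i x \<in> S" "\<And>x. x \<in> S \<Longrightarrow> i (i x) = x" "\<And>x. x \<in> S \<Longrightarrow> f (i x) = - f x"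
  shows "sum f S = 0"
proof -
  have "sum f S = sum (\<lambda>x. - f x) S"
    by (rule sum.reindex_bij_witness[of _ i i]) (use assms in auto)
  then show ?thesis by (simp add: sum_negf)
qed

text \<open>Sets of full rank that contain a broken circuit cancel in pairs of opposite parity. The
  remaining ones are forests, so all of them have \<open>n - 1\<close> elements.\<close>

lemma whitney_broken_circuit:
  assumes sg: "simple_graph n E" and n: "n \<ge> 1" and ord: "inj_on ord E"
  shows "(\<Sum>A\<in>{A. A \<subseteq> E \<and> matroid_rank (graphic_matroid E) A = n - 1}. (-1) ^ card A)
    = (-1 :: int) ^ (n - 1) * int (card {A. nbc ord E A \<and> card A = n - 1})"
proof -
  let ?r = "matroid_rank (graphic_matroid E)"
  let ?hb = "has_broken ord E"
  have finE: "finite E" by (rule simple_graph_finite[OF sg])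
  define S where "S = {A. A \<subseteq> E \<and> ?r A = n - 1}"
  define B where "B = {A \<in> S. \<not> nbc ord E A}"
  have finS: "finite S" unfolding S_def using finE by simp
  \<comment> \<open>The greatest edge that completes a broken circuit in \<open>A\<close>. The other
    edges of \<open>A\<close> span it, so toggling it keeps the rank; being the greatest makes it
    recognisable after the toggle.\<close>
  define \<alpha> where "\<alpha> = (\<lambda>A. SOME c. ?hb A c \<and> (\<forall>d. ?hb A d \<longrightarrow> ord d \<le> ord c))"
  have hbE: "c \<in> E" if "?hb A c" for A c using that cycle_nonempty unfolding has_broken_def by blast
  have finhb: "finite {c. ?hb A c}" for A by (rule finite_subset[OF _ finE]) (use hbE in auto)
  have \<alpha>: "?hb A (\<alpha> A)" "\<And>c. ?hb A c \<Longrightarrow> ord c \<le> ord (\<alpha> A)" if A: "A \<in> B" for A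
  proof -
    have "{c. ?hb A c} \<noteq> {}" using A unfolding B_def S_def nbc_def by auto
    then have "Max (ord ` {c. ?hb A c}) \<in> ord ` {c. ?hb A c}" using finhb by (intro Max_in) auto
    then obtain c where c: "?hb A c" "Max (ord ` {c. ?hb A c}) = ord c" by auto
    have "\<forall>d. ?hb A d \<longrightarrow> ord d \<le> ord c"
      unfolding c(2)[symmetric] using finhb[of A] by (auto intro!: Max_ge)
    then have "\<exists>c. ?hb A c \<and> (\<forall>d. ?hb A d \<longrightarrow> ord d \<le> ord c)" using c(1) by blast
    then have "?hb A (\<alpha> A) \<and> (\<forall>d. ?hb A d \<longrightarrow> ord d \<le> ord (\<alpha> A))" unfolding \<alpha>_def by (rule someI_ex)
    then show "?hb A (\<alpha> A)" "\<And>c. ?hb A c \<Longrightarrow> ord c \<le> ord (\<alpha> A)" by auto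
  qed
  define \<iota> where "\<iota> = (\<lambda>A. if \<alpha> A \<in> A then A - {\<alpha> A} else insert (\<alpha> A) A)"
  have key: "\<iota> A \<in> B \<and> \<alpha> (\<iota> A) = \<alpha> A" if A: "A \<in> B" for A
  proof -
    let ?a = "\<alpha> A"
    have AE: "A \<subseteq> E" and rA: "?r A = n - 1" using A unfolding B_def S_def by auto
    have aE: "?a \<in> E" by (rule hbE[OF \<alpha>(1)[OF A]])
    have \<iota>E: "\<iota> A \<subseteq> E" unfolding \<iota>_def using AE aE by auto
    \<comment> \<open>The other edges of a circuit with least edge \<open>c\<close> lie strictly
      above \<open>c\<close>, hence above \<open>?a\<close>, so toggling \<open>?a\<close> does not
      touch them.\<close>
    have same: "?hb (\<iota> A) c \<longleftrightarrow> ?hb A c" if c: "ord ?a \<le> ord c" for c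
    proof -
      have "C - {c} \<subseteq> \<iota> A \<longleftrightarrow> C - {c} \<subseteq> A" if C: "C \<in> cycles E" "c \<in> C" "\<forall>e\<in>C. ord c \<le> ord e" for C
      proof -
        have "?a \<notin> C - {c}"
        proof
          assume a: "?a \<in> C - {c}"
          then have "ord c = ord ?a" using C c by (metis DiffD1 le_antisym)
          moreover have "c \<in> E" using C cycle_nonempty by blast
          ultimately have "c = ?a" using ord aE by (meson inj_onD)
          then show False using a by simp
        qed
        then show ?thesis unfolding \<iota>_def by auto
      qed
      then show ?thesis unfolding has_broken_def by blast
    qed
    have hba: "?hb (\<iota> A) ?a" using same[of ?a] \<alpha>(1)[OF A] by simp
    have cols: "mono_cols n 2 (\<iota> A) = mono_cols n 2 A"
    proof -
      obtain C where C: "C \<in> cycles E" "?a \<in> C" "C - {?a} \<subseteq> A" using \<alpha>(1)[OF A] unfolding has_broken_def by blast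
      have "mono_cols n 2 (insert ?a (A - {?a})) = mono_cols n 2 (A - {?a})"
        by (rule mono_cols_cycle[OF sg C(1,2)]) (use C(3) in blast)
      then show ?thesis unfolding \<iota>_def by (cases "?a \<in> A") (auto simp: insert_absorb)
    qed
    have "?r (\<iota> A) = n - 1" using rank_eqI[OF sg \<iota>E AE cols] rA by simp
    then have inB: "\<iota> A \<in> B" unfolding B_def S_def nbc_def using \<iota>E hba by auto
    have "ord ?a \<le> ord (\<alpha> (\<iota> A))" by (rule \<alpha>(2)[OF inB hba])
    then have "?hb A (\<alpha> (\<iota> A))" using same \<alpha>(1)[OF inB] by blast
    then have "ord (\<alpha> (\<iota> A)) \<le> ord ?a" by (rule \<alpha>(2)[OF A])
    then have "ord (\<alpha> (\<iota> A)) = ord ?a" using \<open>ord ?a \<le> ord (\<alpha> (\<iota> A))\<close> by simp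
    then have "\<alpha> (\<iota> A) = ?a" using ord aE hbE[OF \<alpha>(1)[OF inB]] by (meson inj_onD)
    then show ?thesis using inB by simp
  qed
  have "(\<Sum>A\<in>B. (-1::int) ^ card A) = 0"
  proof (rule sum_involution_zero[of _ \<iota>])
    fix A assume A: "A \<in> B"
    show "\<iota> A \<in> B" using key[OF A] by simp
    have "\<alpha> (\<iota> A) = \<alpha> A" using key[OF A] by simp
    then have "\<iota> (\<iota> A) = (if \<alpha> A \<in> \<iota> A then \<iota> A - {\<alpha> A} else insert (\<alpha> A) (\<iota> A))"
      unfolding \<iota>_def by simp
    then show "\<iota> (\<iota> A) = A" by (auto simp: \<iota>_def)
    have finA: "finite A" using A finE finite_subset unfolding B_def S_def by blast
    show "(-1::int) ^ card (\<iota> A) = - ((-1) ^ card A)"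
    proof (cases "\<alpha> A \<in> A")
      case True
      then have "card A = Suc (card (A - {\<alpha> A}))" using finA by (metis card.remove)
      then have "(-1::int) ^ card A = (-1) ^ Suc (card (A - {\<alpha> A}))" by (rule arg_cong)
      then show ?thesis using True unfolding \<iota>_def by simp
    next
      case False
      then show ?thesis using finA by (simp add: \<iota>_def)
    qed
  qed
  moreover have "S - B = {A. nbc ord E A \<and> card A = n - 1}"
  proof (intro set_eqI iffI)
    fix A assume "A \<in> S - B"
    then have "nbc ord E A" "A \<subseteq> E" "?r A = n - 1" unfolding S_def B_def by auto
    then show "A \<in> {A. nbc ord E A \<and> card A = n - 1}" using rank_forest[OF sg] nbc_forest by simp
  next
    fix A assume "A \<in> {A. nbc ord E A \<and> card A = n - 1}"
    then have A: "nbc ord E A" "card A = n - 1" "A \<subseteq> E" by (auto simp: nbc_def)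
    then have "?r A = n - 1" using rank_forest[OF sg A(3) nbc_forest[OF A(1)]] by simp
    then show "A \<in> S - B" using A unfolding S_def B_def by auto
  qed
  moreover have "(\<Sum>A\<in>S. (-1::int) ^ card A) = (\<Sum>A\<in>S - B. (-1) ^ card A) + (\<Sum>A\<in>B. (-1) ^ card A)"
    by (rule sum.subset_diff) (use finS in \<open>auto simp: B_def\<close>)
  moreover have "(\<Sum>A\<in>{A. nbc ord E A \<and> card A = n - 1}. (-1::int) ^ card A) = (\<Sum>A\<in>{A. nbc ord E A \<and> card A = n - 1}. (-1) ^ (n - 1))"
    by (rule sum.cong) auto
  ultimately show ?thesis unfolding S_def by (simp add: mult.commute)
qed

text \<open>All three values reduce, up to sign, to the alternating sum over the sets of rank
  \<open>n - 1\<close>: these alone contribute to the linear and to the constant coefficient, and at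
  \<open>x = 1\<close> the power \<open>0 ^ 0\<close> selects them in the Tutte sum.\<close>

lemma three_invariants:
  assumes sg: "simple_graph n E" and c: "connected_graph n E" and n: "n \<ge> 1" and ord: "inj_on ord E"
  shows "coeff (characteristic_poly (graphic_matroid E)) 0 = coeff (chromatic_poly n E) 1"
    "coeff (chromatic_poly n E) 1 = (-1) ^ (n - 1) * int (card {A. nbc ord E A \<and> card A = n - 1})"
    "tutte (graphic_matroid E) (1::int) 0 = int (card {A. nbc ord E A \<and> card A = n - 1})"
proof -
  let ?r = "matroid_rank (graphic_matroid E)"
  have finE: "finite E" by (rule simple_graph_finite[OF sg])
  have g: "ground (graphic_matroid E) = E" by (simp add: graphic_matroid_def)
  have rE: "?r E = n - 1" by (rule rank_connected[OF sg c n])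
  have lt: "?r A < n" if "A \<in> Pow E" for A using rank_less[OF sg _ n] that by simp
  let ?S = "{A. A \<subseteq> E \<and> ?r A = n - 1}"
  have S: "{A \<in> Pow E. ?r A = n - 1} = ?S" by auto
  have filt: "(\<Sum>A\<in>Pow E. if ?r A = n - 1 then f A else 0) = (\<Sum>A\<in>?S. f A)" for f :: "nat set set \<Rightarrow> int"
    using sum.inter_filter[of "Pow E" f "\<lambda>A. ?r A = n - 1"] finE unfolding S by simp
  have c1: "coeff (chromatic_poly n E) 1 = (\<Sum>A\<in>?S. (-1) ^ card A)"
    unfolding chromatic_poly_eq[OF sg n] coeff_sum filt[symmetric] coeff_monom
  proof (rule sum.cong[OF refl])
    fix A assume "A \<in> Pow E"
    then have "n - ?r A = 1 \<longleftrightarrow> ?r A = n - 1" using lt[of A] by auto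
    then show "(if n - ?r A = 1 then (-1) ^ card A else 0) = (if ?r A = n - 1 then (-1::int) ^ card A else 0)" by simp
  qed
  have c0: "coeff (characteristic_poly (graphic_matroid E)) 0 = (\<Sum>A\<in>?S. (-1) ^ card A)"
    unfolding characteristic_poly_def g coeff_sum filt[symmetric] coeff_monom rE
  proof (rule sum.cong[OF refl])
    fix A assume "A \<in> Pow E"
    then have "n - 1 - ?r A = 0 \<longleftrightarrow> ?r A = n - 1" using lt[of A] by auto
    then show "(if n - 1 - ?r A = 0 then (-1) ^ card A else 0) = (if ?r A = n - 1 then (-1::int) ^ card A else 0)" by simp
  qed
  have t: "tutte (graphic_matroid E) (1::int) 0 = (\<Sum>A\<in>?S. (-1) ^ (n - 1) * (-1) ^ card A)"
    unfolding tutte_def g filt[symmetric] rE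
  proof (rule sum.cong[OF refl])
    fix A assume A: "A \<in> Pow E"
    then have iff: "n - 1 - ?r A = 0 \<longleftrightarrow> ?r A = n - 1" using lt[of A] by auto
    have le: "?r A \<le> card A" using rank_le_card[OF sg] A by simp
    show "(1 - 1) ^ (n - 1 - ?r A) * (0 - 1) ^ (card A - ?r A) = (if ?r A = n - 1 then (-1) ^ (n - 1) * (-1) ^ card A else (0::int))"
    proof (cases "?r A = n - 1")
      case True
      then have "(-1::int) ^ card A = (-1) ^ (n - 1) * (-1) ^ (card A - ?r A)"
        using le by (simp add: power_add[symmetric])
      then have "(-1::int) ^ (n - 1) * (-1) ^ card A = ((-1) ^ (n - 1) * (-1) ^ (n - 1)) * (-1) ^ (card A - ?r A)" by simp
      also have "(-1::int) ^ (n - 1) * (-1) ^ (n - 1) = 1" by (simp add: power_mult_distrib[symmetric])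
      finally show ?thesis using True by simp
    next
      case False
      then have "n - 1 - ?r A \<noteq> 0" using iff by simp
      then show ?thesis using False by simp
    qed
  qed
  note w = whitney_broken_circuit[OF sg n ord]
  show "coeff (characteristic_poly (graphic_matroid E)) 0 = coeff (chromatic_poly n E) 1" using c0 c1 by simp
  show "coeff (chromatic_poly n E) 1 = (-1) ^ (n - 1) * int (card {A. nbc ord E A \<and> card A = n - 1})" using c1 w by simp
  have "tutte (graphic_matroid E) (1::int) 0 = (-1) ^ (n - 1) * ((-1) ^ (n - 1) * int (card {A. nbc ord E A \<and> card A = n - 1}))"
    unfolding t w[symmetric] by (simp add: sum_distrib_left)
  also have "\<dots> = ((-1) ^ (n - 1) * (-1) ^ (n - 1)) * int (card {A. nbc ord E A \<and> card A = n - 1})" by simp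
  also have "(-1::int) ^ (n - 1) * (-1) ^ (n - 1) = 1" by (simp add: power_mult_distrib[symmetric])
  finally show "tutte (graphic_matroid E) (1::int) 0 = int (card {A. nbc ord E A \<and> card A = n - 1})" by simp
qed

section \<open>Linear spans and counting\<close>

inductive_set lspan :: "('x \<Rightarrow> complex) set \<Rightarrow> ('x \<Rightarrow> complex) set" for B where
  lspan_zero: "(\<lambda>_. 0) \<in> lspan B"
| lspan_step: "b \<in> B \<Longrightarrow> f \<in> lspan B \<Longrightarrow> (\<lambda>x. f x + c * b x) \<in> lspan B"

lemma lspan_base: "b \<in> B \<Longrightarrow> b \<in> lspan B"
  using lspan_step[OF _ lspan_zero, of b B 1] by simp

lemma lspan_add:
  assumes "f \<in> lspan B" "g \<in> lspan B" shows "(\<lambda>x. f x + g x) \<in> lspan B"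
  using assms(2)
proof (induction rule: lspan.induct)
  case lspan_zero then show ?case using assms(1) by simp
next
  case (lspan_step b g c)
  then show ?case using lspan.lspan_step[of b B "\<lambda>x. f x + g x" c] by (simp add: add.assoc)
qed

lemma lspan_scale: "f \<in> lspan B \<Longrightarrow> (\<lambda>x. c * f x) \<in> lspan B"
proof (induction rule: lspan.induct)
  case lspan_zero show ?case using lspan.lspan_zero by simp
next
  case (lspan_step b f d)
  then show ?case using lspan.lspan_step[of b B "\<lambda>x. c * f x" "c * d"] by (simp add: algebra_simps)
qed

text \<open>Multiplication by \<open>g\<close> is linear, so checking generators suffices. This
  carries the degree bookkeeping below and, with \<open>g = 1\<close>, the change of
  generators.\<close>

lemma lspan_trans:
  assumes "f \<in> lspan B" "\<And>b. b \<in> B \<Longrightarrow> (\<lambda>x. b x * g x) \<in> lspan B'"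
  shows "(\<lambda>x. f x * g x) \<in> lspan B'"
  using assms(1)
proof (induction rule: lspan.induct)
  case lspan_zero then show ?case using lspan.lspan_zero by simp
next
  case (lspan_step b f c)
  have "(\<lambda>x. f x * g x + c * (b x * g x)) \<in> lspan B'"
    by (intro lspan_add lspan_scale assms(2) lspan_step)
  then show ?case by (simp add: algebra_simps)
qed

lemma lspan_sum: "(\<And>i. i \<in> I \<Longrightarrow> f i \<in> lspan B) \<Longrightarrow> (\<lambda>x. \<Sum>i\<in>I. f i x) \<in> lspan B"
  by (induction I rule: infinite_finite_induct) (auto intro: lspan_zero lspan_add)

lemma lspan_mono:
  assumes "f \<in> lspan B" "B \<subseteq> lspan B'" shows "f \<in> lspan B'"
  using lspan_trans[OF assms(1), of "\<lambda>_. 1" B'] assms(2) by auto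

lemma lspan_image:
  assumes "f \<in> lspan (b ` I)" "finite I"
  shows "\<exists>\<kappa>. \<forall>x. f x = (\<Sum>i\<in>I. \<kappa> i * b i x)"
  using assms(1)
proof (induction rule: lspan.induct)
  case lspan_zero show ?case by (intro exI[of _ "\<lambda>_. 0"]) simp
next
  case (lspan_step b' f c)
  then obtain j \<kappa> where j: "j \<in> I" "b' = b j" and \<kappa>: "\<forall>x. f x = (\<Sum>i\<in>I. \<kappa> i * b i x)" by auto
  have "(\<Sum>i\<in>I. (\<kappa> i + (if i = j then c else 0)) * b i x) = f x + c * b' x" for x
  proof -
    have "(\<Sum>i\<in>I. (\<kappa> i + (if i = j then c else 0)) * b i x) = (\<Sum>i\<in>I. \<kappa> i * b i x + (if i = j then c * b i x else 0))"
      by (rule sum.cong) (auto simp: algebra_simps)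
    then show ?thesis using \<kappa> j assms(2) by (simp add: sum.distrib)
  qed
  then show ?case by (intro exI[of _ "\<lambda>i. \<kappa> i + (if i = j then c else 0)"]) simp
qed

lemma lspan_dependent:
  assumes "finite I" "finite J" "card I < card J" "\<And>j. j \<in> J \<Longrightarrow> F j \<in> lspan (b ` I)"
  shows "\<exists>\<kappa>. (\<exists>j\<in>J. \<kappa> j \<noteq> 0) \<and> (\<forall>x. (\<Sum>j\<in>J. \<kappa> j * F j x) = 0)"
proof -
  have "\<forall>j\<in>J. \<exists>a. \<forall>x. F j x = (\<Sum>i\<in>I. a i * b i x)" using lspan_image[OF assms(4) assms(1)] by blast
  then obtain a where a: "\<And>j x. j \<in> J \<Longrightarrow> F j x = (\<Sum>i\<in>I. a j i * b i x)" by (metis bchoice)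
  obtain \<kappa> where \<kappa>: "\<exists>j\<in>J. \<kappa> j \<noteq> 0" "\<forall>i\<in>I. (\<Sum>j\<in>J. a j i * \<kappa> j) = 0"
    using kernel_vector[OF assms(1-3), of "\<lambda>i j. a j i"] by blast
  have "(\<Sum>j\<in>J. \<kappa> j * F j x) = 0" for x
  proof -
    have "(\<Sum>j\<in>J. \<kappa> j * F j x) = (\<Sum>j\<in>J. \<Sum>i\<in>I. (a j i * \<kappa> j) * b i x)"
      by (intro sum.cong refl) (simp add: a sum_distrib_left mult_ac)
    also have "\<dots> = (\<Sum>i\<in>I. (\<Sum>j\<in>J. a j i * \<kappa> j) * b i x)"
      by (subst sum.swap) (simp add: sum_distrib_right)
    finally show ?thesis using \<kappa>(2) by simp
  qed
  then show ?thesis using \<kappa>(1) by blast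
qed

section \<open>Counting exponent vectors\<close>

definition compositions :: "'i set \<Rightarrow> nat \<Rightarrow> ('i \<Rightarrow> nat) set" where
  "compositions I k = {\<beta> \<in> I \<rightarrow>\<^sub>E UNIV. sum \<beta> I = k}"

text \<open>Stars and bars, transported from lists along an enumeration of \<open>I\<close>.\<close>

lemma compositions_card:
  assumes "finite I"
  shows "finite (compositions I k) \<and> card (compositions I k) = (k + card I - 1) choose k"
proof -
  obtain h where h: "bij_betw h {0..<card I} I" using ex_bij_betw_nat_finite[OF assms] by auto
  define h' where "h' = inv_into {0..<card I} h"
  have hh: "h' (h i) = i" "h i \<in> I" if "i < card I" for i
    using h that unfolding h'_def bij_betw_def by auto
  have hh': "h (h' x) = x" "h' x < card I" if "x \<in> I" for x
    using h that unfolding h'_def bij_betw_def by (auto simp: f_inv_into_f intro: inv_into_into[of _ h "{0..<card I}", simplified])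
  let ?L = "{l :: nat list. length l = card I \<and> sum_list l = k}"
  have bij: "bij_betw (\<lambda>\<beta>. map (\<lambda>i. \<beta> (h i)) [0..<card I]) (compositions I k) ?L"
  proof (rule bij_betw_byWitness[where f' = "\<lambda>l. \<lambda>x\<in>I. l ! h' x"])
    have re: "(\<Sum>i\<in>{0..<card I}. \<beta> (h i)) = sum \<beta> I" for \<beta> :: "'a \<Rightarrow> nat"
      using sum.reindex_bij_betw[OF h, of \<beta>] by simp
    show "\<forall>\<beta>\<in>compositions I k. (\<lambda>x\<in>I. map (\<lambda>i. \<beta> (h i)) [0..<card I] ! h' x) = \<beta>"
    proof
      fix \<beta> assume \<beta>: "\<beta> \<in> compositions I k"
      show "(\<lambda>x\<in>I. map (\<lambda>i. \<beta> (h i)) [0..<card I] ! h' x) = \<beta>"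
      proof (rule extensionalityI)
        show "\<beta> \<in> extensional I" using \<beta> by (auto simp: compositions_def PiE_def)
      qed (use hh' in \<open>auto simp: restrict_def extensional_def\<close>)
    qed
    show "\<forall>l\<in>?L. map (\<lambda>i. (\<lambda>x\<in>I. l ! h' x) (h i)) [0..<card I] = l"
      using hh by (auto intro!: nth_equalityI)
    show "(\<lambda>\<beta>. map (\<lambda>i. \<beta> (h i)) [0..<card I]) ` compositions I k \<subseteq> ?L"
      using re by (auto simp: compositions_def interv_sum_list_conv_sum_set_nat)
    show "(\<lambda>l. \<lambda>x\<in>I. l ! h' x) ` ?L \<subseteq> compositions I k"
    proof (rule image_subsetI)
      fix l assume l: "l \<in> ?L"
      have "sum (\<lambda>x\<in>I. l ! h' x) I = (\<Sum>i\<in>{0..<card I}. (\<lambda>x\<in>I. l ! h' x) (h i))" unfolding re ..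
      also have "\<dots> = (\<Sum>i\<in>{0..<card I}. l ! i)" by (rule sum.cong) (use hh in auto)
      also have "\<dots> = k" using l by (auto simp: sum_list_sum_nth)
      finally show "(\<lambda>x\<in>I. l ! h' x) \<in> compositions I k" by (simp add: compositions_def)
    qed
  qed
  have "finite ?L"
  proof (rule finite_subset)
    show "?L \<subseteq> {l. set l \<subseteq> {..k} \<and> length l = card I}" using member_le_sum_list by fastforce
    show "finite {l. set l \<subseteq> {..k} \<and> length l = card I}" by (rule finite_lists_length_eq) simp
  qed
  then have "finite (compositions I k)" using bij bij_betw_finite by blast
  then show ?thesis using bij_betw_same_card[OF bij] card_length_sum_list[of "card I" k] by simp
qed

text \<open>Writing \<open>f m\<close> for \<open>(m + r) choose m\<close>, of order
  \<open>m ^ r\<close>, a shift of the argument by \<open>T\<close> costs only terms of order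
  \<open>m ^ (r - 1)\<close>. The leading coefficients on the two sides compare as \<open>T\<close>
  to \<open>T + 1\<close>.\<close>

lemma growth_gap:
  assumes r: "r \<ge> 1"
  shows "\<exists>k\<ge>T. T * ((k + r) choose k) + C * ((k + r - 1) choose k) < (T + 1) * ((k - T + r) choose (k - T))"
proof -
  obtain r' where r': "r = Suc r'" using r by (cases r) auto
  define f where "f = (\<lambda>m. (m + r) choose m)"
  define g where "g = (\<lambda>m. (m + r') choose m)"
  have rel: "r * f m = (m + r) * g m" for m
  proof -
    have "(m + r) choose m = Suc (m + r') choose Suc r'" unfolding r' by (subst binomial_symmetric) auto
    moreover have "(m + r') choose m = (m + r') choose r'" by (subst binomial_symmetric) auto
    ultimately show ?thesis using Suc_times_binomial[of r' "m + r'"] unfolding f_def g_def by (simp add: r')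
  qed
  have gS: "g (Suc m) \<le> r * g m" for m
  proof -
    have "Suc m * g (Suc m) = (Suc m + r') * g m"
      using Suc_times_binomial[of m "m + r'"] unfolding g_def by simp
    also have "\<dots> \<le> Suc m * (r * g m)" unfolding r' by (simp add: algebra_simps)
    finally show ?thesis by (simp only: mult_le_cancel1)
  qed
  have gmono: "g m \<le> g (Suc m)" for m
    unfolding g_def by simp
  have gT: "g (m + t) \<le> r ^ t * g m" for m t
  proof (induction t)
    case (Suc t)
    have "g (m + Suc t) \<le> r * g (m + t)" using gS[of "m + t"] by simp
    also have "\<dots> \<le> r * (r ^ t * g m)" using Suc by simp
    finally show ?case by simp
  qed simp
  have fS: "f (Suc m) = f m + g (Suc m)" for m unfolding f_def g_def r' by simp
  have fT: "f (m + t) \<le> f m + t * g (m + t)" for m t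
  proof (induction t)
    case (Suc t)
    have "f (m + Suc t) = f (m + t) + g (m + Suc t)" using fS[of "m + t"] by simp
    also have "\<dots> \<le> f m + t * g (m + t) + g (m + Suc t)" using Suc by simp
    also have "\<dots> \<le> f m + t * g (m + Suc t) + g (m + Suc t)" using gmono[of "m + t"] by simp
    finally show ?case by simp
  qed simp
  \<comment> \<open>\<open>Q * g m\<close> bounds all lower-order terms: each of \<open>T\<close>
    copies of \<open>f\<close> takes \<open>T\<close> steps, each at most \<open>g (m + T)\<close>,
    there are \<open>C\<close> further copies of \<open>g\<close>, and every unit shift of
    \<open>g\<close> costs a factor \<open>r\<close>. Since \<open>r * f m = (m + r) * g m\<close>,
    the choice \<open>m = r * Q\<close> gives \<open>Q * g m < f m\<close>.\<close>
  define Q where "Q = (T * T + C) * r ^ T"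
  define m where "m = r * Q"
  let ?k = "m + T"
  have gpos: "g m > 0" unfolding g_def by simp
  have mx: "m * x = r * (Q * x)" for x by (simp add: m_def)
  have "r * f m = r * (Q * g m) + r * g m" unfolding rel mx[symmetric] by (rule distrib_right)
  then have "r * (Q * g m) < r * f m" using gpos r by simp
  then have big: "Q * g m < f m" by simp
  have "T * f ?k + C * g ?k \<le> T * (f m + T * g ?k) + C * g ?k" using fT[of m T] by simp
  also have "\<dots> = T * f m + (T * T + C) * g ?k" by (simp add: algebra_simps)
  also have "\<dots> \<le> T * f m + (T * T + C) * (r ^ T * g m)" using gT[of m T] by (intro add_left_mono mult_left_mono) auto
  also have "\<dots> = T * f m + Q * g m" by (simp add: Q_def)
  also have "\<dots> < (T + 1) * f m" using big by simp
  finally show ?thesis unfolding f_def g_def using r' by (intro exI[of _ ?k]) simp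
qed

text \<open>The ratio of the two powers tends to one as \<open>D\<close> grows, so the strict
  inequality between the factors survives.\<close>

lemma power_growth:
  assumes "H < (U :: nat)"
  shows "\<exists>D. H * (D + k + 1) ^ m < U * (D + 1) ^ m"
proof -
  have "(\<lambda>N. real H * (1 + real k / real (Suc N)) ^ m) \<longlonglongrightarrow> real H * (1 + 0) ^ m"
    by (intro tendsto_intros LIMSEQ_Suc lim_const_over_n)
  then have "\<forall>\<^sub>F N in sequentially. real H * (1 + real k / real (Suc N)) ^ m < real U"
    by (rule order_tendstoD(2)) (use assms in simp)
  then obtain N where N: "real H * (1 + real k / real (Suc N)) ^ m < real U"
    by (meson eventually_happens' sequentially_bot)
  have "1 + real k / real (Suc N) = real (N + k + 1) / real (N + 1)" by (simp add: field_simps)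
  then have "real H * (real (N + k + 1) ^ m / real (N + 1) ^ m) < real U" using N by (simp add: power_divide)
  then have "real H * real (N + k + 1) ^ m < real U * real (N + 1) ^ m" by (simp add: field_simps)
  then have "real (H * (N + k + 1) ^ m) < real (U * (N + 1) ^ m)" by simp
  then show ?thesis using of_nat_less_iff by blast
qed

lemma mon_Suc:
  assumes "finite I" "i \<in> I"
  shows "mon I (\<alpha>(i := Suc (\<alpha> i))) v = mon I \<alpha> v * v i"
proof -
  have "(\<Prod>j\<in>I - {i}. v j ^ (\<alpha>(i := Suc (\<alpha> i))) j) = (\<Prod>j\<in>I - {i}. v j ^ \<alpha> j)" by (rule prod.cong) auto
  then show ?thesis unfolding mon_def using assms by (simp add: prod.remove)
qed

lemma sum_Suc:
  fixes \<alpha> :: "'i \<Rightarrow> nat"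
  assumes "finite I" "i \<in> I"
  shows "(\<Sum>j\<in>I. (\<alpha>(i := Suc (\<alpha> i))) j * h j) = (\<Sum>j\<in>I. \<alpha> j * h j) + h i"
proof -
  have "(\<Sum>j\<in>I - {i}. (\<alpha>(i := Suc (\<alpha> i))) j * h j) = (\<Sum>j\<in>I - {i}. \<alpha> j * h j)" by (rule sum.cong) auto
  then show ?thesis using assms by (simp add: sum.remove)
qed

section \<open>Reciprocals of edge differences\<close>

definition nonvanishing :: "nat set set \<Rightarrow> (nat \<Rightarrow> complex) \<Rightarrow> bool" where
  "nonvanishing E u \<longleftrightarrow> (\<forall>e\<in>E. edge_diff e u \<noteq> 0)"

definition recip :: "(nat \<Rightarrow> complex) \<Rightarrow> nat set \<Rightarrow> complex" where
  "recip u e = 1 / edge_diff e u"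

text \<open>The parameters are indexed by \<open>UNIV \<times> E\<close>: the pair \<open>(True, e)\<close> stands for the measurement of \<open>e\<close>,
  and \<open>(False, e)\<close> for the coefficient at \<open>e\<close> of an auxiliary linear form.\<close>

definition base_fn :: "nat set set \<Rightarrow> (nat set \<Rightarrow> nat) \<times> (bool \<times> nat set \<Rightarrow> nat) \<Rightarrow>
    (nat \<Rightarrow> complex) \<times> (bool \<times> nat set \<Rightarrow> complex) \<Rightarrow> complex" where
  "base_fn E = (\<lambda>(\<alpha>, \<eta>) (u, w). if nonvanishing E u then mon E \<alpha> (recip u) * mon (UNIV \<times> E) \<eta> w else 0)"

definition expbox :: "'i set \<Rightarrow> nat \<Rightarrow> ('i \<Rightarrow> nat) set" where
  "expbox I d = I \<rightarrow>\<^sub>E {..d}"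

lemma expbox_mono: "d \<le> d' \<Longrightarrow> expbox I d \<subseteq> expbox I d'"
  unfolding expbox_def by (rule PiE_mono) auto

lemma expbox_card: "finite I \<Longrightarrow> finite (expbox I d) \<and> card (expbox I d) = (d + 1) ^ card I"
  unfolding expbox_def by (simp add: card_PiE finite_PiE)

definition nbc_compositions :: "(nat set \<Rightarrow> nat) \<Rightarrow> nat set set \<Rightarrow> nat \<Rightarrow> (nat set \<Rightarrow> nat) set" where
  "nbc_compositions ord E k = {\<alpha> \<in> compositions E k. nbc ord E {e \<in> E. \<alpha> e > 0}}"

text \<open>Dividing a circuit relation by the difference of its least edge \<open>c\<close>
  expresses 1 through quotients whose numerators are the differences of the other edges. Multiplied
  into a monomial whose support contains the broken circuit, it trades one reciprocal at such an
  edge for one at \<open>c\<close>, which lowers the exponent sum weighted by \<open>ord\<close>. As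
  \<open>base_fn\<close> is zero wherever some difference vanishes, the identity holds at every
  point.\<close>

lemma straighten:
  assumes sg: "simple_graph n E" and ord: "inj_on ord E" and \<eta>: "\<eta> \<in> N"
    and \<alpha>: "\<alpha> \<in> compositions E k"
  shows "base_fn E (\<alpha>, \<eta>) \<in> lspan (base_fn E ` (nbc_compositions ord E k \<times> N))"
  using \<alpha>
proof (induction "\<Sum>e\<in>E. \<alpha> e * ord e" arbitrary: \<alpha> rule: less_induct)
  case less
  have finE: "finite E" by (rule simple_graph_finite[OF sg])
  show ?case
  proof (cases "nbc ord E {e \<in> E. \<alpha> e > 0}")
    case True
    then have "(\<alpha>, \<eta>) \<in> nbc_compositions ord E k \<times> N" using less(2) \<eta> by (simp add: nbc_compositions_def)
    then show ?thesis by (intro lspan_base imageI)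
  next
    case False
    then obtain c C where C: "C \<in> cycles E" "c \<in> C" "\<forall>e\<in>C. ord c \<le> ord e" "C - {c} \<subseteq> {e \<in> E. \<alpha> e > 0}"
      unfolding nbc_def has_broken_def by blast
    have CE: "C \<subseteq> E" and finC: "finite C" using cycle_nonempty[OF C(1)] by auto
    obtain \<epsilon> :: "nat set \<Rightarrow> int" where \<epsilon>: "\<And>e. e \<in> C \<Longrightarrow> \<epsilon> e = 1 \<or> \<epsilon> e = -1"
      "\<And>u :: nat \<Rightarrow> complex. (\<Sum>e\<in>C. of_int (\<epsilon> e) * edge_diff e u) = 0"
      using cycle_relation[OF C(1)] by metis
    \<comment> \<open>\<open>\<alpha>' e\<close> moves one unit of exponent from \<open>e\<close> to
      \<open>c\<close>; \<open>low e\<close> is the stage in between.\<close>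
    define low where "low = (\<lambda>e. \<alpha>(e := \<alpha> e - 1))"
    define \<alpha>' where "\<alpha>' = (\<lambda>e. (low e)(c := Suc (low e c)))"
    have up: "(low e)(e := Suc (low e e)) = \<alpha>" if "e \<in> C - {c}" for e
      using C(4) that by (auto simp: low_def)
    have in_span: "base_fn E (\<alpha>' e, \<eta>) \<in> lspan (base_fn E ` (nbc_compositions ord E k \<times> N))" if e: "e \<in> C - {c}" for e
    proof (rule less(1))
      have eE: "e \<in> E" "c \<in> E" using e CE C(2) by auto
      have s: "(\<Sum>j\<in>E. \<alpha> j * h j) = (\<Sum>j\<in>E. low e j * h j) + h e" for h
        using sum_Suc[OF finE eE(1), of "low e" h] up[OF e] by simp
      have s': "(\<Sum>j\<in>E. \<alpha>' e j * h j) = (\<Sum>j\<in>E. low e j * h j) + h c" for h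
        unfolding \<alpha>'_def by (rule sum_Suc[OF finE eE(2)])
      have "ord c \<noteq> ord e" using ord eE e by (metis DiffD2 inj_onD singletonI)
      then have "ord c < ord e" using C(3) e by (metis DiffD1 le_neq_implies_less)
      then show "(\<Sum>j\<in>E. \<alpha>' e j * ord j) < (\<Sum>j\<in>E. \<alpha> j * ord j)" using s[of ord] s'[of ord] by simp
      have "sum (\<alpha>' e) E = sum \<alpha> E" using s[of "\<lambda>_. 1"] s'[of "\<lambda>_. 1"] by simp
      moreover have "\<alpha>' e \<in> E \<rightarrow>\<^sub>E UNIV" using less(2) eE unfolding \<alpha>'_def low_def compositions_def
        by (auto simp: PiE_iff extensional_def)
      ultimately show "\<alpha>' e \<in> compositions E k" using less(2) by (simp add: compositions_def)
    qed
    have eq: "base_fn E (\<alpha>, \<eta>) x = (\<Sum>e\<in>C - {c}. (- of_int (\<epsilon> c * \<epsilon> e)) * base_fn E (\<alpha>' e, \<eta>) x)" for x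
    proof -
      obtain u w where x: "x = (u, w)" by (cases x)
      show ?thesis
      proof (cases "nonvanishing E u")
        case False then show ?thesis by (simp add: x base_fn_def)
      next
        case True
        have nz: "edge_diff e u \<noteq> 0" if "e \<in> C" for e using True that CE unfolding nonvanishing_def by auto
        have m: "mon E (\<alpha>' e) (recip u) = mon E \<alpha> (recip u) * edge_diff e u * recip u c" if e: "e \<in> C - {c}" for e
        proof -
          have eE: "e \<in> E" "c \<in> E" using e CE C(2) by auto
          have "mon E \<alpha> (recip u) = mon E (low e) (recip u) * recip u e"
            using mon_Suc[OF finE eE(1), of "low e" "recip u"] up[OF e] by simp
          moreover have "mon E (\<alpha>' e) (recip u) = mon E (low e) (recip u) * recip u c"
            unfolding \<alpha>'_def by (rule mon_Suc[OF finE eE(2)])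
          moreover have "recip u e * edge_diff e u = 1" using nz e by (simp add: recip_def)
          ultimately show ?thesis by (simp add: mult_ac)
        qed
        have "of_int (\<epsilon> c) * edge_diff c u + (\<Sum>e\<in>C - {c}. of_int (\<epsilon> e) * edge_diff e u) = 0"
          using \<epsilon>(2)[of u] sum.remove[OF finC C(2), of "\<lambda>e. of_int (\<epsilon> e) * edge_diff e u"] by simp
        then have "(\<Sum>e\<in>C - {c}. of_int (\<epsilon> e) * edge_diff e u) = - (of_int (\<epsilon> c) * edge_diff c u)"
          by (simp add: add_eq_0_iff)
        then have one: "(\<Sum>e\<in>C - {c}. of_int (\<epsilon> e) * edge_diff e u) * (- of_int (\<epsilon> c) * recip u c) = 1"
          using \<epsilon>(1)[OF C(2)] nz[OF C(2)] by (auto simp: recip_def)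
        let ?m = "mon E \<alpha> (recip u) * mon (UNIV \<times> E) \<eta> w"
        have "(\<Sum>e\<in>C - {c}. (- of_int (\<epsilon> c * \<epsilon> e)) * base_fn E (\<alpha>' e, \<eta>) x)
          = (\<Sum>e\<in>C - {c}. (of_int (\<epsilon> e) * edge_diff e u) * (- of_int (\<epsilon> c) * recip u c) * ?m)"
          by (rule sum.cong) (use True m in \<open>auto simp: x base_fn_def mult_ac\<close>)
        also have "\<dots> = ((\<Sum>e\<in>C - {c}. of_int (\<epsilon> e) * edge_diff e u) * (- of_int (\<epsilon> c) * recip u c)) * ?m"
          by (simp only: sum_distrib_right)
        also have "\<dots> = ?m" unfolding one by simp
        finally show ?thesis using True by (simp add: x base_fn_def)
      qed
    qed
    have "(\<lambda>x. \<Sum>e\<in>C - {c}. (- of_int (\<epsilon> c * \<epsilon> e)) * base_fn E (\<alpha>' e, \<eta>) x) \<in> lspan (base_fn E ` (nbc_compositions ord E k \<times> N))"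
      by (intro lspan_sum lspan_scale in_span)
    then show ?thesis unfolding eq[symmetric] .
  qed
qed

text \<open>Monomials are sorted by support. An nbc set is a forest and so has at most
  \<open>n - 1\<close> edges; only supports of that size contribute to the top order in
  \<open>k\<close>, and the number of smaller ones is bounded crudely by that of all subsets of
  \<open>E\<close>.\<close>

lemma nbc_compositions_card:
  assumes sg: "simple_graph n E" and n: "n \<ge> 3" and ord: "inj_on ord E"
  shows "finite (nbc_compositions ord E k)"
    "card (nbc_compositions ord E k) \<le> card {A. nbc ord E A \<and> card A = n - 1} * ((k + (n - 2)) choose k)
      + 2 ^ card E * ((k + (n - 2) - 1) choose k)"
proof -
  have finE: "finite E" by (rule simple_graph_finite[OF sg])
  show fin: "finite (nbc_compositions ord E k)"
    unfolding nbc_compositions_def using compositions_card[OF finE] by (auto intro: finite_subset)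
  define P where "P = {A. nbc ord E A}"
  have PE: "P \<subseteq> Pow E" unfolding P_def nbc_def by auto
  then have finP: "finite P" using finE finite_subset by blast
  define K where "K = (\<lambda>A. {\<alpha> \<in> compositions E k. {e \<in> E. \<alpha> e > 0} = A})"
  have cardK: "card (K A) \<le> (k + card A - 1) choose k" if A: "A \<in> P" for A
  proof -
    have AE: "A \<subseteq> E" using A PE by auto
    then have finA: "finite A" using finE finite_subset by blast
    have inj: "inj_on (\<lambda>\<alpha>. restrict \<alpha> A) (K A)"
    proof (rule inj_onI)
      fix \<alpha> \<beta> assume ab: "\<alpha> \<in> K A" "\<beta> \<in> K A" "restrict \<alpha> A = restrict \<beta> A"
      show "\<alpha> = \<beta>"
      proof (rule extensionalityI)
        show "\<alpha> \<in> extensional E" "\<beta> \<in> extensional E" using ab unfolding K_def compositions_def by (auto simp: PiE_def)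
        fix e assume e: "e \<in> E"
        show "\<alpha> e = \<beta> e"
        proof (cases "e \<in> A")
          case True then show ?thesis using ab(3) by (metis restrict_apply')
        next
          case False
          then have "\<alpha> e = 0" "\<beta> e = 0" using ab(1,2) e unfolding K_def by auto
          then show ?thesis by simp
        qed
      qed
    qed
    have "(\<lambda>\<alpha>. restrict \<alpha> A) ` K A \<subseteq> compositions A k"
    proof (rule image_subsetI)
      fix \<alpha> assume a: "\<alpha> \<in> K A"
      have "sum \<alpha> E = sum \<alpha> A"
        by (rule sum.mono_neutral_right[OF finE AE]) (use a in \<open>auto simp: K_def\<close>)
      then show "restrict \<alpha> A \<in> compositions A k" using a by (auto simp: K_def compositions_def)
    qed
    then have "card (K A) \<le> card (compositions A k)"
      using card_inj_on_le[OF inj] compositions_card[OF finA] by blast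
    then show ?thesis using compositions_card[OF finA] by simp
  qed
  have "nbc_compositions ord E k \<subseteq> (\<Union>A\<in>P. K A)" unfolding nbc_compositions_def P_def K_def by auto
  moreover have finK: "finite (K A)" for A unfolding K_def using compositions_card[OF finE] by (auto intro: finite_subset)
  ultimately have "card (nbc_compositions ord E k) \<le> card (\<Union>A\<in>P. K A)"
    using finP by (intro card_mono) auto
  also have "\<dots> \<le> (\<Sum>A\<in>P. card (K A))" by (rule card_UN_le[OF finP])
  also have "\<dots> = (\<Sum>A\<in>{A \<in> P. card A = n - 1}. card (K A)) + (\<Sum>A\<in>{A \<in> P. card A \<noteq> n - 1}. card (K A))"
    using finP by (subst sum.union_disjoint[symmetric]) (auto intro!: sum.cong)
  also have "\<dots> \<le> of_nat (card {A \<in> P. card A = n - 1}) * ((k + (n - 2)) choose k)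
      + of_nat (card {A \<in> P. card A \<noteq> n - 1}) * ((k + (n - 2) - 1) choose k)"
  proof (rule add_mono; rule sum_bounded_above)
    fix A assume "A \<in> {A \<in> P. card A = n - 1}"
    then have "A \<in> P" "k + card A - 1 = k + (n - 2)" using n by auto
    then show "card (K A) \<le> (k + (n - 2)) choose k" using cardK[of A] by metis
  next
    fix A assume A: "A \<in> {A \<in> P. card A \<noteq> n - 1}"
    then have AE: "A \<subseteq> E" and f: "cycles A = {}" using nbc_forest unfolding P_def nbc_def by auto
    have "card A < n" using rank_less[OF sg AE] rank_forest[OF sg AE f] n by simp
    then have "card A \<le> n - 2" using A by auto
    then have "(k + card A - 1) choose k \<le> (k + (n - 2) - 1) choose k" by (intro binomial_right_mono) auto
    then show "card (K A) \<le> (k + (n - 2) - 1) choose k" using cardK[of A] A by simp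
  qed
  also have "\<dots> \<le> card {A. nbc ord E A \<and> card A = n - 1} * ((k + (n - 2)) choose k)
      + 2 ^ card E * ((k + (n - 2) - 1) choose k)"
  proof -
    have "card {A \<in> P. card A \<noteq> n - 1} \<le> card (Pow E)" using PE finE by (intro card_mono) auto
    then have "card {A \<in> P. card A \<noteq> n - 1} \<le> 2 ^ card E" by (simp add: card_Pow finE)
    moreover have "{A \<in> P. card A = n - 1} = {A. nbc ord E A \<and> card A = n - 1}" unfolding P_def by auto
    ultimately show ?thesis by (simp add: mult_right_mono)
  qed
  finally show "card (nbc_compositions ord E k) \<le> card {A. nbc ord E A \<and> card A = n - 1} * ((k + (n - 2)) choose k)
      + 2 ^ card E * ((k + (n - 2) - 1) choose k)" .
qed

section \<open>Graded pieces and multiplication by linear forms\<close>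

definition homog :: "nat set set \<Rightarrow> nat \<Rightarrow> nat \<Rightarrow> ((nat \<Rightarrow> complex) \<times> (bool \<times> nat set \<Rightarrow> complex) \<Rightarrow> complex) set" where
  "homog E k d = lspan (base_fn E ` (compositions E k \<times> expbox (UNIV \<times> E) d))"

lemma homog_mult_recip:
  assumes finE: "finite E" and e: "e \<in> E" and f: "f \<in> homog E k d" and dd: "d \<le> d'"
  shows "(\<lambda>x. f x * recip (fst x) e) \<in> homog E (Suc k) d'"
  unfolding homog_def
proof (rule lspan_trans[OF f[unfolded homog_def]])
  fix b assume "b \<in> base_fn E ` (compositions E k \<times> expbox (UNIV \<times> E) d)"
  then obtain \<alpha> \<eta> where b: "b = base_fn E (\<alpha>, \<eta>)" "\<alpha> \<in> compositions E k" "\<eta> \<in> expbox (UNIV \<times> E) d" by auto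
  have "(\<lambda>x. b x * recip (fst x) e) = base_fn E (\<alpha>(e := Suc (\<alpha> e)), \<eta>)"
    by (rule ext) (auto simp: b(1) base_fn_def mon_Suc[OF finE e] split: prod.splits)
  moreover have "\<alpha>(e := Suc (\<alpha> e)) \<in> compositions E (Suc k)"
    using b(2) e sum_Suc[OF finE e, of \<alpha> "\<lambda>_. 1"] by (auto simp: compositions_def PiE_iff extensional_def)
  moreover have "\<eta> \<in> expbox (UNIV \<times> E) d'" using b(3) expbox_mono[OF dd] by blast
  ultimately show "(\<lambda>x. b x * recip (fst x) e) \<in> lspan (base_fn E ` (compositions E (Suc k) \<times> expbox (UNIV \<times> E) d'))"
    by (auto intro!: lspan_base)
qed

lemma homog_mult_param:
  assumes finE: "finite E" and v: "v \<in> UNIV \<times> E" and f: "f \<in> homog E k d"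
  shows "(\<lambda>x. f x * snd x v) \<in> homog E k (Suc d)"
  unfolding homog_def
proof (rule lspan_trans[OF f[unfolded homog_def]])
  fix b assume "b \<in> base_fn E ` (compositions E k \<times> expbox (UNIV \<times> E) d)"
  then obtain \<alpha> \<eta> where b: "b = base_fn E (\<alpha>, \<eta>)" "\<alpha> \<in> compositions E k" "\<eta> \<in> expbox (UNIV \<times> E) d" by auto
  have finV: "finite ((UNIV :: bool set) \<times> E)" using finE by simp
  have "(\<lambda>x. b x * snd x v) = base_fn E (\<alpha>, \<eta>(v := Suc (\<eta> v)))"
    by (rule ext) (auto simp: b(1) base_fn_def mon_Suc[OF finV v] split: prod.splits)
  moreover have "\<eta>(v := Suc (\<eta> v)) \<in> expbox (UNIV \<times> E) (Suc d)"
    using b(3) v unfolding expbox_def by (auto simp: PiE_iff extensional_def le_SucI)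
  ultimately show "(\<lambda>x. b x * snd x v) \<in> lspan (base_fn E ` (compositions E k \<times> expbox (UNIV \<times> E) (Suc d)))"
    using b(2) by (auto intro!: lspan_base)
qed

text \<open>Stands for linear forms in the reciprocals with coefficients of degree at most one in
  the parameters, recorded through their effect on the two degrees, which is what the counting
  sees.\<close>

definition homog_linear :: "nat set set \<Rightarrow> ((nat \<Rightarrow> complex) \<times> (bool \<times> nat set \<Rightarrow> complex) \<Rightarrow> complex) \<Rightarrow> bool" where
  "homog_linear E L \<longleftrightarrow> (\<forall>k d f. f \<in> homog E k d \<longrightarrow> (\<lambda>x. f x * L x) \<in> homog E (Suc k) (Suc d))"

lemma homog_linear_recip: "finite E \<Longrightarrow> e \<in> E \<Longrightarrow> homog_linear E (\<lambda>x. recip (fst x) e)"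
  unfolding homog_linear_def
proof (intro allI impI)
  fix k d f assume "finite E" "e \<in> E" "f \<in> homog E k d"
  then show "(\<lambda>x. f x * recip (fst x) e) \<in> homog E (Suc k) (Suc d)"
    by (rule homog_mult_recip) (rule le_SucI, rule le_refl)
qed

lemma homog_linear_param:
  assumes "finite E" "e \<in> E" "v \<in> UNIV \<times> E"
  shows "homog_linear E (\<lambda>x. snd x v * recip (fst x) e)"
  unfolding homog_linear_def
proof (intro allI impI)
  fix k d f assume "f \<in> homog E k d"
  then have "(\<lambda>x. f x * snd x v) \<in> homog E k (Suc d)" by (rule homog_mult_param[OF assms(1,3)])
  then have "(\<lambda>x. f x * snd x v * recip (fst x) e) \<in> homog E (Suc k) (Suc d)"
    by (rule homog_mult_recip[OF assms(1,2)]) simp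
  then show "(\<lambda>x. f x * (snd x v * recip (fst x) e)) \<in> homog E (Suc k) (Suc d)" by (simp add: mult.assoc)
qed

lemma homog_linear_sum:
  assumes "\<And>i. i \<in> I \<Longrightarrow> homog_linear E (L i)"
  shows "homog_linear E (\<lambda>x. \<Sum>i\<in>I. c i * L i x)"
  unfolding homog_linear_def
proof (intro allI impI)
  fix k d f assume f: "f \<in> homog E k d"
  have "(\<lambda>x. \<Sum>i\<in>I. c i * (f x * L i x)) \<in> homog E (Suc k) (Suc d)"
    unfolding homog_def
    by (intro lspan_sum lspan_scale) (use assms f in \<open>auto simp: homog_linear_def homog_def\<close>)
  then show "(\<lambda>x. f x * (\<Sum>i\<in>I. c i * L i x)) \<in> homog E (Suc k) (Suc d)"
    by (simp add: sum_distrib_left mult_ac)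
qed

lemma homog_power:
  assumes L: "homog_linear E L" and f: "f \<in> homog E k d"
  shows "(\<lambda>x. f x * L x ^ m) \<in> homog E (k + m) (d + m)"
proof (induction m)
  case 0 show ?case using f by simp
next
  case (Suc m)
  have "(\<lambda>x. f x * L x ^ m * L x) \<in> homog E (Suc (k + m)) (Suc (d + m))"
    using L Suc unfolding homog_linear_def by blast
  then show ?case by (simp add: mult_ac)
qed

lemma homog_prod:
  assumes "finite J" "\<And>j. j \<in> J \<Longrightarrow> homog_linear E (L j)" "f \<in> homog E k d"
  shows "(\<lambda>x. f x * (\<Prod>j\<in>J. L j x ^ b j)) \<in> homog E (k + sum b J) (d + sum b J)"
  using assms
proof (induction J rule: finite_induct)
  case (insert j J)
  have "(\<lambda>x. f x * (\<Prod>j\<in>J. L j x ^ b j)) \<in> homog E (k + sum b J) (d + sum b J)" using insert by simp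
  from homog_power[OF _ this, of "L j" "b j"] insert
  show ?case by (simp add: mult_ac add_ac)
qed simp

text \<open>\<open>R\<close> consists of chords of a spanning tree, and row \<open>j\<close> of
  \<open>M\<close> is the fundamental circuit of \<open>j\<close>, scaled to have entry one at
  \<open>j\<close>. A chord occurs in no other fundamental circuit, whence the identity block. The
  edge bound leaves at least \<open>2 * n - 3 - (n - 1) = n - 2\<close> chords; \<open>e0\<close> is
  a tree edge.\<close>

lemma tree_coordinates:
  assumes sg: "simple_graph n E" and conn: "connected_graph n E" and n: "n \<ge> 3" and card: "2 * n - 3 \<le> card E"
  obtains e0 R and M :: "nat set \<Rightarrow> nat set \<Rightarrow> complex" where
    "e0 \<in> E" "R \<subseteq> E" "e0 \<notin> R" "card R = n - 2"
    "\<And>j v. j \<in> R \<Longrightarrow> (\<Sum>f\<in>E. M j f * edge_diff f v) = 0"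
    "\<And>j f. j \<in> R \<Longrightarrow> f \<in> R \<Longrightarrow> M j f = (if f = j then 1 else 0)"
proof -
  have finE: "finite E" by (rule simple_graph_finite[OF sg])
  obtain B where B: "B \<subseteq> E" "\<And>e. e \<in> E - B \<Longrightarrow> \<exists>C\<in>cycles E. e \<in> C \<and> C - {e} \<subseteq> B"
    "card B = matroid_rank (graphic_matroid E) E"
    using max_forest[OF sg order_refl] by metis
  have cB: "card B = n - 1" using B(3) rank_connected[OF sg conn] n by simp
  have finB: "finite B" using B(1) finE finite_subset by blast
  have "card (E - B) = card E - (n - 1)" using card_Diff_subset[OF finB B(1)] cB by simp
  then have "n - 2 \<le> card (E - B)" using card n by simp
  then obtain R where R: "R \<subseteq> E - B" "card R = n - 2" by (metis obtain_subset_with_card_n)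
  have "B \<noteq> {}" using cB n by auto
  then obtain e0 where e0: "e0 \<in> B" by auto
  have "\<exists>m. (\<forall>v. (\<Sum>f\<in>E. m f * edge_diff f v) = 0) \<and> m j = (1::complex) \<and> (\<forall>f. f \<notin> insert j B \<longrightarrow> m f = 0)" if j: "j \<in> R" for j
  proof -
    obtain C where C: "C \<in> cycles E" "j \<in> C" "C - {j} \<subseteq> B" using B(2)[of j] R(1) j by blast
    have CE: "C \<subseteq> E" using cycle_nonempty[OF C(1)] by simp
    obtain \<epsilon> :: "nat set \<Rightarrow> int" where \<epsilon>: "\<And>e. e \<in> C \<Longrightarrow> \<epsilon> e = 1 \<or> \<epsilon> e = -1"
      "\<And>u :: nat \<Rightarrow> complex. (\<Sum>e\<in>C. of_int (\<epsilon> e) * edge_diff e u) = 0"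
      using cycle_relation[OF C(1)] by metis
    define m where "m = (\<lambda>f. if f \<in> C then complex_of_int (\<epsilon> j) * of_int (\<epsilon> f) else 0)"
    have "(\<Sum>f\<in>E. m f * edge_diff f v) = 0" for v
    proof -
      have "(\<Sum>f\<in>E. m f * edge_diff f v) = (\<Sum>f\<in>C. m f * edge_diff f v)"
        by (rule sum.mono_neutral_right[OF finE CE]) (simp add: m_def)
      also have "\<dots> = of_int (\<epsilon> j) * (\<Sum>f\<in>C. of_int (\<epsilon> f) * edge_diff f v)"
        by (simp add: m_def sum_distrib_left mult.assoc)
      finally show ?thesis using \<epsilon>(2) by simp
    qed
    moreover have "m j = 1" using \<epsilon>(1)[OF C(2)] C(2) by (auto simp: m_def)
    moreover have "m f = 0" if "f \<notin> insert j B" for f using that C(3) by (auto simp: m_def)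
    ultimately show ?thesis by blast
  qed
  then obtain M :: "nat set \<Rightarrow> nat set \<Rightarrow> complex" where
    M: "\<And>j. j \<in> R \<Longrightarrow> (\<forall>v. (\<Sum>f\<in>E. M j f * edge_diff f v) = 0) \<and> M j j = 1 \<and> (\<forall>f. f \<notin> insert j B \<longrightarrow> M j f = 0)"
    by metis
  have "M j f = (if f = j then 1 else 0)" if "j \<in> R" "f \<in> R" for j f
    using M[OF that(1)] that(2) R(1) by auto
  then show thesis using that[of e0 R M] e0 B(1) R M by blast
qed

text \<open>For large \<open>k\<close> there are more products than nbc monomials, hence a linear relation. The
  parameters only contribute a factor that tends to one as their degree bound \<open>D\<close> grows.\<close>

lemma growth_relation:
  assumes sg: "simple_graph n E" and n: "n \<ge> 3" and ord: "inj_on ord E" and T: "T = card {A. nbc ord E A \<and> card A = n - 1}"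
    and J: "finite J" "card J = n - 1" and c: "\<And>j. j \<in> J \<Longrightarrow> homog_linear E (c j)"
    and g: "homog_linear E g" and z: "homog_linear E z"
  obtains k D \<kappa> where
    "\<exists>b\<in>compositions J (k - T). \<exists>i\<le>T. \<exists>\<eta>\<in>expbox (UNIV \<times> E) D. \<kappa> b i \<eta> \<noteq> (0 :: complex)"
    "\<And>u w. nonvanishing E u \<Longrightarrow> (\<Sum>b\<in>compositions J (k - T). \<Sum>i\<le>T. \<Sum>\<eta>\<in>expbox (UNIV \<times> E) D.
        \<kappa> b i \<eta> * (mon (UNIV \<times> E) \<eta> w * (\<Prod>j\<in>J. c j (u, w) ^ b j) * g (u, w) ^ i * z (u, w) ^ (T - i))) = 0"
proof -
  have finE: "finite E" by (rule simple_graph_finite[OF sg])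
  let ?V = "(UNIV :: bool set) \<times> E"
  have finV: "finite ?V" using finE by simp
  obtain k where k: "k \<ge> T" "T * ((k + (n - 2)) choose k) + 2 ^ card E * ((k + (n - 2) - 1) choose k)
      < (T + 1) * ((k - T + (n - 2)) choose (k - T))"
  proof -
    have "1 \<le> n - 2" using n by simp
    from growth_gap[OF this, of T "2 ^ card E"] show ?thesis using that by blast
  qed
  define NB where "NB = nbc_compositions ord E k"
  have finNB: "finite NB" unfolding NB_def by (rule nbc_compositions_card(1)[OF sg n ord])
  have cNB: "card NB \<le> T * ((k + (n - 2)) choose k) + 2 ^ card E * ((k + (n - 2) - 1) choose k)"
    unfolding NB_def T by (rule nbc_compositions_card(2)[OF sg n ord])
  define U where "U = card (compositions J (k - T)) * (T + 1)"
  have finJ: "finite (compositions J (k - T))" using compositions_card[OF J(1)] by simp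
  have "k - T + (n - 1) - 1 = k - T + (n - 2)" using n by simp
  then have "card (compositions J (k - T)) = (k - T + (n - 2)) choose (k - T)"
    using compositions_card[OF J(1), of "k - T"] J(2) by metis
  then have "card NB < U" using cNB k(2) unfolding U_def by (simp add: mult.commute)
  then obtain D where D: "card NB * (D + k + 1) ^ card ?V < U * (D + 1) ^ card ?V"
    using power_growth by blast
  let ?I = "NB \<times> expbox ?V (D + k)" and ?J = "compositions J (k - T) \<times> {..T} \<times> expbox ?V D"
  \<comment> \<open>The degrees \<open>k - T\<close>, \<open>i\<close> and \<open>T - i\<close> add
    up to \<open>k\<close>: powers of \<open>z\<close> fill up what \<open>g\<close> leaves, so that
    all products lie in one graded piece. Each of the \<open>k\<close> factors raises the parameter
    degree by at most one, whence the box \<open>D + k\<close>.\<close>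
  define F where "F = (\<lambda>(b, i, \<eta>) x. base_fn E (restrict (\<lambda>_. 0) E, \<eta>) x * (\<Prod>j\<in>J. c j x ^ b j) * g x ^ i * z x ^ (T - i))"
  have span: "F j \<in> lspan (base_fn E ` ?I)" if j: "j \<in> ?J" for j
  proof -
    obtain b i \<eta> where j': "j = (b, i, \<eta>)" "b \<in> compositions J (k - T)" "i \<le> T" "\<eta> \<in> expbox ?V D" using j by auto
    have "base_fn E (restrict (\<lambda>_. 0) E, \<eta>) \<in> homog E 0 D"
    proof -
      have "restrict (\<lambda>_. 0) E \<in> compositions E 0"
        unfolding compositions_def using restrict_PiE_iff[of "\<lambda>_. 0" E "\<lambda>_. UNIV"] by auto
      then show ?thesis unfolding homog_def using j'(4) by (intro lspan_base imageI SigmaI)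
    qed
    from homog_prod[where b = b, OF J(1) c this]
    have "(\<lambda>x. base_fn E (restrict (\<lambda>_. 0) E, \<eta>) x * (\<Prod>j\<in>J. c j x ^ b j)) \<in> homog E (k - T) (D + (k - T))"
      using j'(2) by (simp add: compositions_def)
    from homog_power[OF z homog_power[OF g this, of i], of "T - i"]
    have "F j \<in> homog E (k - T + i + (T - i)) (D + (k - T) + i + (T - i))" unfolding j'(1) F_def by simp
    then have "F j \<in> lspan (base_fn E ` (compositions E k \<times> expbox ?V (D + k)))"
      unfolding homog_def using j'(3) k(1) by simp
    then show ?thesis
    proof (rule lspan_mono, safe)
      fix \<alpha> \<eta> assume "\<alpha> \<in> compositions E k" "\<eta> \<in> expbox ?V (D + k)"
      then show "base_fn E (\<alpha>, \<eta>) \<in> lspan (base_fn E ` ?I)" unfolding NB_def by (intro straighten[OF sg ord])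
    qed
  qed
  have finI: "finite ?I" using finNB expbox_card[OF finV] by blast
  have finJJ: "finite ?J" using finJ expbox_card[OF finV] by blast
  have "card ?I < card ?J"
    using D expbox_card[OF finV, of D] expbox_card[OF finV, of "D + k"] by (simp add: card_cartesian_product U_def algebra_simps)
  from lspan_dependent[OF finI finJJ this span]
  obtain \<kappa> where \<kappa>0: "(\<exists>j\<in>?J. \<kappa> j \<noteq> 0) \<and> (\<forall>x. (\<Sum>j\<in>?J. \<kappa> j * F j x) = 0)" by (rule exE)
  note \<kappa> = conjunct1[OF \<kappa>0] spec[OF conjunct2[OF \<kappa>0]]
  show thesis
  proof (rule that[of k D "\<lambda>b i \<eta>. \<kappa> (b, i, \<eta>)"])
    show "\<exists>b\<in>compositions J (k - T). \<exists>i\<le>T. \<exists>\<eta>\<in>expbox ?V D. \<kappa> (b, i, \<eta>) \<noteq> 0" using \<kappa>(1) by fastforce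
    fix u w assume u: "nonvanishing E u"
    have "mon E (restrict (\<lambda>_. 0) E) v = 1" for v :: "nat set \<Rightarrow> complex" unfolding mon_def by (intro prod.neutral) simp
    then have Fe: "F (b, i, \<eta>) (u, w) = mon ?V \<eta> w * (\<Prod>j\<in>J. c j (u, w) ^ b j) * g (u, w) ^ i * z (u, w) ^ (T - i)" for b i \<eta>
      unfolding F_def base_fn_def using u by simp
    show "(\<Sum>b\<in>compositions J (k - T). \<Sum>i\<le>T. \<Sum>\<eta>\<in>expbox ?V D.
        \<kappa> (b, i, \<eta>) * (mon ?V \<eta> w * (\<Prod>j\<in>J. c j (u, w) ^ b j) * g (u, w) ^ i * z (u, w) ^ (T - i))) = 0"
      using \<kappa>(2)[of "(u, w)"] unfolding sum.cartesian_product Fe[symmetric] by (simp add: case_prod_unfold)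
  qed
qed

section \<open>Passing to the fibre\<close>

lemma zero_at_zero:
  fixes h :: "complex \<Rightarrow> complex"
  assumes "isCont h 0" "\<And>t. t \<noteq> 0 \<Longrightarrow> h t = 0"
  shows "h 0 = 0"
proof -
  have "h \<midarrow>0\<rightarrow> h 0" using assms(1) by (simp add: isCont_def)
  moreover have "h \<midarrow>0\<rightarrow> 0"
    by (rule Lim_transform_eventually[of "\<lambda>_. 0"]) (use assms(2) in \<open>auto simp: eventually_at_filter\<close>)
  ultimately show ?thesis by (rule LIM_unique)
qed

text \<open>When the measurements are the products of the differences of \<open>u\<close> and
  \<open>v\<close>, each form \<open>c j\<close> with \<open>j\<close> in \<open>R\<close> is a
  circuit sum of differences of \<open>v\<close>, hence zero, and the relation may become trivial.
  Its lowest-order part in these forms is kept by letting the measurements approach such values.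
  Cancelling powers of \<open>z\<close> leaves an equation for the quotient of \<open>g\<close> by
  \<open>z\<close>, which is invariant under scaling \<open>u\<close>.\<close>

lemma fibre_relation:
  assumes sg: "simple_graph n E" and conn: "connected_graph n E" and n: "n \<ge> 3" and card: "2 * n - 3 \<le> card E"
    and ord: "inj_on ord E" and T: "T = card {A. nbc ord E A \<and> card A = n - 1}"
  obtains e0 D \<kappa> where "e0 \<in> E" "\<exists>i\<le>T. \<exists>\<eta>\<in>expbox (UNIV \<times> E) D. \<kappa> i \<eta> \<noteq> (0 :: complex)"
    "\<And>u v s. nonvanishing E u \<Longrightarrow> (\<Sum>i\<le>T. (\<Sum>\<eta>\<in>expbox (UNIV \<times> E) D. \<kappa> i \<eta> *
        mon (UNIV \<times> E) \<eta> (\<lambda>(b, e). if b then edge_diff e u * edge_diff e v else s e)) *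
        (\<Sum>e\<in>E. s e * (edge_diff e0 u / edge_diff e u)) ^ i) = 0"
proof -
  have finE: "finite E" by (rule simple_graph_finite[OF sg])
  let ?V = "(UNIV :: bool set) \<times> E"
  have finV: "finite ?V" using finE by simp
  obtain e0 R and M :: "nat set \<Rightarrow> nat set \<Rightarrow> complex" where
    e0: "e0 \<in> E" and R1: "R \<subseteq> E" and e0R: "e0 \<notin> R" and R2: "card R = n - 2"
    and M: "\<And>j v. j \<in> R \<Longrightarrow> (\<Sum>f\<in>E. M j f * edge_diff f v) = 0"
    "\<And>j f. j \<in> R \<Longrightarrow> f \<in> R \<Longrightarrow> M j f = (if f = j then 1 else 0)"
  proof (rule tree_coordinates[OF sg conn n card])
    fix e0 R and M :: "nat set \<Rightarrow> nat set \<Rightarrow> complex"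
    assume a: "e0 \<in> E" "R \<subseteq> E" "e0 \<notin> R" "card R = n - 2"
      "\<And>j v. j \<in> R \<Longrightarrow> (\<Sum>f\<in>E. M j f * edge_diff f v) = 0"
      "\<And>j f. j \<in> R \<Longrightarrow> f \<in> R \<Longrightarrow> M j f = (if f = j then 1 else 0)"
    show thesis by (rule that[OF a])
  qed
  note e0 = e0 e0R and R = R1 R2
  have finR: "finite R" using R(1) finE finite_subset by blast
  define J where "J = insert e0 R"
  have J: "finite J" "card J = n - 1" unfolding J_def using finR e0(2) R(2) n by auto
  define z :: "(nat \<Rightarrow> complex) \<times> (bool \<times> nat set \<Rightarrow> complex) \<Rightarrow> complex" where "z = (\<lambda>x. recip (fst x) e0)"
  define g :: "(nat \<Rightarrow> complex) \<times> (bool \<times> nat set \<Rightarrow> complex) \<Rightarrow> complex" where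
    "g = (\<lambda>x. \<Sum>e\<in>E. 1 * (snd x (False, e) * recip (fst x) e))"
  define c :: "nat set \<Rightarrow> (nat \<Rightarrow> complex) \<times> (bool \<times> nat set \<Rightarrow> complex) \<Rightarrow> complex" where
    "c = (\<lambda>j. if j = e0 then z else (\<lambda>x. \<Sum>f\<in>E. M j f * (snd x (True, f) * recip (fst x) f)))"
  have hz: "homog_linear E z" unfolding z_def by (rule homog_linear_recip[OF finE e0(1)])
  have hg: "homog_linear E g" unfolding g_def by (intro homog_linear_sum homog_linear_param[OF finE]) auto
  have hc: "homog_linear E (c j)" for j
    unfolding c_def using hz by (auto intro!: homog_linear_sum homog_linear_param[OF finE])
  obtain k D \<kappa> where \<kappa>: "\<exists>b\<in>compositions J (k - T). \<exists>i\<le>T. \<exists>\<eta>\<in>expbox ?V D. \<kappa> b i \<eta> \<noteq> (0 :: complex)"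
    and rel: "\<And>u w. nonvanishing E u \<Longrightarrow> (\<Sum>b\<in>compositions J (k - T). \<Sum>i\<le>T. \<Sum>\<eta>\<in>expbox ?V D.
        \<kappa> b i \<eta> * (mon ?V \<eta> w * (\<Prod>j\<in>J. c j (u, w) ^ b j) * g (u, w) ^ i * z (u, w) ^ (T - i))) = 0"
  proof (rule growth_relation[OF sg n ord T J hc hg hz])
    fix k D \<kappa>
    assume a: "\<exists>b\<in>compositions J (k - T). \<exists>i\<le>T. \<exists>\<eta>\<in>expbox ?V D. \<kappa> b i \<eta> \<noteq> (0 :: complex)"
      "\<And>u w. nonvanishing E u \<Longrightarrow> (\<Sum>b\<in>compositions J (k - T). \<Sum>i\<le>T. \<Sum>\<eta>\<in>expbox ?V D.
        \<kappa> b i \<eta> * (mon ?V \<eta> w * (\<Prod>j\<in>J. c j (u, w) ^ b j) * g (u, w) ^ i * z (u, w) ^ (T - i))) = 0"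
    show thesis by (rule that[OF a])
  qed
  let ?C = "compositions J (k - T)"
  have finC: "finite ?C" using compositions_card[OF J(1)] by simp
  define live where "live = (\<lambda>b. \<exists>i\<le>T. \<exists>\<eta>\<in>expbox ?V D. \<kappa> b i \<eta> \<noteq> 0)"
  \<comment> \<open>The least order in the vanishing forms among the terms with a nonzero
    coefficient; this is the power of \<open>t\<close> to divide by.\<close>
  obtain b0 where b0: "b0 \<in> ?C" "live b0" "\<And>b. b \<in> ?C \<Longrightarrow> live b \<Longrightarrow> sum b0 R \<le> sum b R"
  proof -
    obtain b1 where "b1 \<in> ?C \<and> live b1" using \<kappa> unfolding live_def by blast
    from ex_has_least_nat[of "\<lambda>b. b \<in> ?C \<and> live b" b1 "\<lambda>b. sum b R", OF this] show ?thesis using that by blast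
  qed
  define d where "d = sum b0 R"
  define \<Lambda> where "\<Lambda> = {b \<in> ?C. sum b R = d}"
  obtain i0 \<eta>0 where i0: "i0 \<le> T" "\<eta>0 \<in> expbox ?V D" "\<kappa> b0 i0 \<eta>0 \<noteq> 0" using b0(2) unfolding live_def by auto
  \<comment> \<open>A direction in which the lowest-order part does not vanish. Its monomials in
    \<open>R\<close> are distinct, because the fixed total degree determines the exponent at
    \<open>e0\<close>.\<close>
  have "\<exists>\<gamma>. (\<Sum>b\<in>\<Lambda>. \<kappa> b i0 \<eta>0 * mon R b \<gamma>) \<noteq> 0"
  proof (rule ccontr)
    assume "\<not> ?thesis"
    then have zero: "(\<Sum>b\<in>\<Lambda>. \<kappa> b i0 \<eta>0 * mon R b \<gamma>) = 0" for \<gamma> by simp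
    let ?r = "\<lambda>b. restrict b R"
    have sJ: "sum b J = b e0 + sum b R" for b :: "nat set \<Rightarrow> nat" unfolding J_def using finR e0(2) by simp
    have inj: "inj_on ?r \<Lambda>"
    proof (rule inj_onI)
      fix b b' assume bb: "b \<in> \<Lambda>" "b' \<in> \<Lambda>" "?r b = ?r b'"
      show "b = b'"
      proof (rule extensionalityI)
        show "b \<in> extensional J" "b' \<in> extensional J" using bb unfolding \<Lambda>_def compositions_def by (auto simp: PiE_def)
        fix j assume "j \<in> J"
        show "b j = b' j"
        proof (cases "j = e0")
          case True then show ?thesis using bb(1,2) sJ[of b] sJ[of b'] unfolding \<Lambda>_def compositions_def by auto
        next
          case False then have "j \<in> R" using \<open>j \<in> J\<close> by (simp add: J_def)
          then show ?thesis using bb(3) by (metis restrict_apply')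
        qed
      qed
    qed
    have "\<kappa> (inv_into \<Lambda> ?r (?r b0)) i0 \<eta>0 = 0"
    proof (rule mon_indep[OF finR, where \<Lambda> = "?r ` \<Lambda>" and \<kappa> = "\<lambda>\<beta>. \<kappa> (inv_into \<Lambda> ?r \<beta>) i0 \<eta>0"])
      show "finite (?r ` \<Lambda>)" unfolding \<Lambda>_def using finC by simp
      show "?r ` \<Lambda> \<subseteq> R \<rightarrow>\<^sub>E UNIV" by auto
      show "?r b0 \<in> ?r ` \<Lambda>" using b0(1) unfolding \<Lambda>_def d_def by auto
      fix v :: "nat set \<Rightarrow> complex"
      have "(\<Sum>\<beta>\<in>?r ` \<Lambda>. \<kappa> (inv_into \<Lambda> ?r \<beta>) i0 \<eta>0 * mon R \<beta> v) = (\<Sum>b\<in>\<Lambda>. \<kappa> b i0 \<eta>0 * mon R b v)"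
        unfolding sum.reindex[OF inj] comp_def
        by (rule sum.cong) (auto simp: inv_into_f_f[OF inj] mon_def intro!: prod.cong)
      then show "(\<Sum>\<beta>\<in>?r ` \<Lambda>. \<kappa> (inv_into \<Lambda> ?r \<beta>) i0 \<eta>0 * mon R \<beta> v) = 0" using zero by simp
    qed
    then show False using i0(3) inv_into_f_f[OF inj, of b0] b0(1) unfolding \<Lambda>_def d_def by simp
  qed
  then obtain \<gamma> where \<gamma>: "(\<Sum>b\<in>\<Lambda>. \<kappa> b i0 \<eta>0 * mon R b \<gamma>) \<noteq> 0" by blast
  define \<kappa>' where "\<kappa>' = (\<lambda>i \<eta>. \<Sum>b\<in>\<Lambda>. \<kappa> b i \<eta> * mon R b \<gamma>)"
  show thesis
  proof (rule that[of e0 D \<kappa>'])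
    show "e0 \<in> E" by (rule e0(1))
    show "\<exists>i\<le>T. \<exists>\<eta>\<in>expbox ?V D. \<kappa>' i \<eta> \<noteq> 0" using i0 \<gamma> unfolding \<kappa>'_def by blast
    fix u v s assume u: "nonvanishing E u"
    have nz: "edge_diff e u \<noteq> 0" if "e \<in> E" for e using u that by (simp add: nonvanishing_def)
    \<comment> \<open>Moving the measurements along this line makes every coordinate \<open>c j\<close> a multiple of \<open>t\<close>.\<close>
    define w where "w = (\<lambda>t (b, e). if b then edge_diff e u * (edge_diff e v + (if e \<in> R then t * \<gamma> e else 0)) else s e)"
    have cj: "c j (u, w t) = t * \<gamma> j" if j: "j \<in> R" for j t
    proof -
      have "c j (u, w t) = (\<Sum>f\<in>E. M j f * edge_diff f v + (if f \<in> R then M j f * (t * \<gamma> f) else 0))"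
      proof -
        have "j \<noteq> e0" using j e0(2) by blast
        then have "c j (u, w t) = (\<Sum>f\<in>E. M j f * (w t (True, f) * recip u f))" by (simp add: c_def)
        also have "\<dots> = (\<Sum>f\<in>E. M j f * edge_diff f v + (if f \<in> R then M j f * (t * \<gamma> f) else 0))"
        proof (rule sum.cong[OF refl])
          fix f assume "f \<in> E"
          then have "w t (True, f) * recip u f = edge_diff f v + (if f \<in> R then t * \<gamma> f else 0)"
            using nz by (simp add: w_def recip_def)
          then show "M j f * (w t (True, f) * recip u f) = M j f * edge_diff f v + (if f \<in> R then M j f * (t * \<gamma> f) else 0)"
            by (simp add: distrib_left)
        qed
        finally show ?thesis .
      qed
      also have "\<dots> = (\<Sum>f\<in>E. if f \<in> R then M j f * (t * \<gamma> f) else 0)" using M(1)[OF j] by (simp add: sum.distrib)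
      also have "\<dots> = (\<Sum>f\<in>R. M j f * (t * \<gamma> f))"
        using sum.inter_restrict[OF finE, of "\<lambda>f. M j f * (t * \<gamma> f)" R] R(1) by (simp add: Int_absorb1)
      also have "\<dots> = (\<Sum>f\<in>R. if f = j then t * \<gamma> f else 0)" by (rule sum.cong) (use M(2)[OF j] in auto)
      finally show ?thesis using finR j by simp
    qed
    define z0 where "z0 = recip u e0"
    define g0 where "g0 = (\<Sum>e\<in>E. s e * recip u e)"
    have ze: "z (u, w t) = z0" for t by (simp add: z_def z0_def)
    have ge: "g (u, w t) = g0" for t by (simp add: g_def g0_def w_def)
    have pe: "(\<Prod>j\<in>J. c j (u, w t) ^ b j) = z0 ^ b e0 * (t ^ sum b R * mon R b \<gamma>)" for t b
    proof -
      have "(\<Prod>j\<in>J. c j (u, w t) ^ b j) = c e0 (u, w t) ^ b e0 * (\<Prod>j\<in>R. (t * \<gamma> j) ^ b j)"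
        unfolding J_def using finR e0(2) cj by simp
      then show ?thesis by (simp add: c_def ze mon_def power_mult_distrib prod.distrib power_sum)
    qed
    \<comment> \<open>The relation along the line, divided by \<open>t ^ d\<close>. The truncated
      exponent \<open>sum b R - d\<close> is harmless, since terms of smaller order have zero
      coefficients.\<close>
    define h where "h = (\<lambda>t. \<Sum>b\<in>?C. \<Sum>i\<le>T. \<Sum>\<eta>\<in>expbox ?V D.
        \<kappa> b i \<eta> * (mon ?V \<eta> (w t) * (z0 ^ b e0 * (t ^ (sum b R - d) * mon R b \<gamma>)) * g0 ^ i * z0 ^ (T - i)))"
    have "h 0 = 0"
    proof (rule zero_at_zero)
      have wc: "isCont (\<lambda>t. w t y) 0" for y unfolding w_def by (cases y; cases "snd y \<in> R"; cases "fst y") auto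
      show "isCont h 0" unfolding h_def mon_def by (intro continuous_intros wc)
      fix t :: complex assume t: "t \<noteq> 0"
      have "t ^ d * h t = 0"
        unfolding rel[OF u, of "w t", symmetric] h_def sum_distrib_left
      proof (intro sum.cong refl)
        fix b i \<eta> assume b: "b \<in> ?C" "i \<in> {..T}" "\<eta> \<in> expbox ?V D"
        show "t ^ d * (\<kappa> b i \<eta> * (mon ?V \<eta> (w t) * (z0 ^ b e0 * (t ^ (sum b R - d) * mon R b \<gamma>)) * g0 ^ i * z0 ^ (T - i)))
          = \<kappa> b i \<eta> * (mon ?V \<eta> (w t) * (\<Prod>j\<in>J. c j (u, w t) ^ b j) * g (u, w t) ^ i * z (u, w t) ^ (T - i))"
        proof (cases "\<kappa> b i \<eta> = 0")
          case False
          then have "live b" using b unfolding live_def by auto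
          then have "d \<le> sum b R" using b0(3) b(1) unfolding d_def by simp
          then have "t ^ sum b R = t ^ d * t ^ (sum b R - d)" by (simp add: power_add[symmetric])
          then show ?thesis unfolding pe ge ze by (simp add: mult_ac)
        qed simp
      qed
      then show "h t = 0" using t by simp
    qed
    let ?w = "\<lambda>(b, e). if b then edge_diff e u * edge_diff e v else s e"
    have w0: "w 0 = ?w" unfolding w_def by (auto simp: fun_eq_iff)
    have znz: "z0 \<noteq> 0" unfolding z0_def recip_def using nz[OF e0(1)] by simp
    have rho: "g0 = z0 * (\<Sum>e\<in>E. s e * (edge_diff e0 u / edge_diff e u))"
      unfolding g0_def z0_def recip_def sum_distrib_left using nz[OF e0(1)] by (intro sum.cong) auto
    let ?\<rho> = "\<Sum>e\<in>E. s e * (edge_diff e0 u / edge_diff e u)"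
    have "h 0 = (\<Sum>b\<in>?C. if sum b R = d then z0 ^ (k - T - d) * z0 ^ T * (\<Sum>i\<le>T. \<Sum>\<eta>\<in>expbox ?V D.
        \<kappa> b i \<eta> * mon R b \<gamma> * mon ?V \<eta> ?w * ?\<rho> ^ i) else 0)"
      unfolding h_def
    proof (rule sum.cong[OF refl])
      fix b assume b: "b \<in> ?C"
      show "(\<Sum>i\<le>T. \<Sum>\<eta>\<in>expbox ?V D.
        \<kappa> b i \<eta> * (mon ?V \<eta> (w 0) * (z0 ^ b e0 * (0 ^ (sum b R - d) * mon R b \<gamma>)) * g0 ^ i * z0 ^ (T - i)))
        = (if sum b R = d then z0 ^ (k - T - d) * z0 ^ T * (\<Sum>i\<le>T. \<Sum>\<eta>\<in>expbox ?V D.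
        \<kappa> b i \<eta> * mon R b \<gamma> * mon ?V \<eta> ?w * ?\<rho> ^ i) else 0)"
      proof (cases "sum b R = d")
        case True
        have "sum b J = b e0 + sum b R" unfolding J_def using finR e0(2) by simp
        moreover have "sum b J = k - T" using b by (simp add: compositions_def)
        ultimately have be: "b e0 = k - T - d" using True by linarith
        \<comment> \<open>Every surviving term carries the same power of \<open>z0\<close>, which is
          nonzero and can be cancelled.\<close>
        have "z0 ^ b e0 * g0 ^ i * z0 ^ (T - i) = z0 ^ (k - T - d) * z0 ^ T * ?\<rho> ^ i" if "i \<le> T" for i
        proof -
          have "z0 ^ T = z0 ^ i * z0 ^ (T - i)" using that by (simp add: power_add[symmetric])
          then show ?thesis unfolding be rho power_mult_distrib by (simp add: mult_ac)
        qed
        then show ?thesis using True unfolding w0 sum_distrib_left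
          by (auto intro!: sum.cong simp: mult_ac)
      next
        case False
        have "\<kappa> b i \<eta> * 0 ^ (sum b R - d) = 0" if "i \<le> T" "\<eta> \<in> expbox ?V D" for i \<eta>
        proof (cases "sum b R < d")
          case True
          then have "\<not> live b" using b0(3)[OF b] unfolding d_def by auto
          then show ?thesis using that unfolding live_def by auto
        next
          case False then show ?thesis using \<open>sum b R \<noteq> d\<close> by simp
        qed
        then show ?thesis using False by (auto intro!: sum.neutral)
      qed
    qed
    also have "\<dots> = (\<Sum>b\<in>\<Lambda>. z0 ^ (k - T - d) * z0 ^ T * (\<Sum>i\<le>T. \<Sum>\<eta>\<in>expbox ?V D.
        \<kappa> b i \<eta> * mon R b \<gamma> * mon ?V \<eta> ?w * ?\<rho> ^ i))"
      unfolding \<Lambda>_def by (rule sum.inter_filter[OF finC, symmetric])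
    also have "\<dots> = z0 ^ (k - T - d) * z0 ^ T * (\<Sum>b\<in>\<Lambda>. \<Sum>i\<le>T. \<Sum>\<eta>\<in>expbox ?V D.
        \<kappa> b i \<eta> * mon R b \<gamma> * mon ?V \<eta> ?w * ?\<rho> ^ i)" by (rule sum_distrib_left[symmetric])
    finally have "(\<Sum>b\<in>\<Lambda>. \<Sum>i\<le>T. \<Sum>\<eta>\<in>expbox ?V D. \<kappa> b i \<eta> * mon R b \<gamma> * mon ?V \<eta> ?w * ?\<rho> ^ i) = 0"
      using \<open>h 0 = 0\<close> znz by simp
    moreover have "(\<Sum>b\<in>\<Lambda>. \<Sum>i\<le>T. \<Sum>\<eta>\<in>expbox ?V D. \<kappa> b i \<eta> * mon R b \<gamma> * mon ?V \<eta> ?w * ?\<rho> ^ i)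
      = (\<Sum>i\<le>T. (\<Sum>\<eta>\<in>expbox ?V D. \<kappa>' i \<eta> * mon ?V \<eta> ?w) * ?\<rho> ^ i)"
    proof -
      have "(\<Sum>b\<in>\<Lambda>. \<Sum>i\<le>T. \<Sum>\<eta>\<in>expbox ?V D. \<kappa> b i \<eta> * mon R b \<gamma> * mon ?V \<eta> ?w * ?\<rho> ^ i)
        = (\<Sum>i\<le>T. \<Sum>\<eta>\<in>expbox ?V D. \<Sum>b\<in>\<Lambda>. \<kappa> b i \<eta> * mon R b \<gamma> * mon ?V \<eta> ?w * ?\<rho> ^ i)"
        by (subst sum.swap) (intro sum.cong refl sum.swap)
      then show ?thesis unfolding \<kappa>'_def by (simp only: sum_distrib_right)
    qed
    ultimately show "(\<Sum>i\<le>T. (\<Sum>\<eta>\<in>expbox ?V D. \<kappa>' i \<eta> * mon ?V \<eta> ?w) * ?\<rho> ^ i) = 0" by simp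
  qed
qed

section \<open>Bounding the generic fibres\<close>

lemma edge_diff_lin: "edge_diff e (\<lambda>i. f i - c * g i) = edge_diff e f - c * edge_diff e g"
  "edge_diff e (\<lambda>i. c * g i) = c * edge_diff e g"
  unfolding edge_diff_def by (simp_all add: algebra_simps)

lemma edge_diff_const:
  assumes sg: "simple_graph n E" and conn: "connected_graph n E" and n: "n \<ge> 1"
    and z: "\<And>e. e \<in> E \<Longrightarrow> edge_diff e f = (0::complex)"
  obtains a where "\<And>i. i \<in> {1..n} \<Longrightarrow> f i = a"
proof -
  have "f i = f 1" if i: "i \<in> {1..n}" for i
  proof (rule connected_const[where f = f, OF sg conn])
    fix k l assume "{k, l} \<in> E"
    then have "edge_diff {k, l} f = 0" by (rule z)
    then show "f k = f l" unfolding edge_diff_pair by (simp split: if_splits)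
  qed (use i n in auto)
  then show thesis by (rule that)
qed

section \<open>Isotropic coordinates\<close>

definition uc :: "(nat \<Rightarrow> complex ^ 2) \<Rightarrow> nat \<Rightarrow> complex" where "uc q i = q i $ 1 + \<i> * q i $ 2"
definition vc :: "(nat \<Rightarrow> complex ^ 2) \<Rightarrow> nat \<Rightarrow> complex" where "vc q i = q i $ 1 - \<i> * q i $ 2"

lemma sqd_factor: "sqd q e = edge_diff e (uc q) * edge_diff e (vc q)"
proof -
  have i2: "\<i> * (\<i> * z) = - z" for z by (simp add: mult.assoc[symmetric])
  show ?thesis unfolding sqd_def sum_2 edge_diff_def uc_def vc_def
    by (simp add: power2_eq_square algebra_simps i2)
qed

lemma i_times_i: "\<i> * (\<i> * z) = - z"
  by (simp add: mult.assoc[symmetric])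

lemma vec2_eqI:
  fixes p r :: "complex ^ 2"
  assumes "p $ 1 + \<i> * p $ 2 = r $ 1 + \<i> * r $ 2" "p $ 1 - \<i> * p $ 2 = r $ 1 - \<i> * r $ 2"
  shows "p = r"
proof -
  have "2 * p $ 1 = 2 * r $ 1" "2 * (\<i> * p $ 2) = 2 * (\<i> * r $ 2)"
    using arg_cong2[OF assms, of "(+)"] arg_cong2[OF assms, of "(-)"] by (simp_all add: algebra_simps)
  then show ?thesis by (simp add: vec_eq_iff forall_2)
qed

text \<open>Equal ratios make the differences of \<open>uc p\<close> a multiple \<open>s\<close> of
  those of \<open>U\<close>; equal products then make those of \<open>vc p\<close> the multiple
  \<open>1 / s\<close> of those of \<open>V\<close>. Connectedness passes from differences to
  positions up to translation. Such a scaling is a rotation, preceded by a reflection if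
  \<open>U\<close> is \<open>vc q\<close>.\<close>

lemma congruent_by_ratio:
  assumes sg: "simple_graph n E" and conn: "connected_graph n E" and n: "n \<ge> 1"
    and pq: "p \<in> configs n" "q \<in> configs n" and e0: "e0 \<in> E"
    and eq: "\<And>e. e \<in> E \<Longrightarrow> sqd p e = sqd q e" and nz: "\<And>e. e \<in> E \<Longrightarrow> sqd p e \<noteq> 0"
    and UV: "(U, V) = (uc q, vc q) \<or> (U, V) = (vc q, uc q)"
    and ratio: "\<And>e. e \<in> E \<Longrightarrow> edge_diff e0 (uc p) / edge_diff e (uc p) = edge_diff e0 U / edge_diff e U"
  shows "(p, q) \<in> congruence n"
proof -
  have UVe: "edge_diff e U * edge_diff e V = sqd p e" if "e \<in> E" for e
    using UV eq[OF that] by (auto simp: sqd_factor mult.commute)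
  have nzs: "edge_diff e U \<noteq> 0" "edge_diff e V \<noteq> 0" "edge_diff e (uc p) \<noteq> 0" "edge_diff e (vc p) \<noteq> 0" if "e \<in> E" for e
    using UVe[OF that] nz[OF that] sqd_factor[of p e] by auto
  define s where "s = edge_diff e0 (uc p) / edge_diff e0 U"
  have s: "s \<noteq> 0" unfolding s_def using nzs[OF e0] by simp
  have u: "edge_diff e (uc p) = s * edge_diff e U" if "e \<in> E" for e
    using ratio[OF that] nzs[OF that] nzs[OF e0] by (simp add: s_def field_simps)
  have v: "edge_diff e (vc p) = (1 / s) * edge_diff e V" if "e \<in> E" for e
  proof -
    have "edge_diff e (uc p) * edge_diff e (vc p) = edge_diff e U * edge_diff e V"
      using sqd_factor[of p e] UVe[OF that] by metis
    then have "edge_diff e U * (s * edge_diff e (vc p)) = edge_diff e U * edge_diff e V"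
      unfolding u[OF that] by (simp only: mult_ac)
    then have "s * edge_diff e (vc p) = edge_diff e V" using nzs[OF that] by simp
    then show ?thesis using s by (simp add: field_simps)
  qed
  obtain a where a: "\<And>i. i \<in> {1..n} \<Longrightarrow> uc p i - s * U i = a"
    by (rule edge_diff_const[OF sg conn n, of "\<lambda>i. uc p i - s * U i"]) (use u in \<open>auto simp: edge_diff_lin\<close>)
  obtain b where b: "\<And>i. i \<in> {1..n} \<Longrightarrow> vc p i - (1 / s) * V i = b"
    by (rule edge_diff_const[OF sg conn n, of "\<lambda>i. vc p i - (1 / s) * V i"]) (simp_all only: edge_diff_lin v diff_self)
  have pu: "uc p i = s * U i + a" "vc p i = (1 / s) * V i + b" if "i \<in> {1..n}" for i
    using a[OF that] b[OF that] by (simp_all add: algebra_simps)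
  \<comment> \<open>The complex cosine and sine of the rotation, solved from
    \<open>\<alpha> - \<i> * \<beta> = s\<close> and
    \<open>\<alpha> + \<i> * \<beta> = 1 / s\<close>, its factors on the two isotropic
    coordinates.\<close>
  define \<alpha> where "\<alpha> = (s + 1 / s) / 2"
  define \<beta> where "\<beta> = \<i> * (s - 1 / s) / 2"
  have sab: "\<alpha> - \<i> * \<beta> = s" "\<alpha> + \<i> * \<beta> = 1 / s"
    unfolding \<alpha>_def \<beta>_def by (simp_all add: i_times_i field_simps)
  have "(\<alpha> - \<i> * \<beta>) * (\<alpha> + \<i> * \<beta>) = \<alpha> * \<alpha> + \<beta> * \<beta>" by (simp add: algebra_simps i_times_i)
  then have ab: "\<alpha> * \<alpha> + \<beta> * \<beta> = 1" unfolding sab using s by simp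
  define x :: "complex ^ 2" where "x = vector [(a + b) / 2, - \<i> * (a - b) / 2]"
  have "\<exists>A :: complex ^ 2 ^ 2. orthogonal_matrix A \<and> (\<forall>i\<in>{1..n}. p i = A *v q i + x)"
    using UV
  proof
    assume "(U, V) = (uc q, vc q)"
    then have UV: "U = uc q" "V = vc q" by auto
    let ?A = "vector [vector [\<alpha>, \<beta>], vector [- \<beta>, \<alpha>]] :: complex ^ 2 ^ 2"
    have "orthogonal_matrix ?A"
      using ab by (simp add: orthogonal_matrix_def matrix_matrix_mult_def transpose_def mat_def vec_eq_iff forall_2 sum_2 algebra_simps)
    moreover have "p i = ?A *v q i + x" if i: "i \<in> {1..n}" for i
    proof (rule vec2_eqI)
      have r: "(?A *v q i + x) $ 1 = \<alpha> * q i $ 1 + \<beta> * q i $ 2 + (a + b) / 2"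
        "(?A *v q i + x) $ 2 = - \<beta> * q i $ 1 + \<alpha> * q i $ 2 - \<i> * (a - b) / 2"
        by (simp_all add: matrix_vector_mult_def sum_2 x_def)
      have "(\<alpha> - \<i> * \<beta>) * (q i $ 1 + \<i> * q i $ 2) + a
        = (?A *v q i + x) $ 1 + \<i> * (?A *v q i + x) $ 2"
        unfolding r by (simp add: algebra_simps i_times_i add_divide_distrib diff_divide_distrib)
      then show "p i $ 1 + \<i> * p i $ 2 = (?A *v q i + x) $ 1 + \<i> * (?A *v q i + x) $ 2"
        unfolding sab using pu(1)[OF i] by (simp add: UV uc_def vc_def)
      have "(\<alpha> + \<i> * \<beta>) * (q i $ 1 - \<i> * q i $ 2) + b
        = (?A *v q i + x) $ 1 - \<i> * (?A *v q i + x) $ 2"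
        unfolding r by (simp add: algebra_simps i_times_i add_divide_distrib diff_divide_distrib)
      then show "p i $ 1 - \<i> * p i $ 2 = (?A *v q i + x) $ 1 - \<i> * (?A *v q i + x) $ 2"
        unfolding sab using pu(2)[OF i] by (simp add: UV uc_def vc_def)
    qed
    ultimately show ?thesis by blast
  next
    assume "(U, V) = (vc q, uc q)"
    then have UV: "U = vc q" "V = uc q" by auto
    \<comment> \<open>The rotation of the other case, preceded by the reflection that negates the
      second coordinate and so swaps \<open>uc\<close> and \<open>vc\<close>.\<close>
    let ?A = "vector [vector [\<alpha>, - \<beta>], vector [- \<beta>, - \<alpha>]] :: complex ^ 2 ^ 2"
    have "orthogonal_matrix ?A"
      using ab by (simp add: orthogonal_matrix_def matrix_matrix_mult_def transpose_def mat_def vec_eq_iff forall_2 sum_2 algebra_simps)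
    moreover have "p i = ?A *v q i + x" if i: "i \<in> {1..n}" for i
    proof (rule vec2_eqI)
      have r: "(?A *v q i + x) $ 1 = \<alpha> * q i $ 1 - \<beta> * q i $ 2 + (a + b) / 2"
        "(?A *v q i + x) $ 2 = - \<beta> * q i $ 1 - \<alpha> * q i $ 2 - \<i> * (a - b) / 2"
        by (simp_all add: matrix_vector_mult_def sum_2 x_def)
      have "(\<alpha> - \<i> * \<beta>) * (q i $ 1 - \<i> * q i $ 2) + a
        = (?A *v q i + x) $ 1 + \<i> * (?A *v q i + x) $ 2"
        unfolding r by (simp add: algebra_simps i_times_i add_divide_distrib diff_divide_distrib)
      then show "p i $ 1 + \<i> * p i $ 2 = (?A *v q i + x) $ 1 + \<i> * (?A *v q i + x) $ 2"
        unfolding sab using pu(1)[OF i] by (simp add: UV uc_def vc_def)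
      have "(\<alpha> + \<i> * \<beta>) * (q i $ 1 + \<i> * q i $ 2) + b
        = (?A *v q i + x) $ 1 - \<i> * (?A *v q i + x) $ 2"
        unfolding r by (simp add: algebra_simps i_times_i add_divide_distrib diff_divide_distrib)
      then show "p i $ 1 - \<i> * p i $ 2 = (?A *v q i + x) $ 1 - \<i> * (?A *v q i + x) $ 2"
        unfolding sab using pu(2)[OF i] by (simp add: UV uc_def vc_def)
    qed
    ultimately show ?thesis by blast
  qed
  then show ?thesis unfolding congruence_def using pq by blast
qed

text \<open>A complex relation is evaluated at real configurations, where its real and imaginary
  parts are two real relations.\<close>

lemma alg_indep_complex:
  fixes \<kappa> :: "(nat set \<Rightarrow> nat) \<Rightarrow> complex"
  assumes ai: "alg_indep E" and \<Lambda>: "finite \<Lambda>" "\<Lambda> \<subseteq> (E \<rightarrow>\<^sub>E UNIV)" and \<eta>: "\<eta> \<in> \<Lambda>"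
    and zero: "\<And>p :: nat \<Rightarrow> complex ^ 2. (\<Sum>\<eta>\<in>\<Lambda>. \<kappa> \<eta> * mon E \<eta> (sqd p)) = 0"
  shows "\<kappa> \<eta> = 0"
proof -
  have real: "(\<Sum>\<eta>\<in>\<Lambda>. \<kappa> \<eta> * complex_of_real (mon E \<eta> (sqd p))) = 0" for p :: "nat \<Rightarrow> real ^ 2"
  proof -
    let ?p = "\<lambda>i. (\<chi> k. complex_of_real (p i $ k)) :: complex ^ 2"
    have "sqd ?p = (\<lambda>e. complex_of_real (sqd p e))" by (auto simp: sqd_def fun_eq_iff)
    then have "mon E \<eta> (sqd ?p) = complex_of_real (mon E \<eta> (sqd p))" for \<eta> by (simp add: mon_def)
    then show ?thesis using zero[of ?p] by simp
  qed
  have "Re (\<kappa> \<eta>) = 0"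
  proof (rule alg_indepD[OF ai \<Lambda> _ \<eta>])
    fix p :: "nat \<Rightarrow> real ^ 2"
    have "(\<Sum>\<eta>\<in>\<Lambda>. Re (\<kappa> \<eta>) * mon E \<eta> (sqd p)) = Re (\<Sum>\<eta>\<in>\<Lambda>. \<kappa> \<eta> * complex_of_real (mon E \<eta> (sqd p)))"
      by simp
    then show "(\<Sum>\<eta>\<in>\<Lambda>. Re (\<kappa> \<eta>) * mon E \<eta> (sqd p)) = 0" using real by simp
  qed
  moreover have "Im (\<kappa> \<eta>) = 0"
  proof (rule alg_indepD[OF ai \<Lambda> _ \<eta>])
    fix p :: "nat \<Rightarrow> real ^ 2"
    have "(\<Sum>\<eta>\<in>\<Lambda>. Im (\<kappa> \<eta>) * mon E \<eta> (sqd p)) = Im (\<Sum>\<eta>\<in>\<Lambda>. \<kappa> \<eta> * complex_of_real (mon E \<eta> (sqd p)))"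
      by simp
    then show "(\<Sum>\<eta>\<in>\<Lambda>. Im (\<kappa> \<eta>) * mon E \<eta> (sqd p)) = 0" using real by simp
  qed
  ultimately show ?thesis by (simp add: complex_eq_iff)
qed

lemma for_generic_measurement:
  fixes \<kappa> :: "(nat set \<Rightarrow> nat) \<Rightarrow> complex"
  assumes sg: "simple_graph n E" and ai: "alg_indep E" and \<Lambda>: "finite \<Lambda>" "\<Lambda> \<subseteq> (E \<rightarrow>\<^sub>E UNIV)" and \<eta>: "\<eta> \<in> \<Lambda>" "\<kappa> \<eta> \<noteq> 0"
  shows "for_generic n (\<lambda>p :: nat \<Rightarrow> complex ^ 2. (\<Sum>\<eta>\<in>\<Lambda>. \<kappa> \<eta> * mon E \<eta> (sqd p)) \<noteq> 0)"
proof -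
  obtain p :: "nat \<Rightarrow> complex ^ 2" where "(\<Sum>\<eta>\<in>\<Lambda>. \<kappa> \<eta> * mon E \<eta> (sqd p)) \<noteq> 0"
    using alg_indep_complex[OF ai \<Lambda> \<eta>(1), of \<kappa>] \<eta>(2) by blast
  moreover have "(\<lambda>p :: nat \<Rightarrow> complex ^ 2. \<Sum>\<eta>\<in>\<Lambda>. \<kappa> \<eta> * mon E \<eta> (sqd p)) \<in> poly_funs n"
    by (rule mon_sqd_poly_fun[OF sg order_refl])
  ultimately show ?thesis by (rule for_generic_nonzero[rotated])
qed

lemma for_generic_edges_nonzero:
  assumes sg: "simple_graph n E"
  shows "for_generic n (\<lambda>p :: nat \<Rightarrow> complex ^ 2. \<forall>e\<in>E. sqd p e \<noteq> 0)"
proof (rule for_generic_ball[OF simple_graph_finite[OF sg]])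
  fix e assume e: "e \<in> E"
  obtain a b where ab: "Min e = a" "Max e = b" "a < b" using simple_graphD[OF sg e] by metis
  show "for_generic n (\<lambda>p :: nat \<Rightarrow> complex ^ 2. sqd p e \<noteq> 0)"
    by (rule for_generic_nonzero[OF sqd_poly_fun[OF sg e], of "\<lambda>i. \<chi> k. if i = a then 1 else 0"])
       (use ab in \<open>simp add: sqd_def\<close>)
qed

section \<open>Measurements that are squares of differences\<close>

abbreviation mono_span :: "'i set \<Rightarrow> nat \<Rightarrow> (('i \<Rightarrow> complex) \<Rightarrow> complex) set" where
  "mono_span I d \<equiv> lspan (mon I ` expbox I d)"

lemma mono_span_mono: "d \<le> d' \<Longrightarrow> f \<in> mono_span I d \<Longrightarrow> f \<in> mono_span I d'"
  by (erule lspan_mono) (use expbox_mono[of d d' I] in \<open>auto intro: lspan_base\<close>)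

lemma mono_span_var:
  assumes "finite I" "i \<in> I" "f \<in> mono_span I d"
  shows "(\<lambda>v. f v * v i) \<in> mono_span I (Suc d)"
proof (rule lspan_trans[OF assms(3)])
  fix b :: "('a \<Rightarrow> complex) \<Rightarrow> complex" assume "b \<in> mon I ` expbox I d"
  then obtain \<alpha> where \<alpha>: "b = mon I \<alpha>" "\<alpha> \<in> expbox I d" by auto
  have "(\<lambda>v. b v * v i) = mon I (\<alpha>(i := Suc (\<alpha> i)))" unfolding \<alpha>(1) by (rule ext) (simp add: mon_Suc[OF assms(1,2)])
  moreover have "\<alpha>(i := Suc (\<alpha> i)) \<in> expbox I (Suc d)"
    using \<alpha>(2) assms(2) unfolding expbox_def by (auto simp: PiE_iff extensional_def le_SucI)
  ultimately show "(\<lambda>v. b v * v i) \<in> mono_span I (Suc d)" by (auto intro: lspan_base)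
qed

text \<open>Differences are invariant under translation, so \<open>u 1\<close> may be set to zero.
  That leaves \<open>n - 1\<close> variables, and this saving decides the count in
  \<open>for_generic_not_square\<close>.\<close>

lemma mono_span_edge:
  assumes sg: "simple_graph n E" and e: "e \<in> E" and f: "f \<in> mono_span {2..n} d"
  shows "(\<lambda>u. f u * edge_diff e (u(1 := 0))) \<in> mono_span {2..n} (Suc d)"
proof -
  have v: "(\<lambda>u. f u * (u(1 := 0)) i) \<in> mono_span {2..n} (Suc d)" if "i \<in> {1..n}" for i
  proof (cases "i = 1")
    case True then show ?thesis using lspan_zero by simp
  next
    case False
    then have "i \<in> {2..n}" using that by auto
    then show ?thesis using mono_span_var[OF _ _ f, of i] False by simp
  qed
  obtain a b where "a \<in> {1..n}" "b \<in> {1..n}" "Min e = a" "Max e = b" using simple_graphD[OF sg e] by metis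
  then have "(\<lambda>u. f u * (u(1 := 0)) (Min e) + (-1) * (f u * (u(1 := 0)) (Max e))) \<in> mono_span {2..n} (Suc d)"
    by (intro lspan_add lspan_scale v) auto
  then show ?thesis by (simp add: edge_diff_def right_diff_distrib)
qed

lemma mono_span_edge_power:
  assumes sg: "simple_graph n E" and e: "e \<in> E" and f: "f \<in> mono_span {2..n} d"
  shows "(\<lambda>u. f u * edge_diff e (u(1 := 0)) ^ m) \<in> mono_span {2..n} (d + m)"
proof (induction m)
  case (Suc m)
  have "(\<lambda>u. (f u * edge_diff e (u(1 := 0)) ^ m) * edge_diff e (u(1 := 0))) \<in> mono_span {2..n} (Suc (d + m))"
    by (rule mono_span_edge[OF sg e Suc])
  then show ?case by (simp only: power_Suc mult_ac add_Suc_right)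
qed (use f in simp)

lemma mono_span_edge_prod:
  assumes sg: "simple_graph n E" and F: "F \<subseteq> E"
  shows "(\<lambda>u. \<Prod>e\<in>F. edge_diff e (u(1 := 0)) ^ m e) \<in> mono_span {2..n} (sum m F)"
proof -
  have "finite F" using F simple_graph_finite[OF sg] by (rule finite_subset)
  then show ?thesis using F
  proof (induction F rule: finite_induct)
    case empty
    have "mon {2..n} (restrict (\<lambda>_. 0) {2..n}) = (\<lambda>u :: nat \<Rightarrow> complex. 1)"
      by (rule ext) (simp add: mon_def)
    moreover have "restrict (\<lambda>_. 0) {2..n} \<in> expbox {2..n} 0" unfolding expbox_def by (rule restrict_PiE_iff[THEN iffD2]) simp
    then have "mon {2..n} (restrict (\<lambda>_. 0) {2..n}) \<in> mono_span {2..n} 0" by (intro lspan_base imageI)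
    ultimately show ?case by simp
  next
    case (insert e F)
    have "(\<lambda>u. (\<Prod>e\<in>F. edge_diff e (u(1 := 0)) ^ m e) * edge_diff e (u(1 := 0)) ^ m e) \<in> mono_span {2..n} (sum m F + m e)"
      by (rule mono_span_edge_power[OF sg]) (use insert in blast)+
    then show ?case unfolding prod.insert[OF insert(1,2)] sum.insert[OF insert(1,2)]
      by (simp only: mult.commute add.commute)
  qed
qed

text \<open>Excludes realisations whose two isotropic coordinates have proportional differences. The
  squares are polynomials in \<open>n - 1\<close> variables and there are at least \<open>n\<close>
  of them, so counting monomials yields a relation; by algebraic independence generic measurements
  violate it.\<close>

lemma for_generic_not_square:
  assumes sg: "simple_graph n E" and ai: "alg_indep E" and n: "n \<ge> 1" and card: "n \<le> card E"
  shows "for_generic n (\<lambda>p :: nat \<Rightarrow> complex ^ 2. \<not> (\<exists>u. \<forall>e\<in>E. sqd p e = (edge_diff e u)\<^sup>2))"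
proof -
  have finE: "finite E" by (rule simple_graph_finite[OF sg])
  define m where "m = card E"
  \<comment> \<open>Chosen so that \<open>(2 * m * (D + 1)) ^ (n - 1)\<close>, which bounds the
    number of available monomials, equals \<open>D * (D + 1) ^ (n - 1)\<close> and thus stays below
    the number \<open>(D + 1) ^ m\<close> of exponent vectors.\<close>
  define D where "D = (2 * m) ^ (n - 1)"
  let ?I = "expbox {2..n} (2 * D * m)" and ?J = "expbox E D"
  define F where "F = (\<lambda>\<eta> (u :: nat \<Rightarrow> complex). mon E \<eta> (\<lambda>e. (edge_diff e (u(1 := 0)))\<^sup>2))"
  have "F \<eta> \<in> mono_span {2..n} (2 * D * m)" if \<eta>: "\<eta> \<in> ?J" for \<eta>
  proof -
    have "F \<eta> = (\<lambda>u. \<Prod>e\<in>E. edge_diff e (u(1 := 0)) ^ (2 * \<eta> e))" by (rule ext) (simp add: F_def mon_def power_mult)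
    moreover have "(\<Sum>e\<in>E. 2 * \<eta> e) \<le> of_nat (card E) * (2 * D)"
      by (rule sum_bounded_above) (use \<eta> in \<open>auto simp: expbox_def PiE_iff\<close>)
    then have "(\<Sum>e\<in>E. 2 * \<eta> e) \<le> 2 * D * m" by (simp add: m_def mult_ac)
    ultimately show ?thesis using mono_span_edge_prod[OF sg order_refl, of "\<lambda>e. 2 * \<eta> e"] mono_span_mono by metis
  qed
  moreover have "card ?I < card ?J"
  proof -
    have m1: "m \<ge> 1" using n card by (simp add: m_def)
    have "2 * D * m + 1 \<le> 2 * m * (D + 1)" using m1 by simp
    then have "(2 * D * m + 1) ^ (n - 1) \<le> (2 * m * (D + 1)) ^ (n - 1)" by (rule power_mono) simp
    also have "\<dots> = D * (D + 1) ^ (n - 1)"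
      unfolding power_mult_distrib[of "2 * m" "D + 1"] D_def[symmetric] ..
    also have "\<dots> < (D + 1) * (D + 1) ^ (n - 1)" by simp
    also have "\<dots> = (D + 1) ^ n" using n by (metis Suc_diff_1 less_le_trans power_Suc zero_less_one)
    also have "\<dots> \<le> (D + 1) ^ m" using card by (intro power_increasing) (auto simp: m_def)
    finally show ?thesis using expbox_card[OF finE, of D] expbox_card[of "{2..n}" "2 * D * m"] by (simp add: m_def)
  qed
  moreover have "finite ?I" "finite ?J" using expbox_card[OF finE, of D] expbox_card[of "{2..n}" "2 * D * m"] by auto
  ultimately have "\<exists>\<kappa>. (\<exists>\<eta>\<in>?J. \<kappa> \<eta> \<noteq> 0) \<and> (\<forall>x. (\<Sum>\<eta>\<in>?J. \<kappa> \<eta> * F \<eta> x) = 0)"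
    by (intro lspan_dependent)
  then obtain \<kappa> where \<kappa>0: "(\<exists>\<eta>\<in>?J. \<kappa> \<eta> \<noteq> 0) \<and> (\<forall>x. (\<Sum>\<eta>\<in>?J. \<kappa> \<eta> * F \<eta> x) = 0)" by (rule exE)
  then obtain \<eta> where \<eta>: "\<eta> \<in> ?J" "\<kappa> \<eta> \<noteq> 0" by blast
  have zero: "(\<Sum>\<eta>\<in>?J. \<kappa> \<eta> * F \<eta> u) = 0" for u using \<kappa>0 by blast
  have "?J \<subseteq> E \<rightarrow>\<^sub>E UNIV" unfolding expbox_def by (rule PiE_mono) simp
  from for_generic_measurement[where \<kappa> = \<kappa>, OF sg ai _ this \<eta>]
  have "for_generic n (\<lambda>p :: nat \<Rightarrow> complex ^ 2. (\<Sum>\<eta>\<in>?J. \<kappa> \<eta> * mon E \<eta> (sqd p)) \<noteq> 0)"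
    using expbox_card[OF finE, of D] by simp
  then show ?thesis
  proof (rule for_generic_mono)
    fix p :: "nat \<Rightarrow> complex ^ 2" assume p: "(\<Sum>\<eta>\<in>?J. \<kappa> \<eta> * mon E \<eta> (sqd p)) \<noteq> 0"
    show "\<not> (\<exists>u. \<forall>e\<in>E. sqd p e = (edge_diff e u)\<^sup>2)"
    proof
      assume "\<exists>u. \<forall>e\<in>E. sqd p e = (edge_diff e u)\<^sup>2"
      then obtain u where u: "\<forall>e\<in>E. sqd p e = (edge_diff e u)\<^sup>2" ..
      let ?u = "\<lambda>i. u i - u 1"
      have "?u(1 := 0) = ?u" by auto
      then have "edge_diff e (?u(1 := 0)) = edge_diff e u" for e by (simp add: edge_diff_def)
      then have "F \<eta> ?u = mon E \<eta> (sqd p)" for \<eta> unfolding F_def by (intro mon_cong) (use u in simp)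
      then show False using zero[of ?u] p by simp
    qed
  qed
qed

section \<open>Separating the points of a fibre\<close>

lemma measurement_eq_iff: "measurement E q = measurement E p \<longleftrightarrow> (\<forall>e\<in>E. sqd q e = sqd p e)"
  unfolding measurement_def sqd_def fun_eq_iff by (auto simp: restrict_def)

definition fibre :: "nat \<Rightarrow> nat set set \<Rightarrow> (nat \<Rightarrow> complex ^ 2) \<Rightarrow> (nat \<Rightarrow> complex ^ 2) set" where
  "fibre n E p = {q \<in> configs n. measurement E q = measurement E p}"

text \<open>At least \<open>k\<close> congruence classes, expressed through representatives. Unlike
  the quotient itself, this can be brought into a first-order form to which quantifier elimination
  applies.\<close>

definition many_realisations :: "nat \<Rightarrow> nat set set \<Rightarrow> nat \<Rightarrow> (nat \<Rightarrow> complex ^ 2) \<Rightarrow> bool" where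
  "many_realisations n E k p \<longleftrightarrow> (\<exists>Q \<subseteq> fibre n E p. finite Q \<and> card Q = k \<and>
     (\<forall>q\<in>Q. \<forall>q'\<in>Q. q \<noteq> q' \<longrightarrow> (q, q') \<notin> congruence n))"

definition par :: "(nat set \<Rightarrow> complex) \<Rightarrow> (nat set \<Rightarrow> complex) \<Rightarrow> bool \<times> nat set \<Rightarrow> complex" where
  "par l s = (\<lambda>(b, e). if b then l e else s e)"

lemma mon_par:
  assumes "finite E"
  shows "mon (UNIV \<times> E) \<eta> (par l s) = mon E (\<lambda>e. \<eta> (True, e)) l * mon E (\<lambda>e. \<eta> (False, e)) s"
proof -
  have "mon (UNIV \<times> E) \<eta> (par l s) = (\<Prod>b\<in>UNIV. \<Prod>e\<in>E. par l s (b, e) ^ \<eta> (b, e))"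
    unfolding mon_def by (simp add: prod.cartesian_product)
  then show ?thesis by (simp add: UNIV_bool mon_def par_def mult.commute)
qed

text \<open>A coefficient is a nonzero polynomial in measurements and auxiliary parameters jointly.
  Fixing the latter at a point where it does not vanish leaves a nontrivial polynomial in the
  measurements, to which algebraic independence applies.\<close>

lemma generic_coefficient:
  assumes sg: "simple_graph n E" and ai: "alg_indep E"
    and \<eta>: "\<eta> \<in> expbox (UNIV \<times> E) D" "\<kappa> \<eta> \<noteq> (0 :: complex)"
  obtains s where "for_generic n (\<lambda>p :: nat \<Rightarrow> complex ^ 2.
    (\<Sum>\<eta>\<in>expbox (UNIV \<times> E) D. \<kappa> \<eta> * mon (UNIV \<times> E) \<eta> (par (sqd p) s)) \<noteq> 0)"
proof -
  have finE: "finite E" by (rule simple_graph_finite[OF sg])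
  let ?V = "(UNIV :: bool set) \<times> E" and ?N = "expbox ((UNIV :: bool set) \<times> E) D"
  have finV: "finite ?V" using finE by simp
  have finN: "finite ?N" using expbox_card[OF finV] by blast
  have sub: "?N \<subseteq> ?V \<rightarrow>\<^sub>E UNIV" unfolding expbox_def by (rule PiE_mono) simp
  obtain w where w: "(\<Sum>\<eta>\<in>?N. \<kappa> \<eta> * mon ?V \<eta> w) \<noteq> 0"
    using mon_indep[OF finV finN sub _ \<eta>(1), of \<kappa>] \<eta>(2) by blast
  define s where "s = (\<lambda>e. w (False, e))"
  define top where "top = (\<lambda>\<eta> :: bool \<times> nat set \<Rightarrow> nat. \<lambda>e\<in>E. \<eta> (True, e))"
  \<comment> \<open>Terms that agree in the measurement exponents merge once \<open>s\<close> is
    fixed, so their coefficients are collected.\<close>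
  define \<kappa>' where "\<kappa>' = (\<lambda>\<zeta>. \<Sum>\<eta>\<in>{\<eta> \<in> ?N. top \<eta> = \<zeta>}. \<kappa> \<eta> * mon E (\<lambda>e. \<eta> (False, e)) s)"
  have mtop: "mon E (\<lambda>e. \<eta> (True, e)) l = mon E (top \<eta>) l" for \<eta> and l :: "nat set \<Rightarrow> complex"
    unfolding mon_def top_def by (rule prod.cong) auto
  have collect: "(\<Sum>\<eta>\<in>?N. \<kappa> \<eta> * mon ?V \<eta> (par l s)) = (\<Sum>\<zeta>\<in>top ` ?N. \<kappa>' \<zeta> * mon E \<zeta> l)" for l
  proof -
    have "(\<Sum>\<eta>\<in>?N. \<kappa> \<eta> * mon ?V \<eta> (par l s))
      = (\<Sum>\<zeta>\<in>top ` ?N. \<Sum>\<eta>\<in>{\<eta> \<in> ?N. top \<eta> = \<zeta>}. \<kappa> \<eta> * mon ?V \<eta> (par l s))"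
      by (rule sum.image_gen[OF finN])
    also have "\<dots> = (\<Sum>\<zeta>\<in>top ` ?N. \<kappa>' \<zeta> * mon E \<zeta> l)"
      unfolding \<kappa>'_def sum_distrib_right
      by (intro sum.cong refl) (auto simp: mon_par[OF finE] mtop)
    finally show ?thesis .
  qed
  have wp: "par (\<lambda>e. w (True, e)) s = w" unfolding par_def s_def by (auto simp: fun_eq_iff)
  have "(\<Sum>\<zeta>\<in>top ` ?N. \<kappa>' \<zeta> * mon E \<zeta> (\<lambda>e. w (True, e))) \<noteq> 0"
    using w unfolding collect[symmetric] wp .
  then obtain \<zeta> where \<zeta>: "\<zeta> \<in> top ` ?N" "\<kappa>' \<zeta> \<noteq> 0"
    by (rule sum.not_neutral_contains_not_neutral) simp
  have sub': "top ` ?N \<subseteq> E \<rightarrow>\<^sub>E UNIV" unfolding top_def by auto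
  have fin': "finite (top ` ?N)" using finN by simp
  have "for_generic n (\<lambda>p :: nat \<Rightarrow> complex ^ 2. (\<Sum>\<zeta>\<in>top ` ?N. \<kappa>' \<zeta> * mon E \<zeta> (sqd p)) \<noteq> 0)"
    by (rule for_generic_measurement[where \<kappa> = \<kappa>', OF sg ai fin' sub' \<zeta>])
  then show thesis by (intro that[of s]) (simp add: collect)
qed

text \<open>Each representative gives two points, hence \<open>2 * k\<close> roots of one polynomial
  of degree at most \<open>T\<close>. The auxiliary form is chosen such that the roots are distinct
  and the polynomial is not zero.\<close>

lemma fibre_bound:
  assumes sg: "simple_graph n E" and conn: "connected_graph n E" and n: "n \<ge> 3" and card: "2 * n - 3 \<le> card E"
    and ai: "alg_indep E" and ord: "inj_on ord E" and T: "T = card {A. nbc ord E A \<and> card A = n - 1}"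
    and many: "for_generic n (many_realisations n E k)"
  shows "2 * k \<le> T"
proof -
  have finE: "finite E" by (rule simple_graph_finite[OF sg])
  let ?V = "(UNIV :: bool set) \<times> E"
  obtain e0 D \<kappa> where e0: "e0 \<in> E" and \<kappa>: "\<exists>i\<le>T. \<exists>\<eta>\<in>expbox ?V D. \<kappa> i \<eta> \<noteq> (0 :: complex)"
    and rel: "\<And>u v s. nonvanishing E u \<Longrightarrow> (\<Sum>i\<le>T. (\<Sum>\<eta>\<in>expbox ?V D. \<kappa> i \<eta> *
        mon ?V \<eta> (\<lambda>(b, e). if b then edge_diff e u * edge_diff e v else s e)) *
        (\<Sum>e\<in>E. s e * (edge_diff e0 u / edge_diff e u)) ^ i) = 0"
  proof (rule fibre_relation[OF sg conn n card ord T])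
    fix e0 D \<kappa> assume a: "e0 \<in> E" "\<exists>i\<le>T. \<exists>\<eta>\<in>expbox ?V D. \<kappa> i \<eta> \<noteq> (0 :: complex)"
      "\<And>u v s. nonvanishing E u \<Longrightarrow> (\<Sum>i\<le>T. (\<Sum>\<eta>\<in>expbox ?V D. \<kappa> i \<eta> *
        mon ?V \<eta> (\<lambda>(b, e). if b then edge_diff e u * edge_diff e v else s e)) *
        (\<Sum>e\<in>E. s e * (edge_diff e0 u / edge_diff e u)) ^ i) = 0"
    show thesis by (rule that[OF a])
  qed
  obtain i0 \<eta>0 where i0: "i0 \<le> T" "\<eta>0 \<in> expbox ?V D" "\<kappa> i0 \<eta>0 \<noteq> 0" using \<kappa> by blast
  obtain s0 where s0: "for_generic n (\<lambda>p :: nat \<Rightarrow> complex ^ 2.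
    (\<Sum>\<eta>\<in>expbox ?V D. \<kappa> i0 \<eta> * mon ?V \<eta> (par (sqd p) s0)) \<noteq> 0)"
    by (rule generic_coefficient[where \<kappa> = "\<kappa> i0", OF sg ai i0(2,3)])
  have "n \<le> card E" using card n by simp
  note sq = for_generic_not_square[OF sg ai _ this]
  have "for_generic n (\<lambda>p. (many_realisations n E k p \<and> (\<Sum>\<eta>\<in>expbox ?V D. \<kappa> i0 \<eta> * mon ?V \<eta> (par (sqd p) s0)) \<noteq> 0)
      \<and> ((\<forall>e\<in>E. sqd p e \<noteq> 0) \<and> \<not> (\<exists>u. \<forall>e\<in>E. sqd p e = (edge_diff e u)\<^sup>2)))"
    using n by (intro for_generic_conj many s0 for_generic_edges_nonzero[OF sg] sq) simp
  then obtain p where p: "many_realisations n E k p" "(\<Sum>\<eta>\<in>expbox ?V D. \<kappa> i0 \<eta> * mon ?V \<eta> (par (sqd p) s0)) \<noteq> 0"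
    "\<forall>e\<in>E. sqd p e \<noteq> 0" "\<not> (\<exists>u. \<forall>e\<in>E. sqd p e = (edge_diff e u)\<^sup>2)"
    using for_generic_ex by blast
  obtain Q where Q: "Q \<subseteq> fibre n E p" "finite Q" "card Q = k"
    "\<And>q q'. q \<in> Q \<Longrightarrow> q' \<in> Q \<Longrightarrow> q \<noteq> q' \<Longrightarrow> (q, q') \<notin> congruence n"
    using p(1) unfolding many_realisations_def by blast
  have Qc: "q \<in> configs n" "e \<in> E \<Longrightarrow> sqd q e = sqd p e" if "q \<in> Q" for q e
    using Q(1) that unfolding fibre_def measurement_eq_iff by auto
  \<comment> \<open>The flag selects which isotropic coordinate enters the ratios; \<open>W\<close>
    is the other one, and the products of differences are the measurements either way.\<close>
  define U where "U = (\<lambda>(q, b). if b then uc q else vc q)"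
  define W where "W = (\<lambda>(q, b). if b then vc q else uc q)"
  have UW: "edge_diff e (U x) * edge_diff e (W x) = sqd p e" if "x \<in> Q \<times> UNIV" "e \<in> E" for x e
    using that Qc(2)[of "fst x" e] by (auto simp: U_def W_def sqd_factor mult.commute split: prod.splits)
  have nz: "edge_diff e (U x) \<noteq> 0" "edge_diff e (W x) \<noteq> 0" if "x \<in> Q \<times> UNIV" "e \<in> E" for x e
    using UW[OF that] p(3) that(2) by auto
  define \<zeta> where "\<zeta> = (\<lambda>x e. edge_diff e0 (U x) / edge_diff e (U x))"
  have distinct: "\<exists>e\<in>E. \<zeta> x e \<noteq> \<zeta> y e" if xy: "x \<in> Q \<times> UNIV" "y \<in> Q \<times> UNIV" "x \<noteq> y" for x y
  proof (rule ccontr)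
    assume "\<not> ?thesis"
    then have eq: "\<zeta> x e = \<zeta> y e" if "e \<in> E" for e using that by blast
    \<comment> \<open>As the products \<open>U * W\<close> agree, proportional \<open>U\<close> means proportional \<open>W\<close>.\<close>
    have eqW: "edge_diff e0 (W x) / edge_diff e (W x) = edge_diff e0 (W y) / edge_diff e (W y)" if e: "e \<in> E" for e
    proof -
      have "edge_diff e0 (W z) / edge_diff e (W z) = (sqd p e0 / sqd p e) / \<zeta> z e" if z: "z \<in> Q \<times> UNIV" for z
        using UW[OF z e] UW[OF z e0] nz[OF z e] nz[OF z e0] unfolding \<zeta>_def
        by (simp add: UW[OF z e, symmetric] UW[OF z e0, symmetric])
      then show ?thesis using xy eq[OF e] by simp
    qed
    obtain q b q' b' where xq: "x = (q, b)" "y = (q', b')" "q \<in> Q" "q' \<in> Q" using xy by (cases x; cases y) auto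
    have sqq: "sqd q e = sqd q' e" "sqd q e \<noteq> 0" if "e \<in> E" for e using Qc(2) xq that p(3) by auto
    show False
    proof (cases "q = q'")
      case False
      have "\<exists>U' V'. ((U', V') = (uc q', vc q') \<or> (U', V') = (vc q', uc q')) \<and>
        (\<forall>e\<in>E. edge_diff e0 (uc q) / edge_diff e (uc q) = edge_diff e0 U' / edge_diff e U')"
      proof (cases b)
        case True
        then show ?thesis using eq xq by (intro exI[of _ "U y"] exI[of _ "W y"]) (auto simp: \<zeta>_def U_def W_def)
      next
        case False
        then show ?thesis using eqW xq by (intro exI[of _ "W y"] exI[of _ "U y"]) (auto simp: U_def W_def)
      qed
      then obtain U' V' where "(U', V') = (uc q', vc q') \<or> (U', V') = (vc q', uc q')"
        "\<And>e. e \<in> E \<Longrightarrow> edge_diff e0 (uc q) / edge_diff e (uc q) = edge_diff e0 U' / edge_diff e U'" by blast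
      then have "(q, q') \<in> congruence n"
        using congruent_by_ratio[OF sg conn _ Qc(1)[OF xq(3)] Qc(1)[OF xq(4)] e0 sqq] n by simp
      then show False using Q(4) xq False by blast
    next
      case True
      then have "b \<noteq> b'" using xy(3) xq by simp
      then have uv: "edge_diff e0 (uc q) / edge_diff e (uc q) = edge_diff e0 (vc q) / edge_diff e (vc q)" if "e \<in> E" for e
        using eq[OF that] xq True by (cases b) (auto simp: \<zeta>_def U_def)
      have nzq: "edge_diff e (uc q) \<noteq> 0" "edge_diff e (vc q) \<noteq> 0" if "e \<in> E" for e
        using sqq(2)[OF that] sqd_factor[of q e] by auto
      \<comment> \<open>If the differences of \<open>vc q\<close> are \<open>c\<close> times those
        of \<open>uc q\<close>, a square root of \<open>c\<close> turns every measurement into a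
        square of a difference, which the choice of \<open>p\<close> excludes.\<close>
      define c where "c = edge_diff e0 (vc q) / edge_diff e0 (uc q)"
      define \<sigma> where "\<sigma> = csqrt c"
      have "sqd p e = (edge_diff e (\<lambda>i. \<sigma> * uc q i))\<^sup>2" if e: "e \<in> E" for e
      proof -
        have "edge_diff e (vc q) = c * edge_diff e (uc q)"
          using uv[OF e] nzq[OF e] nzq[OF e0] by (simp add: c_def field_simps)
        then have "sqd q e = c * (edge_diff e (uc q))\<^sup>2" by (simp add: sqd_factor power2_eq_square)
        also have "c = \<sigma>\<^sup>2" by (simp add: \<sigma>_def)
        finally show ?thesis using Qc(2)[OF xq(3) e] by (simp add: edge_diff_lin(2) power_mult_distrib)
      qed
      then show False using p(4) by blast
    qed
  qed
  define a where "a = (\<lambda>i s. \<Sum>\<eta>\<in>expbox ?V D. \<kappa> i \<eta> * mon ?V \<eta> (par (sqd p) s))"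
  have apoly: "a i0 \<in> polyfn"
  proof -
    have "(\<lambda>s. mon ?V \<eta> (\<lambda>j. (\<lambda>s. par (sqd p) s j) s)) \<in> polyfn" for \<eta>
    proof (rule polyfn_subst[OF polyfn_mon])
      fix j :: "bool \<times> nat set"
      show "(\<lambda>s. par (sqd p) s j) \<in> polyfn"
        unfolding par_def by (cases j; cases "fst j") (auto intro: polyfn_const polyfn_var)
    qed
    then show ?thesis unfolding a_def by (intro polyfn_sum polyfn_mult polyfn_const) simp
  qed
  let ?P = "{(x, y). x \<in> Q \<times> (UNIV :: bool set) \<and> y \<in> Q \<times> (UNIV :: bool set) \<and> x \<noteq> y}"
  \<comment> \<open>All requirements on \<open>s\<close> in one finite family of polynomials:
    \<open>None\<close> stands for the nonzero coefficient, \<open>Some (x, y)\<close> for the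
    separation of two points.\<close>
  define G where "G = (\<lambda>z. case z of None \<Rightarrow> a i0 | Some (x, y) \<Rightarrow> (\<lambda>s. \<Sum>e\<in>E. s e * (\<zeta> x e - \<zeta> y e)))"
  have finP: "finite ?P" by (rule finite_subset[of _ "(Q \<times> UNIV) \<times> (Q \<times> UNIV)"]) (use Q(2) in auto)
  obtain s where s: "\<And>z. z \<in> insert None (Some ` ?P) \<Longrightarrow> G z s \<noteq> 0"
  proof (rule polyfn_nonzero_all[of "insert None (Some ` ?P)" G])
    show "finite (insert None (Some ` ?P))" using finP by simp
    fix z assume z: "z \<in> insert None (Some ` ?P)"
    show "G z \<in> polyfn"
    proof (cases z)
      case None then show ?thesis using apoly by (simp add: G_def)
    next
      case (Some xy)
      then show ?thesis unfolding G_def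
        by (cases xy) (auto intro!: polyfn_sum polyfn_mult polyfn_const polyfn_var)
    qed
    show "\<exists>v. G z v \<noteq> 0"
    proof (cases z)
      case None then show ?thesis using p(2) by (auto simp: G_def a_def)
    next
      case (Some xy)
      then obtain x y where xy: "z = Some (x, y)" "x \<in> Q \<times> UNIV" "y \<in> Q \<times> UNIV" "x \<noteq> y" using z by auto
      obtain e where e: "e \<in> E" "\<zeta> x e \<noteq> \<zeta> y e" using distinct[OF xy(2-4)] by blast
      have "G z (\<lambda>f. if f = e then 1 else 0) = (\<Sum>f\<in>E. if f = e then \<zeta> x f - \<zeta> y f else 0)"
        unfolding G_def xy(1) by (auto intro!: sum.cong)
      also have "\<dots> = \<zeta> x e - \<zeta> y e" using finE e(1) by simp
      finally show ?thesis using e(2) by (intro exI[of _ "\<lambda>f. if f = e then 1 else 0"]) simp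
    qed
  qed blast
  define \<rho> where "\<rho> = (\<lambda>x. \<Sum>e\<in>E. s e * \<zeta> x e)"
  have inj: "inj_on \<rho> (Q \<times> (UNIV :: bool set))"
  proof (rule inj_onI, rule ccontr)
    fix x y assume xy: "x \<in> Q \<times> (UNIV :: bool set)" "y \<in> Q \<times> (UNIV :: bool set)" "\<rho> x = \<rho> y" "x \<noteq> y"
    have "G (Some (x, y)) s \<noteq> 0" by (rule s) (use xy in auto)
    moreover have "G (Some (x, y)) s = \<rho> x - \<rho> y" by (simp add: G_def \<rho>_def right_diff_distrib sum_subtractf)
    ultimately show False using xy(3) by simp
  qed
  define Pol where "Pol = (\<Sum>i\<le>T. monom (a i s) i)"
  have "coeff Pol i0 = a i0 s" unfolding Pol_def coeff_sum using i0(1) by (simp add: if_distrib cong: if_cong)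
  moreover have "a i0 s \<noteq> 0" using s[of None] by (simp add: G_def)
  ultimately have Pol0: "Pol \<noteq> 0" by auto
  have degP: "degree Pol \<le> T" unfolding Pol_def
  proof (rule degree_sum_le)
    fix i assume "i \<in> {..T}"
    then show "degree (monom (a i s) i) \<le> T" using degree_monom_le[of "a i s" i] by simp
  qed simp
  have root: "poly Pol (\<rho> x) = 0" if x: "x \<in> Q \<times> UNIV" for x
  proof -
    have "nonvanishing E (U x)" unfolding nonvanishing_def using nz(1)[OF x] by blast
    from rel[OF this, of "W x" s]
    have r: "(\<Sum>i\<le>T. (\<Sum>\<eta>\<in>expbox ?V D. \<kappa> i \<eta> *
        mon ?V \<eta> (\<lambda>(b, e). if b then edge_diff e (U x) * edge_diff e (W x) else s e)) * \<rho> x ^ i) = 0"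
      unfolding \<rho>_def \<zeta>_def .
    have "mon ?V \<eta> (\<lambda>(b, e). if b then edge_diff e (U x) * edge_diff e (W x) else s e) = mon ?V \<eta> (par (sqd p) s)" for \<eta>
      by (rule mon_cong) (use UW[OF x] in \<open>auto simp: par_def\<close>)
    then show ?thesis using r unfolding Pol_def a_def by (simp add: poly_sum poly_monom)
  qed
  have "2 * k = card (Q \<times> (UNIV :: bool set))" using Q(3) by (simp add: card_cartesian_product)
  also have "\<dots> = card (\<rho> ` (Q \<times> UNIV))" by (rule card_image[OF inj, symmetric])
  also have "\<dots> \<le> card {x. poly Pol x = 0}"
    by (rule card_mono[OF poly_roots_finite[OF Pol0]]) (use root in auto)
  also have "\<dots> \<le> degree Pol" by (rule card_poly_roots_bound[OF Pol0])
  finally show ?thesis using degP by simp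
qed

section \<open>Quantifier elimination over the complex numbers\<close>

inductive_set constructible :: "(('i \<Rightarrow> complex) \<Rightarrow> bool) set" where
  constructible_zero: "f \<in> polyfn \<Longrightarrow> (\<lambda>v. f v = 0) \<in> constructible"
| constructible_not: "\<phi> \<in> constructible \<Longrightarrow> (\<lambda>v. \<not> \<phi> v) \<in> constructible"
| constructible_and: "\<phi> \<in> constructible \<Longrightarrow> \<psi> \<in> constructible \<Longrightarrow> (\<lambda>v. \<phi> v \<and> \<psi> v) \<in> constructible"

lemma constructible_cong: "\<phi> \<in> constructible \<Longrightarrow> (\<And>v. \<psi> v \<longleftrightarrow> \<phi> v) \<Longrightarrow> \<psi> \<in> constructible"
  by presburger

lemma constructible_or: "\<phi> \<in> constructible \<Longrightarrow> \<psi> \<in> constructible \<Longrightarrow> (\<lambda>v. \<phi> v \<or> \<psi> v) \<in> constructible"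
  using constructible_not[OF constructible_and[OF constructible_not[of \<phi>] constructible_not[of \<psi>]]] by simp

lemma constructible_const: "(\<lambda>v. b) \<in> constructible"
proof (cases b)
  case True
  then show ?thesis using constructible_zero[OF polyfn_const[of 0]] by simp
next
  case False
  then show ?thesis using constructible_zero[OF polyfn_const[of 1]] by simp
qed

lemma constructible_eq: "f \<in> polyfn \<Longrightarrow> g \<in> polyfn \<Longrightarrow> (\<lambda>v. f v = g v) \<in> constructible"
  using constructible_zero[OF polyfn_minus[of f g]] by simp

lemma constructible_ball:
  "finite B \<Longrightarrow> (\<And>b. b \<in> B \<Longrightarrow> \<phi> b \<in> constructible) \<Longrightarrow> (\<lambda>v. \<forall>b\<in>B. \<phi> b v) \<in> constructible"
  by (induction B rule: finite_induct) (auto intro: constructible_const constructible_and)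

lemma constructible_bex:
  "finite B \<Longrightarrow> (\<And>b. b \<in> B \<Longrightarrow> \<phi> b \<in> constructible) \<Longrightarrow> (\<lambda>v. \<exists>b\<in>B. \<phi> b v) \<in> constructible"
  by (induction B rule: finite_induct) (auto intro: constructible_const constructible_or)

text \<open>A polynomial with polynomial functions as coefficients, kept as a list so that its
  formal degree does not depend on \<open>v\<close>. The actual degree drops where the last
  coefficient vanishes, which is the source of the case distinctions below.\<close>

definition ev :: "(('i \<Rightarrow> complex) \<Rightarrow> complex) list \<Rightarrow> ('i \<Rightarrow> complex) \<Rightarrow> complex poly" where
  "ev cs v = Poly (map (\<lambda>c. c v) cs)"

lemma coeff_ev: "coeff (ev cs v) j = (if j < length cs then (cs ! j) v else 0)"
  unfolding ev_def coeff_Poly_eq nth_default_def by simp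

lemma ev_eq_0_iff: "ev cs v = 0 \<longleftrightarrow> (\<forall>c\<in>set cs. c v = 0)"
  unfolding poly_eq_iff coeff_ev by (auto simp: all_set_conv_all_nth)

lemma ev_snoc_zero: "l v = 0 \<Longrightarrow> ev (ps @ [l]) v = ev ps v"
  unfolding poly_eq_iff coeff_ev by (auto simp: nth_append)

lemma degree_ev_snoc: "l v \<noteq> 0 \<Longrightarrow> degree (ev (ps @ [l]) v) = length ps"
proof -
  assume "l v \<noteq> 0"
  then have "coeff (ev (ps @ [l]) v) (length ps) \<noteq> 0" by (simp add: coeff_ev)
  moreover have "degree (ev (ps @ [l]) v) \<le> length ps" by (rule degree_le) (simp add: coeff_ev)
  ultimately show ?thesis using le_degree le_antisym by blast
qed

text \<open>One step of pseudo-division: the leading terms of the longer list are cancelled.\<close>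

definition reduce where
  "reduce ps l rs r = map (\<lambda>j v. l v * (rs ! j) v - r v * (if length rs - length ps \<le> j
     then (ps ! (j - (length rs - length ps))) v else 0)) [0..<length rs]"

lemma ev_reduce:
  assumes "length ps \<le> length rs"
  shows "ev (reduce ps l rs r) v = smult (l v) (ev (rs @ [r]) v)
    - smult (r v) (monom 1 (length rs - length ps) * ev (ps @ [l]) v)"
proof (rule poly_eqI)
  fix j
  show "coeff (ev (reduce ps l rs r) v) j = coeff (smult (l v) (ev (rs @ [r]) v)
    - smult (r v) (monom 1 (length rs - length ps) * ev (ps @ [l]) v)) j"
  proof (cases "j < length rs")
    case True
    then show ?thesis using assms
      by (auto simp: coeff_ev reduce_def coeff_monom_mult nth_append)
  next
    case False
    then have "length rs - length ps \<le> j" by simp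
    then show ?thesis using assms False
      by (cases "j = length rs") (auto simp: coeff_ev reduce_def coeff_monom_mult nth_append)
  qed
qed

lemma reduce_polyfn:
  assumes "set ps \<subseteq> polyfn" "l \<in> polyfn" "set rs \<subseteq> polyfn" "r \<in> polyfn" "length ps \<le> length rs"
  shows "set (reduce ps l rs r) \<subseteq> polyfn"
proof
  fix f assume "f \<in> set (reduce ps l rs r)"
  then obtain j where j: "j < length rs" "f = (\<lambda>v. l v * (rs ! j) v - r v * (if length rs - length ps \<le> j
     then (ps ! (j - (length rs - length ps))) v else 0))" unfolding reduce_def by auto
  have "rs ! j \<in> polyfn" using assms(3) j(1) nth_mem by blast
  moreover have "(\<lambda>v. if length rs - length ps \<le> j then (ps ! (j - (length rs - length ps))) v else 0) \<in> polyfn"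
  proof (cases "length rs - length ps \<le> j")
    case True
    then have "j - (length rs - length ps) < length ps" using j(1) assms(5) by simp
    then have "ps ! (j - (length rs - length ps)) \<in> polyfn" using assms(1) nth_mem by blast
    then show ?thesis using True by simp
  qed (simp add: polyfn_const)
  ultimately show "f \<in> polyfn" unfolding j(2) by (intro polyfn_minus polyfn_mult assms)
qed

text \<open>Where \<open>l\<close> does not vanish the divisor has degree \<open>length ps\<close>,
  so a dividend with at most that many coefficients is divisible only if it is zero. A longer one is
  shortened by \<open>reduce\<close>, which preserves divisibility because \<open>l v\<close> is a
  unit.\<close>

lemma constructible_dvd:
  assumes ps: "set ps \<subseteq> polyfn" "l \<in> polyfn"
  shows "set R \<subseteq> polyfn \<Longrightarrow> (\<lambda>v. l v \<noteq> 0 \<and> ev (ps @ [l]) v dvd ev R v) \<in> constructible"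
proof (induction R rule: length_induct)
  case (1 R)
  have lc: "(\<lambda>v. l v \<noteq> 0) \<in> constructible" by (intro constructible_not constructible_zero ps)
  show ?case
  proof (cases "length R \<le> length ps")
    case True
    have iff: "(l v \<noteq> 0 \<and> ev (ps @ [l]) v dvd ev R v) \<longleftrightarrow> (l v \<noteq> 0 \<and> (\<forall>c\<in>set R. c v = 0))" for v
    proof -
      have "ev R v = 0" if "l v \<noteq> 0" "ev (ps @ [l]) v dvd ev R v"
      proof (rule ccontr)
        assume nz: "ev R v \<noteq> 0"
        then have "length ps \<le> degree (ev R v)" using dvd_imp_degree_le[OF that(2)] degree_ev_snoc[where l = l and v = v, OF that(1)] by metis
        moreover have "coeff (ev R v) (degree (ev R v)) \<noteq> 0" using nz by simp
        then have "degree (ev R v) < length R" unfolding coeff_ev by (simp split: if_splits)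
        ultimately show False using True by simp
      qed
      then show ?thesis using ev_eq_0_iff[of R v] by auto
    qed
    have "(\<lambda>v. l v \<noteq> 0 \<and> (\<forall>c\<in>set R. c v = 0)) \<in> constructible"
      by (intro constructible_and lc constructible_ball constructible_zero) (use 1(2) in auto)
    then show ?thesis by (rule constructible_cong) (rule iff)
  next
    case False
    then obtain rs r where R: "R = rs @ [r]" by (cases R rule: rev_cases) auto
    have len: "length ps \<le> length rs" using False R by simp
    have mem: "set rs \<subseteq> polyfn" "r \<in> polyfn" using 1(2) R by auto
    have "length (reduce ps l rs r) < length R" by (simp add: reduce_def R)
    then have red: "(\<lambda>v. l v \<noteq> 0 \<and> ev (ps @ [l]) v dvd ev (reduce ps l rs r) v) \<in> constructible"
      using 1(1) reduce_polyfn[OF ps mem len] by blast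
    have iff: "ev (ps @ [l]) v dvd ev (reduce ps l rs r) v \<longleftrightarrow> ev (ps @ [l]) v dvd ev R v" if "l v \<noteq> 0" for v
    proof -
      have "ev (ps @ [l]) v dvd smult (r v) (monom 1 (length rs - length ps) * ev (ps @ [l]) v)"
        by (simp add: dvd_smult)
      then have "ev (ps @ [l]) v dvd ev (reduce ps l rs r) v \<longleftrightarrow> ev (ps @ [l]) v dvd smult (l v) (ev (rs @ [r]) v)"
        unfolding ev_reduce[OF len] by (rule dvd_diff_left_iff)
      then show ?thesis using that R by (simp add: dvd_smult_iff)
    qed
    show ?thesis using red by (rule constructible_cong) (use iff in blast)
  qed
qed

text \<open>A description of such polynomials that is visibly closed under ring operations;
  \<open>poly_family_list\<close> converts it back to coefficient lists.\<close>

definition poly_family :: "(('i \<Rightarrow> complex) \<Rightarrow> complex poly) \<Rightarrow> bool" where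
  "poly_family F \<longleftrightarrow> (\<exists>N. \<forall>v. degree (F v) \<le> N) \<and> (\<forall>j. (\<lambda>v. coeff (F v) j) \<in> polyfn)"

lemma poly_family_list:
  assumes "poly_family F"
  obtains cs where "set cs \<subseteq> polyfn" "\<And>v. ev cs v = F v"
proof -
  obtain N where N: "\<And>v. degree (F v) \<le> N" using assms unfolding poly_family_def by auto
  show thesis
  proof (rule that[of "map (\<lambda>j v. coeff (F v) j) [0..<Suc N]"])
    show "set (map (\<lambda>j v. coeff (F v) j) [0..<Suc N]) \<subseteq> polyfn" using assms unfolding poly_family_def by auto
    fix v
    have "coeff (F v) j = 0" if "j \<ge> Suc N" for j using N[of v] that by (intro coeff_eq_0) simp
    then show "ev (map (\<lambda>j v. coeff (F v) j) [0..<Suc N]) v = F v"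
      by (intro poly_eqI) (auto simp: coeff_ev nth_append simp del: upt_Suc)
  qed
qed

lemma poly_family_ev: "set cs \<subseteq> polyfn \<Longrightarrow> poly_family (ev cs)"
  unfolding poly_family_def
proof
  assume cs: "set cs \<subseteq> polyfn"
  show "\<exists>N. \<forall>v. degree (ev cs v) \<le> N" by (intro exI[of _ "length cs"] allI degree_le) (simp add: coeff_ev)
  show "\<forall>j. (\<lambda>v. coeff (ev cs v) j) \<in> polyfn"
  proof
    fix j show "(\<lambda>v. coeff (ev cs v) j) \<in> polyfn"
      by (cases "j < length cs") (use cs nth_mem[of j cs] in \<open>auto simp: coeff_ev intro: polyfn_const\<close>)
  qed
qed

lemma poly_family_add:
  assumes "poly_family F" "poly_family G" shows "poly_family (\<lambda>v. F v + G v)"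
proof -
  obtain N M where "\<And>v. degree (F v) \<le> N" "\<And>v. degree (G v) \<le> M" using assms unfolding poly_family_def by auto
  then have "degree (F v + G v) \<le> max N M" for v by (meson degree_add_le max.coboundedI1 max.coboundedI2)
  then show ?thesis using assms unfolding poly_family_def by (auto intro: polyfn_add)
qed

lemma poly_family_mult:
  assumes "poly_family F" "poly_family G" shows "poly_family (\<lambda>v. F v * G v)"
proof -
  obtain N M where "\<And>v. degree (F v) \<le> N" "\<And>v. degree (G v) \<le> M" using assms unfolding poly_family_def by auto
  then have "degree (F v * G v) \<le> N + M" for v by (meson degree_mult_le add_mono order_trans)
  then show ?thesis using assms unfolding poly_family_def coeff_mult by (auto intro!: polyfn_sum polyfn_mult)
qed

lemma poly_family_const: "f \<in> polyfn \<Longrightarrow> poly_family (\<lambda>v. [:f v:])"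
  unfolding poly_family_def
proof (intro conjI exI allI)
  fix j assume "f \<in> polyfn"
  then show "(\<lambda>v. coeff [:f v:] j) \<in> polyfn" by (cases j) (auto intro: polyfn_const)
qed simp

lemma poly_family_power: "poly_family F \<Longrightarrow> poly_family (\<lambda>v. F v ^ k)"
proof (induction k)
  case 0 show ?case using poly_family_const[OF polyfn_const[of 1]] by (simp add: one_pCons)
next
  case (Suc k) then show ?case by (simp add: poly_family_mult)
qed

lemma polyfn_restrict_var:
  assumes "f \<in> polyfn"
  shows "\<exists>F. poly_family F \<and> (\<forall>v x. f (v(i := x)) = poly (F v) x)"
  using assms
proof (induction rule: polyfn.induct)
  case (polyfn_const c)
  show ?case by (intro exI[of _ "\<lambda>v. [:c:]"]) (auto intro: poly_family_const polyfn.intros)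
next
  case (polyfn_var j)
  show ?case
  proof (cases "j = i")
    case True
    have "poly_family (\<lambda>v. [:0, 1:])" unfolding poly_family_def by (auto intro: polyfn.intros)
    then show ?thesis using True by (intro exI[of _ "\<lambda>v. [:0, 1:]"]) simp
  next
    case False
    then show ?thesis by (intro exI[of _ "\<lambda>v. [:v j:]"]) (auto intro: poly_family_const polyfn.intros)
  qed
next
  case (polyfn_add f g)
  then obtain F G where "poly_family F" "\<forall>v x. f (v(i := x)) = poly (F v) x"
    "poly_family G" "\<forall>v x. g (v(i := x)) = poly (G v) x" by blast
  then show ?case by (intro exI[of _ "\<lambda>v. F v + G v"] conjI poly_family_add allI) (simp_all only: poly_add)
next
  case (polyfn_mult f g)
  then obtain F G where "poly_family F" "\<forall>v x. f (v(i := x)) = poly (F v) x"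
    "poly_family G" "\<forall>v x. g (v(i := x)) = poly (G v) x" by blast
  then show ?case by (intro exI[of _ "\<lambda>v. F v * G v"] conjI poly_family_mult allI) (simp_all only: poly_mult)
qed

abbreviation solvable where
  "solvable Ps Q v \<equiv> \<exists>x. (\<forall>P\<in>set Ps. poly (ev P v) x = 0) \<and> poly (ev Q v) x \<noteq> 0"

text \<open>By the univariate Nullstellensatz, all roots of a polynomial are roots of
  \<open>Q\<close> exactly if it divides the power of \<open>Q\<close> whose exponent is its degree.
  This degree is \<open>length ps\<close> as long as \<open>l\<close> does not vanish.\<close>

lemma solvable_single:
  assumes ps: "set ps \<subseteq> polyfn" "l \<in> polyfn" and Q: "set Q \<subseteq> polyfn"
  shows "(\<lambda>v. l v \<noteq> 0 \<and> solvable [ps @ [l]] Q v) \<in> constructible"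
proof -
  obtain R where R: "set R \<subseteq> polyfn" "\<And>v. ev R v = ev Q v ^ length ps"
    using poly_family_list[OF poly_family_power[OF poly_family_ev[OF Q]]] by metis
  have iff: "l v \<noteq> 0 \<and> solvable [ps @ [l]] Q v \<longleftrightarrow> l v \<noteq> 0 \<and> \<not> (l v \<noteq> 0 \<and> ev (ps @ [l]) v dvd ev R v)" for v
  proof -
    have "solvable [ps @ [l]] Q v \<longleftrightarrow> \<not> ev (ps @ [l]) v dvd ev R v" if l: "l v \<noteq> 0"
    proof -
      have "ev (ps @ [l]) v \<noteq> 0" using l by (auto simp: ev_eq_0_iff)
      then have "(\<forall>x. poly (ev (ps @ [l]) v) x = 0 \<longrightarrow> poly (ev Q v) x = 0) \<longleftrightarrow> ev (ps @ [l]) v dvd ev R v"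
        using nullstellensatz_univariate[of "ev (ps @ [l]) v" "ev Q v"] degree_ev_snoc[where l = l and v = v, OF l] R(2) by simp
      then show ?thesis by auto
    qed
    then show ?thesis by auto
  qed
  have "(\<lambda>v. l v \<noteq> 0 \<and> \<not> (l v \<noteq> 0 \<and> ev (ps @ [l]) v dvd ev R v)) \<in> constructible"
    using constructible_and[OF constructible_not[OF constructible_zero[OF ps(2)]] constructible_not[OF constructible_dvd[OF ps R(1)]]] .
  then show ?thesis by (rule constructible_cong) (rule iff)
qed

text \<open>Euclid's algorithm on the system: either a leading coefficient vanishes and is dropped,
  or the shorter polynomial reduces the longer one without changing the common zeros, until at most
  one equation is left.\<close>

lemma solvable_constructible:
  assumes Q: "set Q \<subseteq> polyfn"
  shows "(\<And>P. P \<in> set Ps \<Longrightarrow> set P \<subseteq> polyfn) \<Longrightarrow> solvable Ps Q \<in> constructible"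
\<comment> \<open>The \<open>Suc\<close> makes the removal of an empty list, which denotes the zero
  polynomial, count as progress.\<close>
proof (induction "sum_list (map (\<lambda>P. Suc (length P)) Ps)" arbitrary: Ps rule: less_induct)
  case less
  have IH: "solvable Ps' Q \<in> constructible"
    if "sum_list (map (\<lambda>P. Suc (length P)) Ps') < sum_list (map (\<lambda>P. Suc (length P)) Ps)"
       "\<And>P. P \<in> set Ps' \<Longrightarrow> set P \<subseteq> polyfn" for Ps'
    using less(1)[OF that] .
  have split_case: "solvable (P # rest) Q \<in> constructible"
    if P: "P = ps @ [l]" "set P \<subseteq> polyfn" and c: "solvable (ps # rest) Q \<in> constructible"
      "(\<lambda>v. l v \<noteq> 0 \<and> solvable (P # rest) Q v) \<in> constructible" for P ps l rest
  proof -
    have l: "l \<in> polyfn" using P by auto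
    have iff: "solvable (P # rest) Q v \<longleftrightarrow> (l v = 0 \<and> solvable (ps # rest) Q v) \<or> (l v \<noteq> 0 \<and> solvable (P # rest) Q v)" for v
      by (cases "l v = 0") (simp_all add: P(1) ev_snoc_zero)
    have "(\<lambda>v. (l v = 0 \<and> solvable (ps # rest) Q v) \<or> (l v \<noteq> 0 \<and> solvable (P # rest) Q v)) \<in> constructible"
      by (intro constructible_or constructible_and constructible_zero l c)
    then show ?thesis by (rule constructible_cong) (rule iff)
  qed
  show ?case
  proof (cases "[] \<in> set Ps")
    case True
    then obtain xs ys where Ps: "Ps = xs @ [] # ys" by (meson split_list)
    have [simp]: "ev [] v = 0" for v by (simp add: ev_def)
    have "solvable Ps Q = solvable (xs @ ys) Q" unfolding Ps by (intro ext) auto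
    moreover have "solvable (xs @ ys) Q \<in> constructible" by (rule IH) (use less(2) in \<open>auto simp: Ps\<close>)
    ultimately show ?thesis by simp
  next
    case ne: False
    consider "Ps = []" | P where "Ps = [P]" | A B rest where "Ps = A # B # rest" by (metis list.exhaust)
    then show ?thesis
    proof cases
      case 1
      have iff: "solvable Ps Q v \<longleftrightarrow> (\<exists>c\<in>set Q. c v \<noteq> 0)" for v
      proof -
        have "(\<exists>x. poly (ev Q v) x \<noteq> 0) \<longleftrightarrow> ev Q v \<noteq> 0" using poly_all_0_iff_0 by blast
        then show ?thesis unfolding 1 using ev_eq_0_iff[of Q v] by auto
      qed
      have "(\<lambda>v. \<exists>c\<in>set Q. c v \<noteq> 0) \<in> constructible"
        by (intro constructible_bex constructible_not constructible_zero) (use Q in auto)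
      then show ?thesis by (rule constructible_cong) (rule iff)
    next
      case 2
      then obtain ps l where P: "P = ps @ [l]" using ne by (cases P rule: rev_cases) auto
      have mem: "set ps \<subseteq> polyfn" "l \<in> polyfn" "set P \<subseteq> polyfn" using less(2)[of P] 2 P by auto
      have "solvable [ps] Q \<in> constructible" by (rule IH) (use mem 2 P in auto)
      moreover have "(\<lambda>v. l v \<noteq> 0 \<and> solvable [P] Q v) \<in> constructible"
        using solvable_single[OF mem(1,2) Q] unfolding P .
      ultimately show ?thesis using split_case[OF P mem(3), of "[]"] unfolding 2 by blast
    next
      case 3
      have ordered: "solvable (B # A # rest) Q \<in> constructible"
        if len: "length B \<le> length A" and tot: "sum_list (map (\<lambda>P. Suc (length P)) (B # A # rest)) = sum_list (map (\<lambda>P. Suc (length P)) Ps)"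
          and s: "set (B # A # rest) = set Ps" for A B
      proof -
        have "B \<noteq> []" "A \<noteq> []" using ne s by auto
        then obtain ps l rs r where BA: "B = ps @ [l]" "A = rs @ [r]" by (metis rev_exhaust)
        have mem: "set ps \<subseteq> polyfn" "l \<in> polyfn" "set rs \<subseteq> polyfn" "r \<in> polyfn" "set B \<subseteq> polyfn"
          "\<And>P. P \<in> set rest \<Longrightarrow> set P \<subseteq> polyfn" "set A \<subseteq> polyfn"
          using less(2)[of A] less(2)[of B] less(2) s BA by auto
        have len': "length ps \<le> length rs" using len BA by simp
        have c1: "solvable (ps # A # rest) Q \<in> constructible"
          by (rule IH) (use tot BA mem in auto)
        have c2: "solvable (B # reduce ps l rs r # rest) Q \<in> constructible"
          by (rule IH) (use tot BA mem reduce_polyfn[OF mem(1-4) len'] in \<open>auto simp: reduce_def\<close>)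
        have iff: "l v \<noteq> 0 \<and> solvable (B # A # rest) Q v \<longleftrightarrow> l v \<noteq> 0 \<and> solvable (B # reduce ps l rs r # rest) Q v" for v
        proof -
          have "poly (ev (reduce ps l rs r) v) x = l v * poly (ev A v) x" if "poly (ev B v) x = 0" for x
            unfolding ev_reduce[OF len'] BA(2) using that BA(1) by simp
          then show ?thesis by auto
        qed
        have "(\<lambda>v. l v \<noteq> 0 \<and> solvable (B # A # rest) Q v) \<in> constructible"
          using constructible_and[OF constructible_not[OF constructible_zero[OF mem(2)]] c2]
          by (rule constructible_cong) (rule iff)
        then show ?thesis by (rule split_case[OF BA(1) mem(5) c1])
      qed
      show ?thesis
      proof (cases "length B \<le> length A")
        case True
        have "solvable (B # A # rest) Q \<in> constructible" by (rule ordered[OF True]) (auto simp: 3)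
        moreover have "solvable (B # A # rest) Q = solvable Ps Q" unfolding 3 by auto
        ultimately show ?thesis by simp
      next
        case False
        have "solvable (A # B # rest) Q \<in> constructible" by (rule ordered) (use False in \<open>auto simp: 3\<close>)
        then show ?thesis unfolding 3 .
      qed
    qed
  qed
qed

text \<open>A single inequation is enough, since several can be multiplied together.\<close>

abbreviation basic_set where
  "basic_set Fg v \<equiv> (\<forall>f\<in>set (fst Fg). f v = 0) \<and> snd Fg v \<noteq> 0"

abbreviation wf_basic where
  "wf_basic L \<equiv> \<forall>Fg\<in>set L. set (fst Fg) \<subseteq> polyfn \<and> snd Fg \<in> polyfn"

lemma normal_form_and:
  fixes L K :: "((('i \<Rightarrow> complex) \<Rightarrow> complex) list \<times> (('i \<Rightarrow> complex) \<Rightarrow> complex)) list"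
  assumes "wf_basic L" "wf_basic K"
  shows "\<exists>M. wf_basic M \<and> (\<forall>v. (\<exists>Fg\<in>set M. basic_set Fg v) \<longleftrightarrow> (\<exists>Fg\<in>set L. basic_set Fg v) \<and> (\<exists>Fg\<in>set K. basic_set Fg v))"
proof -
  define pr where "pr = (\<lambda>a b :: (('i \<Rightarrow> complex) \<Rightarrow> complex) list \<times> (('i \<Rightarrow> complex) \<Rightarrow> complex).
    (fst a @ fst b, \<lambda>v. snd a v * snd b v))"
  let ?M = "[pr a b. a \<leftarrow> L, b \<leftarrow> K]"
  have M: "set ?M = (\<Union>a\<in>set L. pr a ` set K)" by auto
  have "wf_basic ?M" using assms unfolding M pr_def by (auto intro!: polyfn_mult)
  moreover have pr: "basic_set (pr a b) v \<longleftrightarrow> basic_set a v \<and> basic_set b v" for a b v unfolding pr_def by auto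
  have "(\<exists>Fg\<in>set ?M. basic_set Fg v) \<longleftrightarrow> (\<exists>a\<in>set L. \<exists>b\<in>set K. basic_set (pr a b) v)" for v
    unfolding M by blast
  then have "(\<exists>Fg\<in>set ?M. basic_set Fg v) \<longleftrightarrow> (\<exists>Fg\<in>set L. basic_set Fg v) \<and> (\<exists>Fg\<in>set K. basic_set Fg v)" for v
    unfolding pr by blast
  ultimately show ?thesis by (intro exI[of _ ?M] conjI allI)
qed

lemma normal_form_not:
  fixes L :: "((('i \<Rightarrow> complex) \<Rightarrow> complex) list \<times> (('i \<Rightarrow> complex) \<Rightarrow> complex)) list"
  shows "wf_basic L \<Longrightarrow> \<exists>M. wf_basic M \<and> (\<forall>v. (\<exists>Fg\<in>set M. basic_set Fg v) \<longleftrightarrow> \<not> (\<exists>Fg\<in>set L. basic_set Fg v))"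
proof (induction L)
  case Nil
  show ?case by (intro exI[of _ "[([], \<lambda>v. 1)]"]) (auto intro: polyfn_const)
next
  case (Cons a L)
  then obtain M where M: "wf_basic M" "\<forall>v. (\<exists>Fg\<in>set M. basic_set Fg v) \<longleftrightarrow> \<not> (\<exists>Fg\<in>set L. basic_set Fg v)" by auto
  \<comment> \<open>The complement of one basic set: its inequation fails, or one of its equations
    does.\<close>
  let ?K = "([snd a], \<lambda>v. 1) # map (\<lambda>f. ([], f)) (fst a)"
  have K: "wf_basic ?K" using Cons(2) by (auto intro: polyfn_const)
  obtain N where N: "wf_basic N" "\<forall>v. (\<exists>Fg\<in>set N. basic_set Fg v) \<longleftrightarrow> (\<exists>Fg\<in>set ?K. basic_set Fg v) \<and> (\<exists>Fg\<in>set M. basic_set Fg v)"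
    using normal_form_and[OF K M(1)] by blast
  have "(\<exists>Fg\<in>set ?K. basic_set Fg v) \<longleftrightarrow> \<not> basic_set a v" for v by auto
  then have "\<forall>v. (\<exists>Fg\<in>set N. basic_set Fg v) \<longleftrightarrow> \<not> (\<exists>Fg\<in>set (a # L). basic_set Fg v)" using N(2) M(2) by simp
  then show ?case using N(1) by blast
qed

lemma normal_form:
  assumes "\<phi> \<in> constructible"
  shows "\<exists>L. wf_basic L \<and> (\<forall>v. (\<exists>Fg\<in>set L. basic_set Fg v) \<longleftrightarrow> \<phi> v)"
  using assms
proof (induction rule: constructible.induct)
  case (constructible_zero f)
  then show ?case by (intro exI[of _ "[([f], \<lambda>v. 1)]"]) (auto intro: polyfn_const)
next
  case (constructible_not \<phi>)
  then obtain L where "wf_basic L" "\<forall>v. (\<exists>Fg\<in>set L. basic_set Fg v) \<longleftrightarrow> \<phi> v" by blast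
  then show ?case using normal_form_not[of L] by simp
next
  case (constructible_and \<phi> \<psi>)
  then obtain L K where "wf_basic L" "\<forall>v. (\<exists>Fg\<in>set L. basic_set Fg v) \<longleftrightarrow> \<phi> v"
    "wf_basic K" "\<forall>v. (\<exists>Fg\<in>set K. basic_set Fg v) \<longleftrightarrow> \<psi> v" by blast
  then show ?case using normal_form_and[of L K] by simp
qed

text \<open>The quantifier distributes over the disjuncts of the normal form, and each disjunct is a
  system in the variable \<open>i\<close> whose coefficients are polynomial functions.\<close>

lemma constructible_ex:
  assumes "\<phi> \<in> constructible"
  shows "(\<lambda>v. \<exists>x. \<phi> (v(i := x))) \<in> constructible"
proof -
  obtain L where L: "wf_basic L" "\<And>v. (\<exists>Fg\<in>set L. basic_set Fg v) \<longleftrightarrow> \<phi> v" using normal_form[OF assms] by blast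
  have list: "\<exists>cs. set cs \<subseteq> polyfn \<and> (\<forall>v x. f (v(i := x)) = poly (ev cs v) x)" if "f \<in> polyfn" for f
    using polyfn_restrict_var[OF that, of i] poly_family_list by metis
  have "(\<lambda>v. \<exists>x. basic_set Fg (v(i := x))) \<in> constructible" if Fg: "Fg \<in> set L" for Fg
  proof -
    have "\<forall>f\<in>insert (snd Fg) (set (fst Fg)). \<exists>cs. set cs \<subseteq> polyfn \<and> (\<forall>v x. f (v(i := x)) = poly (ev cs v) x)"
      using L(1) Fg list by blast
    then obtain c where c: "\<forall>f\<in>insert (snd Fg) (set (fst Fg)). set (c f) \<subseteq> polyfn \<and> (\<forall>v x. f (v(i := x)) = poly (ev (c f) v) x)"
      by (rule bchoice[THEN exE])
    have "solvable (map c (fst Fg)) (c (snd Fg)) \<in> constructible"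
      by (rule solvable_constructible) (use c in auto)
    then show ?thesis by (rule constructible_cong) (use c in simp)
  qed
  then have "(\<lambda>v. \<exists>Fg\<in>set L. \<exists>x. basic_set Fg (v(i := x))) \<in> constructible"
    by (intro constructible_bex) auto
  then show ?thesis by (rule constructible_cong) (use L(2) in blast)
qed

lemma constructible_ex_block:
  assumes "finite I" "\<phi> \<in> constructible"
  shows "(\<lambda>v. \<exists>w. \<phi> (\<lambda>i. if i \<in> I then w i else v i)) \<in> constructible"
  using assms(1)
proof (induction I rule: finite_induct)
  case empty then show ?case using assms(2) by simp
next
  case (insert i I)
  have iff: "(\<exists>w. \<phi> (\<lambda>j. if j \<in> insert i I then w j else v j))
    \<longleftrightarrow> (\<exists>x w. \<phi> (\<lambda>j. if j \<in> I then w j else (v(i := x)) j))" for v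
  proof
    assume "\<exists>w. \<phi> (\<lambda>j. if j \<in> insert i I then w j else v j)"
    then obtain w where "\<phi> (\<lambda>j. if j \<in> insert i I then w j else v j)" ..
    moreover have "(\<lambda>j. if j \<in> insert i I then w j else v j) = (\<lambda>j. if j \<in> I then w j else (v(i := w i)) j)"
      by auto
    ultimately show "\<exists>x w. \<phi> (\<lambda>j. if j \<in> I then w j else (v(i := x)) j)" by metis
  next
    assume "\<exists>x w. \<phi> (\<lambda>j. if j \<in> I then w j else (v(i := x)) j)"
    then obtain x w where "\<phi> (\<lambda>j. if j \<in> I then w j else (v(i := x)) j)" by blast
    moreover have "(\<lambda>j. if j \<in> insert i I then (w(i := x)) j else v j) = (\<lambda>j. if j \<in> I then w j else (v(i := x)) j)"
      using insert(2) by auto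
    ultimately show "\<exists>w. \<phi> (\<lambda>j. if j \<in> insert i I then w j else v j)" by metis
  qed
  show ?case using constructible_ex[OF insert.IH, of i] by (rule constructible_cong) (rule iff)
qed

text \<open>A polynomial vanishes identically or is generically nonzero. Negation exchanges the two
  alternatives, and two conditions that hold generically hold together.\<close>

lemma generic_dichotomy:
  assumes "\<phi> \<in> constructible" and s: "\<And>j. (\<lambda>p. s p j) \<in> poly_funs n"
  shows "for_generic n (\<lambda>p :: nat \<Rightarrow> complex ^ 'd::finite. \<phi> (s p)) \<or> for_generic n (\<lambda>p. \<not> \<phi> (s p))"
  using assms(1)
proof (induction rule: constructible.induct)
  case (constructible_zero f)
  have f: "(\<lambda>p. f (\<lambda>j. s p j)) \<in> poly_funs n" by (rule poly_funs_subst[OF constructible_zero s])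
  show ?case
  proof (cases "\<exists>p. f (s p) \<noteq> 0")
    case True
    then show ?thesis using for_generic_nonzero[OF f] by auto
  next
    case False
    then show ?thesis by (simp add: for_generic_True)
  qed
next
  case (constructible_not \<phi>) then show ?case by auto
next
  case (constructible_and \<phi> \<psi>)
  then show ?case
    using for_generic_conj[of n "\<lambda>p. \<phi> (s p)" "\<lambda>p. \<psi> (s p)"]
      for_generic_mono[of n "\<lambda>p. \<not> \<phi> (s p)" "\<lambda>p. \<not> (\<phi> (s p) \<and> \<psi> (s p))"]
      for_generic_mono[of n "\<lambda>p. \<not> \<psi> (s p)" "\<lambda>p. \<not> (\<phi> (s p) \<and> \<psi> (s p))"] by blast
qed

section \<open>The realisation number\<close>

text \<open>\<open>congruence\<close> freed from the extensionality of configurations, because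
  configurations read off from an environment of variables are total functions.\<close>

definition isometric :: "nat \<Rightarrow> (nat \<Rightarrow> complex ^ 2) \<Rightarrow> (nat \<Rightarrow> complex ^ 2) \<Rightarrow> bool" where
  "isometric n p q \<longleftrightarrow> (\<exists>(A :: complex ^ 2 ^ 2) x. orthogonal_matrix A \<and> (\<forall>i\<in>{1..n}. p i = A *v q i + x))"

lemma congruence_iff: "(p, q) \<in> congruence n \<longleftrightarrow> p \<in> configs n \<and> q \<in> configs n \<and> isometric n p q"
  unfolding congruence_def isometric_def by auto

lemma isometric_cong:
  assumes "\<And>i. i \<in> {1..n} \<Longrightarrow> p i = p' i" "\<And>i. i \<in> {1..n} \<Longrightarrow> q i = q' i"
  shows "isometric n p q \<longleftrightarrow> isometric n p' q'"
  unfolding isometric_def using assms by simp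

lemma isometric_refl: "isometric n p p"
  unfolding isometric_def by (intro exI[of _ "mat 1"] exI[of _ 0]) (simp add: orthogonal_matrix_id)

lemma isometric_sym:
  assumes "isometric n p q" shows "isometric n q p"
proof -
  obtain A :: "complex ^ 2 ^ 2" and x where A: "orthogonal_matrix A" "\<And>i. i \<in> {1..n} \<Longrightarrow> p i = A *v q i + x"
    using assms unfolding isometric_def by blast
  have "q i = transpose A *v p i + (- (transpose A *v x))" if "i \<in> {1..n}" for i
    using A(1) unfolding A(2)[OF that] orthogonal_matrix_def
    by (simp add: matrix_vector_right_distrib matrix_vector_mul_assoc)
  moreover have "orthogonal_matrix (transpose A)" using A(1) by (simp add: orthogonal_matrix_def)
  ultimately show ?thesis unfolding isometric_def by blast
qed

lemma isometric_trans:
  assumes "isometric n p q" "isometric n q r" shows "isometric n p r"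
proof -
  obtain A :: "complex ^ 2 ^ 2" and x where A: "orthogonal_matrix A" "\<And>i. i \<in> {1..n} \<Longrightarrow> p i = A *v q i + x"
    using assms(1) unfolding isometric_def by blast
  obtain B :: "complex ^ 2 ^ 2" and y where B: "orthogonal_matrix B" "\<And>i. i \<in> {1..n} \<Longrightarrow> q i = B *v r i + y"
    using assms(2) unfolding isometric_def by blast
  have "p i = (A ** B) *v r i + (A *v y + x)" if "i \<in> {1..n}" for i
    unfolding A(2)[OF that] B(2)[OF that] by (simp add: matrix_vector_right_distrib matrix_vector_mul_assoc)
  moreover have "orthogonal_matrix (A ** B)"
  proof -
    have "transpose (A ** B) ** (A ** B) = transpose B ** ((transpose A ** A) ** B)"
      by (simp add: matrix_transpose_mul matrix_mul_assoc)
    moreover have "(A ** B) ** transpose (A ** B) = A ** ((B ** transpose B) ** transpose A)"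
      by (simp add: matrix_transpose_mul matrix_mul_assoc)
    ultimately show ?thesis using A(1) B(1) by (simp add: orthogonal_matrix_def)
  qed
  ultimately show ?thesis unfolding isometric_def by blast
qed

lemma congruence_sym:
  fixes p q :: "nat \<Rightarrow> complex ^ 2"
  shows "(p, q) \<in> congruence n \<Longrightarrow> (q, p) \<in> congruence n"
  unfolding congruence_iff using isometric_sym by blast

lemma congruence_trans:
  fixes p q r :: "nat \<Rightarrow> complex ^ 2"
  shows "(p, q) \<in> congruence n \<Longrightarrow> (q, r) \<in> congruence n \<Longrightarrow> (p, r) \<in> congruence n"
  unfolding congruence_iff using isometric_trans[of n p q r] by blast

text \<open>A family of \<open>k\<close> inequivalent points that cannot be enlarged meets every
  class exactly once.\<close>

lemma realisations_card:
  assumes many: "many_realisations n E k p" and notmore: "\<not> many_realisations n E (Suc k) p"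
  shows "finite (realisations n E p) \<and> card (realisations n E p) = k"
proof -
  obtain Q where Q: "Q \<subseteq> fibre n E p" "finite Q" "card Q = k"
    "\<And>q q'. q \<in> Q \<Longrightarrow> q' \<in> Q \<Longrightarrow> q \<noteq> q' \<Longrightarrow> (q, q') \<notin> congruence n"
    using many unfolding many_realisations_def by blast
  let ?c = "\<lambda>q :: nat \<Rightarrow> complex ^ 2. congruence n `` {q}"
  have conf: "q \<in> configs n" if "q \<in> fibre n E p" for q using that by (simp add: fibre_def)
  have cls: "?c q = ?c q'" if "(q, q') \<in> congruence n" for q q'
    using congruence_trans[OF that] congruence_trans[OF congruence_sym[OF that]] by blast
  have inj: "inj_on ?c Q"
  proof (rule inj_onI, rule ccontr)
    fix q q' assume qq: "q \<in> Q" "q' \<in> Q" "?c q = ?c q'" "q \<noteq> q'"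
    have "q' \<in> configs n" using conf Q(1) qq(2) by blast
    then have "q' \<in> ?c q'" using isometric_refl by (simp add: congruence_iff)
    then have "(q, q') \<in> congruence n" using qq(3) by blast
    then show False using Q(4) qq by blast
  qed
  have "\<exists>q\<in>Q. (q, x) \<in> congruence n" if x: "x \<in> fibre n E p" for x
  proof (rule ccontr)
    assume no: "\<not> ?thesis"
    then have xq: "(q, x) \<notin> congruence n" "(x, q) \<notin> congruence n" if "q \<in> Q" for q
      using that congruence_sym by blast+
    have "(x, x) \<in> congruence n" using conf[OF x] isometric_refl by (simp add: congruence_iff)
    then have "x \<notin> Q" using no by blast
    then have "many_realisations n E (Suc k) p"
      unfolding many_realisations_def using Q x xq by (intro exI[of _ "insert x Q"]) auto
    then show False using notmore by simp
  qed
  then have "?c ` fibre n E p \<subseteq> ?c ` Q" using cls by (intro image_subsetI) (metis imageI)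
  moreover have "?c ` Q \<subseteq> ?c ` fibre n E p" by (rule image_mono[OF Q(1)])
  moreover have "realisations n E p = ?c ` fibre n E p"
    unfolding realisations_def fibre_def[symmetric] quotient_def by (rule UNION_singleton_eq_range)
  ultimately have "realisations n E p = ?c ` Q" by (simp only: subset_antisym)
  then show ?thesis using Q(2,3) card_image[OF inj] by simp
qed

section \<open>The number of realisations as a first-order statement\<close>

lemma sqd_cong:
  assumes "simple_graph n E" "e \<in> E" "\<And>i. i \<in> {1..n} \<Longrightarrow> p i = q i"
  shows "sqd p e = sqd q e"
proof -
  obtain a b where "a \<in> {1..n}" "b \<in> {1..n}" "Min e = a" "Max e = b" using simple_graphD[OF assms(1,2)] by metis
  then show ?thesis unfolding sqd_def using assms(3) by simp
qed

text \<open>The set of representatives becomes an indexed family of total functions, which can be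
  stored in finitely many relevant variables.\<close>

lemma many_realisations_iff:
  assumes sg: "simple_graph n E"
  shows "many_realisations n E k p \<longleftrightarrow> (\<exists>qs. (\<forall>j\<in>{1..k}. \<forall>e\<in>E. sqd (qs j) e = sqd p e) \<and>
    (\<forall>j\<in>{1..k}. \<forall>l\<in>{1..k}. j \<noteq> l \<longrightarrow> \<not> isometric n (qs j) (qs l)))"
proof
  assume "many_realisations n E k p"
  then obtain Q where Q: "Q \<subseteq> fibre n E p" "finite Q" "card Q = k"
    "\<And>q q'. q \<in> Q \<Longrightarrow> q' \<in> Q \<Longrightarrow> q \<noteq> q' \<Longrightarrow> (q, q') \<notin> congruence n"
    unfolding many_realisations_def by blast
  obtain h where h: "bij_betw h {1..k} Q" using ex_bij_betw_nat_finite_1[OF Q(2)] Q(3) by auto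
  have hQ: "h j \<in> Q" if "j \<in> {1..k}" for j using h that by (auto simp: bij_betw_def)
  have "sqd (h j) e = sqd p e" if "j \<in> {1..k}" "e \<in> E" for j e
    using hQ[OF that(1)] Q(1) that(2) unfolding fibre_def measurement_eq_iff by auto
  moreover have "\<not> isometric n (h j) (h l)" if jl: "j \<in> {1..k}" "l \<in> {1..k}" "j \<noteq> l" for j l
  proof -
    have "h j \<noteq> h l" using inj_onD[OF bij_betw_imp_inj_on[OF h], of j l] jl by blast
    then have "(h j, h l) \<notin> congruence n" using Q(4) hQ jl by blast
    moreover have "h j \<in> configs n" "h l \<in> configs n" using hQ jl Q(1) by (auto simp: fibre_def)
    ultimately show ?thesis by (simp add: congruence_iff)
  qed
  ultimately show "\<exists>qs. (\<forall>j\<in>{1..k}. \<forall>e\<in>E. sqd (qs j) e = sqd p e) \<and>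
    (\<forall>j\<in>{1..k}. \<forall>l\<in>{1..k}. j \<noteq> l \<longrightarrow> \<not> isometric n (qs j) (qs l))" by blast
next
  assume "\<exists>qs. (\<forall>j\<in>{1..k}. \<forall>e\<in>E. sqd (qs j) e = sqd p e) \<and>
    (\<forall>j\<in>{1..k}. \<forall>l\<in>{1..k}. j \<noteq> l \<longrightarrow> \<not> isometric n (qs j) (qs l))"
  then obtain qs where qs: "\<And>j e. j \<in> {1..k} \<Longrightarrow> e \<in> E \<Longrightarrow> sqd (qs j) e = sqd p e"
    "\<And>j l. j \<in> {1..k} \<Longrightarrow> l \<in> {1..k} \<Longrightarrow> j \<noteq> l \<Longrightarrow> \<not> isometric n (qs j) (qs l)" by blast
  define r where "r = (\<lambda>j. restrict (qs j) {1..n})"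
  have ri: "r j i = qs j i" if "i \<in> {1..n}" for i j using that by (simp add: r_def)
  have nc: "\<not> isometric n (r j) (r l)" if "j \<in> {1..k}" "l \<in> {1..k}" "j \<noteq> l" for j l
    using qs(2)[OF that] isometric_cong[of n "r j" "qs j" "r l" "qs l", OF ri ri] by blast
  have inj: "inj_on r {1..k}"
  proof (rule inj_onI, rule ccontr)
    fix j l assume "j \<in> {1..k}" "l \<in> {1..k}" "r j = r l" "j \<noteq> l"
    then show False using nc[of j l] isometric_refl by simp
  qed
  have "r ` {1..k} \<subseteq> fibre n E p"
  proof (rule image_subsetI)
    fix j assume j: "j \<in> {1..k}"
    have "sqd (r j) e = sqd p e" if "e \<in> E" for e
      using qs(1)[OF j that] sqd_cong[OF sg that, of "r j" "qs j", OF ri] by simp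
    then show "r j \<in> fibre n E p" unfolding fibre_def measurement_eq_iff r_def using restrict_configs by blast
  qed
  moreover have "card (r ` {1..k}) = k" using card_image[OF inj] by simp
  moreover have "\<forall>q\<in>r ` {1..k}. \<forall>q'\<in>r ` {1..k}. q \<noteq> q' \<longrightarrow> (q, q') \<notin> congruence n"
  proof (intro ballI impI)
    fix q q' assume "q \<in> r ` {1..k}" "q' \<in> r ` {1..k}" "q \<noteq> q'"
    then obtain j l where "j \<in> {1..k}" "l \<in> {1..k}" "j \<noteq> l" "q = r j" "q' = r l" by blast
    then show "(q, q') \<notin> congruence n" using nc[of j l] unfolding congruence_iff by blast
  qed
  ultimately show "many_realisations n E k p" unfolding many_realisations_def by blast
qed

text \<open>Several configurations, and a matrix with a translation vector, are stored in one environment: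
  the entry \<open>(j, i, c)\<close> is coordinate \<open>c\<close> of vertex \<open>i\<close> in the \<open>j\<close>-th configuration.\<close>

definition layer :: "(nat \<times> nat \<times> 2 \<Rightarrow> complex) \<Rightarrow> nat \<Rightarrow> nat \<Rightarrow> complex ^ 2" where
  "layer v j i = (\<chi> c. v (j, i, c))"

definition layer_matrix :: "(nat \<times> nat \<times> 2 \<Rightarrow> complex) \<Rightarrow> nat \<Rightarrow> complex ^ 2 ^ 2" where
  "layer_matrix v j = (\<chi> r. layer v j (if r = 1 then 1 else 2))"

lemma polyfn_layer: "(\<lambda>v. layer v j i $ c) \<in> polyfn"
  unfolding layer_def by (simp add: polyfn_var)

lemma polyfn_layer_matrix: "(\<lambda>v. layer_matrix v j $ r $ c) \<in> polyfn"
  unfolding layer_matrix_def by (simp add: polyfn_layer)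

text \<open>Matrix and translation are existentially quantified variables, stored in layer
  \<open>m\<close> so that they cannot overlap the layers \<open>j\<close> and
  \<open>l\<close>.\<close>

lemma constructible_isometric:
  assumes jl: "j < m" "l < m"
  shows "(\<lambda>v. isometric n (layer v j) (layer v l)) \<in> constructible"
proof -
  \<comment> \<open>Within layer \<open>m\<close>, index 0 holds the translation and the indices 1
    and 2 hold the rows of the matrix.\<close>
  let ?I = "{m} \<times> {0..2} \<times> (UNIV :: 2 set)"
  define \<psi> where "\<psi> = (\<lambda>v. orthogonal_matrix (layer_matrix v m) \<and>
    (\<forall>i\<in>{1..n}. layer v j i = layer_matrix v m *v layer v l i + layer v m 0))"
  have sum: "(\<lambda>v. \<Sum>k\<in>(UNIV :: 2 set). f k v * g k v) \<in> polyfn" if "\<And>k. f k \<in> polyfn" "\<And>k. g k \<in> polyfn"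
    for f g :: "2 \<Rightarrow> (nat \<times> nat \<times> 2 \<Rightarrow> complex) \<Rightarrow> complex"
    by (intro polyfn_sum polyfn_mult that)
  have eq: "\<psi> v \<longleftrightarrow> ((\<forall>a\<in>UNIV. \<forall>b\<in>UNIV. (\<Sum>k\<in>UNIV. layer_matrix v m $ k $ a * layer_matrix v m $ k $ b) = (if a = b then 1 else 0)) \<and>
      (\<forall>a\<in>UNIV. \<forall>b\<in>UNIV. (\<Sum>k\<in>UNIV. layer_matrix v m $ a $ k * layer_matrix v m $ b $ k) = (if a = b then 1 else 0))) \<and>
    (\<forall>i\<in>{1..n}. \<forall>c\<in>UNIV. layer v j i $ c = (\<Sum>k\<in>UNIV. layer_matrix v m $ c $ k * layer v l i $ k) + layer v m 0 $ c)" for v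
    unfolding \<psi>_def orthogonal_matrix_def
    by (simp add: vec_eq_iff matrix_matrix_mult_def transpose_def mat_def matrix_vector_mult_def)
  have "\<psi> \<in> constructible"
    by (rule constructible_cong[OF _ eq])
       (intro constructible_and constructible_ball constructible_eq sum polyfn_add polyfn_layer polyfn_layer_matrix polyfn_const finite finite_atLeastAtMost)
  from constructible_ex_block[OF _ this, of ?I]
  have "(\<lambda>v. \<exists>w. \<psi> (\<lambda>i. if i \<in> ?I then w i else v i)) \<in> constructible" by simp
  moreover have "isometric n (layer v j) (layer v l) \<longleftrightarrow> (\<exists>w. \<psi> (\<lambda>i. if i \<in> ?I then w i else v i))" for v
  proof -
    have same: "layer (\<lambda>i. if i \<in> ?I then w i else v i) j = layer v j"
      "layer (\<lambda>i. if i \<in> ?I then w i else v i) l = layer v l" for w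
      using jl by (auto simp: layer_def fun_eq_iff)
    show ?thesis
    proof
      assume "isometric n (layer v j) (layer v l)"
      then obtain A :: "complex ^ 2 ^ 2" and x where A: "orthogonal_matrix A"
        "\<forall>i\<in>{1..n}. layer v j i = A *v layer v l i + x" unfolding isometric_def by blast
      let ?w = "\<lambda>(s :: nat, i :: nat, c). if i = 0 then x $ c else if i = 1 then A $ 1 $ c else A $ 2 $ c"
      have "layer_matrix (\<lambda>i. if i \<in> ?I then ?w i else v i) m = A"
        by (simp add: layer_matrix_def layer_def vec_eq_iff forall_2)
      moreover have "layer (\<lambda>i. if i \<in> ?I then ?w i else v i) m 0 = x"
        by (simp add: layer_def vec_eq_iff)
      ultimately have "\<psi> (\<lambda>i. if i \<in> ?I then ?w i else v i)" unfolding \<psi>_def same using A by simp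
      then show "\<exists>w. \<psi> (\<lambda>i. if i \<in> ?I then w i else v i)" by blast
    next
      assume "\<exists>w. \<psi> (\<lambda>i. if i \<in> ?I then w i else v i)"
      then show "isometric n (layer v j) (layer v l)" unfolding \<psi>_def same isometric_def by blast
    qed
  qed
  ultimately show ?thesis by (rule constructible_cong)
qed

text \<open>The given configuration occupies layer 0 as free variables, and the representatives in
  the layers 1 to \<open>k\<close> are quantified away. What remains is a constructible condition on
  the coordinates of \<open>p\<close>.\<close>

lemma many_realisations_dichotomy:
  assumes sg: "simple_graph n E"
  shows "for_generic n (many_realisations n E k) \<or> for_generic n (\<lambda>p. \<not> many_realisations n E k p)"
proof -
  let ?I = "{1..k} \<times> {1..n} \<times> (UNIV :: 2 set)"
  define \<psi> where "\<psi> = (\<lambda>v. (\<forall>j\<in>{1..k}. \<forall>e\<in>E. sqd (layer v j) e = sqd (layer v 0) e) \<and>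
    (\<forall>j\<in>{1..k}. \<forall>l\<in>{1..k}. j = l \<or> \<not> isometric n (layer v j) (layer v l)))"
  define \<phi> where "\<phi> = (\<lambda>v. \<exists>w. \<psi> (\<lambda>i. if i \<in> ?I then w i else v i))"
  have finE: "finite E" by (rule simple_graph_finite[OF sg])
  have sq: "(\<lambda>v. sqd (layer v j) e) \<in> polyfn" for j e
    unfolding sqd_def by (intro polyfn_sum polyfn_power polyfn_minus polyfn_layer)
  \<comment> \<open>Layer \<open>Suc k\<close>, beyond all representatives, hosts the
    isometries.\<close>
  have "\<psi> \<in> constructible" unfolding \<psi>_def
    by (intro constructible_and constructible_ball constructible_or constructible_not constructible_eq constructible_const
        constructible_isometric[of _ "Suc k"] sq finE) auto
  then have \<phi>: "\<phi> \<in> constructible" unfolding \<phi>_def by (intro constructible_ex_block) auto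
  define s where "s = (\<lambda>(p :: nat \<Rightarrow> complex ^ 2) (j :: nat, i, c). if j = 0 \<and> i \<in> {1..n} then p i $ c else 0)"
  have s: "(\<lambda>p. s p x) \<in> poly_funs n" for x
  proof -
    obtain j i c where x: "x = (j, i, c)" by (cases x)
    show ?thesis by (cases "j = 0 \<and> i \<in> {1..n}") (auto simp: x s_def intro: poly_funs.coord poly_funs.const)
  qed
  have iff: "\<phi> (s p) \<longleftrightarrow> many_realisations n E k p" for p
  proof -
    have l0: "layer (\<lambda>i. if i \<in> ?I then w i else s p i) 0 i = p i" if "i \<in> {1..n}" for w i
      using that by (simp add: layer_def s_def vec_eq_iff)
    show ?thesis unfolding many_realisations_iff[OF sg]
    proof
      assume "\<phi> (s p)"
      then obtain w where w: "\<psi> (\<lambda>i. if i \<in> ?I then w i else s p i)" unfolding \<phi>_def by blast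
      let ?v = "\<lambda>i. if i \<in> ?I then w i else s p i"
      have v0: "sqd (layer ?v 0) e = sqd p e" if "e \<in> E" for e by (rule sqd_cong[OF sg that l0])
      show "\<exists>qs. (\<forall>j\<in>{1..k}. \<forall>e\<in>E. sqd (qs j) e = sqd p e) \<and>
        (\<forall>j\<in>{1..k}. \<forall>l\<in>{1..k}. j \<noteq> l \<longrightarrow> \<not> isometric n (qs j) (qs l))"
      proof (intro exI[of _ "layer ?v"] conjI ballI impI)
        fix j e assume "j \<in> {1..k}" "e \<in> E"
        then have "sqd (layer ?v j) e = sqd (layer ?v 0) e" using w unfolding \<psi>_def by blast
        then show "sqd (layer ?v j) e = sqd p e" unfolding v0[OF \<open>e \<in> E\<close>] .
      next
        fix j l assume "j \<in> {1..k}" "l \<in> {1..k}" "j \<noteq> l"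
        then show "\<not> isometric n (layer ?v j) (layer ?v l)" using w unfolding \<psi>_def by blast
      qed
    next
      assume "\<exists>qs. (\<forall>j\<in>{1..k}. \<forall>e\<in>E. sqd (qs j) e = sqd p e) \<and>
        (\<forall>j\<in>{1..k}. \<forall>l\<in>{1..k}. j \<noteq> l \<longrightarrow> \<not> isometric n (qs j) (qs l))"
      then obtain qs where qs: "\<And>j e. j \<in> {1..k} \<Longrightarrow> e \<in> E \<Longrightarrow> sqd (qs j) e = sqd p e"
        "\<And>j l. j \<in> {1..k} \<Longrightarrow> l \<in> {1..k} \<Longrightarrow> j \<noteq> l \<Longrightarrow> \<not> isometric n (qs j) (qs l)" by blast
      let ?w = "\<lambda>(j, i, c). qs j i $ c"
      let ?v = "\<lambda>i. if i \<in> ?I then ?w i else s p i"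
      have lj: "layer ?v j i = qs j i" if "j \<in> {1..k}" "i \<in> {1..n}" for j i
        using that by (simp add: layer_def vec_eq_iff)
      have "sqd (layer ?v j) e = sqd (layer ?v 0) e" if "j \<in> {1..k}" "e \<in> E" for j e
      proof -
        have "sqd (layer ?v j) e = sqd (qs j) e" by (rule sqd_cong[OF sg that(2) lj[OF that(1)]])
        moreover have "sqd (layer ?v 0) e = sqd p e" by (rule sqd_cong[OF sg that(2) l0])
        ultimately show ?thesis using qs(1)[OF that] by simp
      qed
      moreover have "\<not> isometric n (layer ?v j) (layer ?v l)" if "j \<in> {1..k}" "l \<in> {1..k}" "j \<noteq> l" for j l
        using qs(2)[OF that] isometric_cong[of n "layer ?v j" "qs j" "layer ?v l" "qs l", OF lj[OF that(1)] lj[OF that(2)]]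
        by blast
      ultimately have "\<psi> ?v" unfolding \<psi>_def by blast
      then show "\<phi> (s p)" unfolding \<phi>_def by blast
    qed
  qed
  show ?thesis using generic_dichotomy[where s = s, OF \<phi> s] unfolding iff .
qed

theorem corollary5p11:
  fixes n :: nat and E :: "nat set set"
  assumes "simple_graph n E"
    and "n \<ge> 3"
    and "minimally_rigid_graph TYPE(2) n E"
  shows "tutte (graphic_matroid E) (1::int) 0 = \<bar>coeff (characteristic_poly (graphic_matroid E)) 0\<bar>
    \<and> \<bar>coeff (characteristic_poly (graphic_matroid E)) 0\<bar> = \<bar>coeff (chromatic_poly n E) 1\<bar>
    \<and> 2 * int (realisation_number TYPE(2) n E) \<le> tutte (graphic_matroid E) (1::int) 0"
proof -
  note sg = assms(1) and n = assms(2)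
  have rig: "rigid_graph TYPE(2) n E" using assms(3) unfolding minimally_rigid_graph_def by simp
  have conn: "connected_graph n E"
    unfolding connected_graph_def using rigid_connected[OF rig] by blast
  have card: "2 * n - 3 \<le> card E" by (rule rigid_edge_count[OF sg n rig])
  have ai: "alg_indep E" by (rule minimally_rigid_alg_indep[OF sg assms(3)])
  obtain ord :: "nat set \<Rightarrow> nat" where ord: "inj_on ord E"
    using finite_imp_inj_to_nat_seg[OF simple_graph_finite[OF sg]] by blast
  define T where "T = card {A. nbc ord E A \<and> card A = n - 1}"
  have n1: "n \<ge> 1" using n by simp
  note inv = three_invariants[OF sg conn n1 ord, folded T_def]
  have bound: "2 * k \<le> T" if "for_generic n (many_realisations n E k)" for k
    by (rule fibre_bound[OF sg conn n card ai ord T_def that])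
  \<comment> \<open>There is a greatest \<open>k\<close> such that \<open>k\<close> classes occur
    generically: zero classes always do, and \<open>bound\<close> caps their number.\<close>
  have "for_generic n (many_realisations n E 0)"
    by (rule for_generic_mono[OF for_generic_True]) (auto simp: many_realisations_def)
  moreover have "\<forall>k. for_generic n (many_realisations n E k) \<longrightarrow> k < Suc T" using bound by fastforce
  ultimately obtain k where k: "for_generic n (many_realisations n E k)"
    "\<And>l. for_generic n (many_realisations n E l) \<Longrightarrow> l \<le> k"
    using ex_has_greatest_nat[of "\<lambda>k. for_generic n (many_realisations n E k)" 0 "\<lambda>k. k" "Suc T"] by blast
  have "\<not> for_generic n (many_realisations n E (Suc k))" using k(2)[of "Suc k"] by auto
  \<comment> \<open>By the dichotomy, not holding generically means failing generically, so a
    generic fibre has exactly \<open>k\<close> classes.\<close>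
  then have "for_generic n (\<lambda>p. \<not> many_realisations n E (Suc k) p)" using many_realisations_dichotomy[OF sg] by blast
  from for_generic_conj[OF k(1) this]
  have gen: "for_generic n (\<lambda>p :: nat \<Rightarrow> complex ^ 2. finite (realisations n E p) \<and> card (realisations n E p) = k)"
    by (rule for_generic_mono) (use realisations_card in blast)
  have "realisation_number TYPE(2) n E = k"
    unfolding realisation_number_def
  proof (rule the_equality)
    show "for_generic n (\<lambda>p :: nat \<Rightarrow> complex ^ 2. finite (realisations n E p) \<and> card (realisations n E p) = k)" by (rule gen)
    fix N assume "for_generic n (\<lambda>p :: nat \<Rightarrow> complex ^ 2. finite (realisations n E p) \<and> card (realisations n E p) = N)"
    \<comment> \<open>Two generic conditions are met by a common configuration, whose number of
      classes is then both \<open>k\<close> and \<open>N\<close>.\<close>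
    from for_generic_ex[OF for_generic_conj[OF gen this]] show "N = k" by auto
  qed
  then have "2 * realisation_number TYPE(2) n E \<le> T" using bound[OF k(1)] by simp
  moreover have "\<bar>(-1 :: int) ^ (n - 1) * int T\<bar> = int T" by (simp add: abs_mult power_abs)
  ultimately show ?thesis using inv by simp
qed

end
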